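(* Let $(\mathcal M,\mathring g)$ be an $n$-dimensional asymptotically hyperbolic manifold. For every $\epsilon>0$ and every $\delta\in\,]-(n+1)/2,\,-1[$, there exists $R_{\epsilon,\delta}>0$ such that for all $R>R_{\epsilon,\delta}$ there exists a constant $c>0$ such that $$\forall N\in C^\infty_c(E_R),\qquad \|N\|_{2,2,-\delta;E_R}\le c\,\|\mathring T(N)\|_{2,-\delta;E_R}.$$
   Context: **Background.** $\bar{\mathcal M}$ is a compact smooth $n$-manifold with boundary $\partial_\infty\mathcal M$ and $\mathcal M=\bar{\mathcal M}\setminus\partial_\infty\mathcal M$. $\rho\in C^\infty(\bar{\mathcal M})$ is a defining function: $\rho\ge0$, $\partial_\infty\mathcal M=\{\rho=0\}$, $d\rho\ne0$ on $\partial_\infty\mathcal M$. $\mathring g=\rho^{-2}\mathring h$ is asymptotically hyperbolic: $\mathring h$ is a smooth Riemannian metric on $\bar{\mathcal M}$ and $|d\rho|_{\mathring h}^2=1$ on $\partial_\infty\mathcal M$. $\mathring\nabla$ is the Levi-Civita connection of $\mathring g$. **Notation.** $E_R=\{x\in\mathcal M:\rho(x)\le e^{-2R}\}$. $C_c^\infty(E_R)$ is the set of smooth functions on $E_R$ with compact support in $E_R$; such functions vanish near $\partial_\infty\mathcal M$ but not necessarily on the inner boundary $\{\rho=e^{-2R}\}$. $\mathring T(N)=\mathring\nabla^2N-N\mathring g$. For a domain $U\subset\mathcal M$, $\|u\|_{2,s;U}=\big(\int_U|u|^2_{\mathring g}\rho^{2s}d\mu(\mathring g)\big)^{1/2}$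 and $\|u\|_{k,2,s;U}=\sum_{j\le k}\|\mathring\nabla^ju\|_{2,s;U}$. *)

theory Defs
  imports "HOL-Analysis.Analysis"
begin

section \<open>Smooth functions on subsets of coordinate space\<close>

primrec iter_partial :: "'n::finite list \<Rightarrow> (real^'n \<Rightarrow> real) \<Rightarrow> real^'n \<Rightarrow> real" where
  "iter_partial [] f = f"
| "iter_partial (i # I) f =
     (\<lambda>x. frechet_derivative (iter_partial I f) (at x) (axis i 1))"

text \<open>As usual for sets that need not be open (half-balls, sublevel sets), smoothness means
  the local existence of smooth extensions.\<close>

definition smooth_on :: "(real^'n::finite) set \<Rightarrow> (real^'n \<Rightarrow> real) \<Rightarrow> bool" where
  "smooth_on S f \<longleftrightarrow>
     (\<forall>x\<in>S. \<exists>U e. open U \<and> x \<in> U \<and> (\<forall>I. iter_partial I e differentiable_on U) \<and>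
        (\<forall>y\<in>S \<inter> U. e y = f y))"


section \<open>Smooth manifolds with boundary\<close>

text \<open>A chart is a pair of a domain and a coordinate map; the dimension is \<open>CARD('n)\<close>.
  The boundary coordinate is an arbitrary but fixed element of the index type.\<close>

type_synonym ('a, 'n) chart = "'a set \<times> ('a \<Rightarrow> real^'n)"

definition bdry_index :: "'n::finite" where
  "bdry_index = (SOME k. True)"

definition half_space :: "(real^'n::finite) set" where
  "half_space = {x. 0 \<le> x $ bdry_index}"

definition is_chart :: "'a topology \<Rightarrow> ('a, 'n::finite) chart \<Rightarrow> bool" where
  "is_chart X c \<longleftrightarrow> openin X (fst c) \<and>
     openin (top_of_set half_space) (snd c ` fst c) \<and>
     homeomorphic_map (subtopology X (fst c)) (top_of_set (snd c ` fst c)) (snd c)"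

text \<open>\<open>smooth_in_chart D c f\<close> and \<open>coord_deriv D c i f p\<close> depend only on the values of \<open>f\<close>
  on \<open>D\<close>: derivatives are taken within the coordinate image of \<open>D\<close>, i.e. they are one-sided
  at points where \<open>D\<close> has a boundary.\<close>

definition smooth_in_chart :: "'a set \<Rightarrow> ('a, 'n::finite) chart \<Rightarrow> ('a \<Rightarrow> real) \<Rightarrow> bool" where
  "smooth_in_chart D c f \<longleftrightarrow> smooth_on (snd c ` (fst c \<inter> D)) (f \<circ> inv_into (fst c) (snd c))"

definition coord_deriv ::
    "'a set \<Rightarrow> ('a, 'n::finite) chart \<Rightarrow> 'n \<Rightarrow> ('a \<Rightarrow> real) \<Rightarrow> 'a \<Rightarrow> real" where
  "coord_deriv D c i f p =
     frechet_derivative (f \<circ> inv_into (fst c) (snd c))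
       (at (snd c p) within snd c ` (fst c \<inter> D)) (axis i 1)"

definition compact_manifold_with_boundary :: "'a topology \<Rightarrow> ('a, 'n::finite) chart set \<Rightarrow> bool" where
  "compact_manifold_with_boundary X A \<longleftrightarrow>
     compact_space X \<and> Hausdorff_space X \<and> second_countable X \<and>
     (\<forall>c\<in>A. is_chart X c) \<and> (\<Union>c\<in>A. fst c) = topspace X \<and>
     (\<forall>c\<in>A. \<forall>d\<in>A. \<forall>k. smooth_in_chart (fst d) c (\<lambda>p. snd d p $ k))"

definition bdry :: "('a, 'n::finite) chart set \<Rightarrow> 'a set" where
  "bdry A = {p. \<exists>c\<in>A. p \<in> fst c \<and> snd c p $ bdry_index = 0}"

definition smooth_fun_on :: "('a, 'n::finite) chart set \<Rightarrow> 'a set \<Rightarrow> ('a \<Rightarrow> real) \<Rightarrow> bool" where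
  "smooth_fun_on A D f \<longleftrightarrow> (\<forall>c\<in>A. smooth_in_chart D c f)"


section \<open>Tensor fields and Riemannian metrics\<close>

text \<open>Covariant tensor fields are given by their components in each chart: a rank-\<open>j\<close> tensor
  has components indexed by lists of length \<open>j\<close>. Metrics are stored as matrices.\<close>

type_synonym ('a, 'n) tensor = "('a, 'n) chart \<Rightarrow> 'a \<Rightarrow> 'n list \<Rightarrow> real"
type_synonym ('a, 'n) metric = "('a, 'n) chart \<Rightarrow> 'a \<Rightarrow> real^'n^'n"

definition riemannian_metric :: "('a, 'n::finite) chart set \<Rightarrow> ('a, 'n) metric \<Rightarrow> bool" where
  "riemannian_metric A h \<longleftrightarrow>
     (\<forall>c\<in>A. \<forall>i j. smooth_in_chart UNIV c (\<lambda>p. h c p $ i $ j)) \<and>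
     (\<forall>c\<in>A. \<forall>p\<in>fst c. transpose (h c p) = h c p \<and> (\<forall>v. v \<noteq> 0 \<longrightarrow> 0 < v \<bullet> (h c p *v v))) \<and>
     (\<forall>c\<in>A. \<forall>d\<in>A. \<forall>p\<in>fst c \<inter> fst d. \<forall>i j.
        h c p $ i $ j =
          (\<Sum>k\<in>UNIV. \<Sum>l\<in>UNIV. coord_deriv (fst d) c i (\<lambda>q. snd d q $ k) p *
             coord_deriv (fst d) c j (\<lambda>q. snd d q $ l) p * h d p $ k $ l))"

definition christoffel ::
    "('a, 'n::finite) metric \<Rightarrow> ('a, 'n) chart \<Rightarrow> 'a \<Rightarrow> 'n \<Rightarrow> 'n \<Rightarrow> 'n \<Rightarrow> real" where
  "christoffel g c p l i j =
     (\<Sum>m\<in>UNIV. matrix_inv (g c p) $ l $ m *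
        (coord_deriv UNIV c i (\<lambda>q. g c q $ m $ j) p
         + coord_deriv UNIV c j (\<lambda>q. g c q $ m $ i) p
         - coord_deriv UNIV c m (\<lambda>q. g c q $ i $ j) p)) / 2"

definition scalar :: "('a \<Rightarrow> real) \<Rightarrow> ('a, 'n::finite) tensor" where
  "scalar f c p I = f p"

text \<open>Levi-Civita covariant derivative on the domain \<open>D\<close>, the index of differentiation coming
  first: \<open>(\<nabla>T)\<^sub>i\<^sub>J\<close> is \<open>\<partial>\<^sub>i T\<^sub>J\<close> minus the sum over the positions \<open>m\<close> of \<open>J\<close> of
  \<open>\<Gamma>\<^sup>l\<close> with lower indices \<open>i\<close>, \<open>J ! m\<close>, contracted with the \<open>m\<close>-th slot of \<open>T\<close>.\<close>

definition cov_deriv ::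
    "('a, 'n::finite) metric \<Rightarrow> 'a set \<Rightarrow> ('a, 'n) tensor \<Rightarrow> ('a, 'n) tensor" where
  "cov_deriv g D T c p I =
     (let i = hd I; J = tl I in
      coord_deriv D c i (\<lambda>q. T c q J) p
      - (\<Sum>m<length J. \<Sum>l\<in>UNIV. christoffel g c p l i (J ! m) * T c p (J[m := l])))"

definition differential :: "'a set \<Rightarrow> ('a \<Rightarrow> real) \<Rightarrow> ('a, 'n::finite) tensor" where
  "differential D f c p I = coord_deriv D c (hd I) f p"

text \<open>The pointwise norm of a tensor does not depend on the chart in which it is computed.\<close>

definition chart_at :: "('a, 'n) chart set \<Rightarrow> 'a \<Rightarrow> ('a, 'n) chart" where
  "chart_at A p = (SOME c. c \<in> A \<and> p \<in> fst c)"

definition tensor_norm ::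
    "('a, 'n::finite) chart set \<Rightarrow> ('a, 'n) metric \<Rightarrow> nat \<Rightarrow> ('a, 'n) tensor \<Rightarrow> 'a \<Rightarrow> real" where
  "tensor_norm A g j T p =
     (let c = chart_at A p in
      sqrt (\<Sum>I | length I = j. \<Sum>J | length J = j.
        (\<Prod>m<j. matrix_inv (g c p) $ (I ! m) $ (J ! m)) * T c p I * T c p J))"

text \<open>The Riemannian measure of a metric \<open>g\<close> on an open set \<open>M\<close> of interior points: the
  (unique) Borel measure with density \<open>sqrt (det g)\<close> in every chart.\<close>

definition riemannian_measure ::
    "'a topology \<Rightarrow> ('a, 'n::finite) chart set \<Rightarrow> 'a set \<Rightarrow> ('a, 'n) metric \<Rightarrow> 'a measure \<Rightarrow> bool"
  where
  "riemannian_measure X A M g \<mu> \<longleftrightarrow>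
     space \<mu> = M \<and> sets \<mu> = sigma_sets M {V. openin (subtopology X M) V} \<and>
     (\<forall>c\<in>A. \<forall>B\<in>sets \<mu>. B \<subseteq> fst c \<longrightarrow>
        emeasure \<mu> B =
          (\<integral>\<^sup>+x\<in>snd c ` B. ennreal (sqrt (det (g c (inv_into (fst c) (snd c) x)))) \<partial>lborel))"


section \<open>Asymptotically hyperbolic manifolds\<close>

definition defining_function ::
    "'a topology \<Rightarrow> ('a, 'n::finite) chart set \<Rightarrow> ('a \<Rightarrow> real) \<Rightarrow> bool" where
  "defining_function X A \<rho> \<longleftrightarrow>
     smooth_fun_on A UNIV \<rho> \<and> (\<forall>p\<in>topspace X. 0 \<le> \<rho> p) \<and>
     bdry A = {p \<in> topspace X. \<rho> p = 0} \<and>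
     (\<forall>p\<in>bdry A. \<forall>c\<in>A. p \<in> fst c \<longrightarrow> (\<exists>i. coord_deriv UNIV c i \<rho> p \<noteq> 0))"

text \<open>\<open>X\<close> and \<open>A\<close> describe the compactified manifold, \<open>h\<close> is the compactified metric.\<close>

definition asymptotically_hyperbolic ::
    "'a topology \<Rightarrow> ('a, 'n::finite) chart set \<Rightarrow> ('a \<Rightarrow> real) \<Rightarrow> ('a, 'n) metric \<Rightarrow> bool" where
  "asymptotically_hyperbolic X A \<rho> h \<longleftrightarrow>
     compact_manifold_with_boundary X A \<and> defining_function X A \<rho> \<and> riemannian_metric A h \<and>
     (\<forall>p\<in>bdry A. (tensor_norm A h 1 (differential UNIV \<rho>) p)\<^sup>2 = 1)"

definition interior_part :: "'a topology \<Rightarrow> ('a, 'n::finite) chart set \<Rightarrow> 'a set" where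
  "interior_part X A = topspace X - bdry A"

definition ah_metric :: "('a \<Rightarrow> real) \<Rightarrow> ('a, 'n::finite) metric \<Rightarrow> ('a, 'n) metric" where
  "ah_metric \<rho> h c p = (1 / (\<rho> p)\<^sup>2) *\<^sub>R h c p"

definition end_set :: "'a topology \<Rightarrow> ('a, 'n::finite) chart set \<Rightarrow> ('a \<Rightarrow> real) \<Rightarrow> real \<Rightarrow> 'a set" where
  "end_set X A \<rho> R = {p \<in> interior_part X A. \<rho> p \<le> exp (- 2 * R)}"

text \<open>Only the values on \<open>E\<close> matter. The support is the closure, relative to \<open>E\<close>, of the
  non-zero set, so it may meet the part of the topological boundary of \<open>E\<close> contained in \<open>E\<close>.\<close>

definition smooth_compact_support ::
    "'a topology \<Rightarrow> ('a, 'n::finite) chart set \<Rightarrow> 'a set \<Rightarrow> ('a \<Rightarrow> real) set" where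
  "smooth_compact_support X A E =
     {N. smooth_fun_on A E N \<and>
         compactin (subtopology X E) (subtopology X E closure_of {p \<in> E. N p \<noteq> 0})}"

definition T_op ::
    "('a, 'n::finite) metric \<Rightarrow> 'a set \<Rightarrow> ('a \<Rightarrow> real) \<Rightarrow> ('a, 'n) tensor" where
  "T_op g D N c p I =
     cov_deriv g D (cov_deriv g D (scalar N)) c p I - N p * g c p $ (I ! 0) $ (I ! 1)"

definition weighted_norm ::
    "('a, 'n::finite) chart set \<Rightarrow> ('a, 'n) metric \<Rightarrow> ('a \<Rightarrow> real) \<Rightarrow> 'a measure \<Rightarrow>
     real \<Rightarrow> 'a set \<Rightarrow> nat \<Rightarrow> ('a, 'n) tensor \<Rightarrow> real" where
  "weighted_norm A g \<rho> \<mu> s D j T =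
     sqrt (LINT p:D|\<mu>. (tensor_norm A g j T p)\<^sup>2 * \<rho> p powr (2 * s))"

definition weighted_sobolev_norm ::
    "('a, 'n::finite) chart set \<Rightarrow> ('a, 'n) metric \<Rightarrow> ('a \<Rightarrow> real) \<Rightarrow> 'a measure \<Rightarrow>
     nat \<Rightarrow> real \<Rightarrow> 'a set \<Rightarrow> ('a \<Rightarrow> real) \<Rightarrow> real" where
  "weighted_sobolev_norm A g \<rho> \<mu> k s D u =
     (\<Sum>j\<le>k. weighted_norm A g \<rho> \<mu> s D j ((cov_deriv g D ^^ j) (scalar u)))"

end

theory Submission
  imports Defs
begin

text \<open>
  Put \<open>t = - ln \<rho>\<close>, \<open>s = - \<delta>\<close> and \<open>p = \<langle>\<nabla>N, \<nabla>t\<rangle>\<close>. Near infinity \<open>|dt|\<close> tends to \<open>1\<close> and \<open>\<nabla>\<^sup>2t\<close> to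
  \<open>g - dt dt\<close>, because \<open>g = \<rho>\<^sup>-\<^sup>2 h\<close> and \<open>h\<close> is smooth up to the boundary. For
  \<open>Z = (K (N + p)\<^sup>2 + \<kappa> (N - p)\<^sup>2) \<nabla>t + N \<nabla>N\<close> with \<open>\<kappa>\<close> slightly above \<open>1/4\<close> and \<open>K\<close> large, the flux
  \<open>\<langle>Z, \<nabla>t\<rangle>\<close> is nonnegative and, as \<open>s < (n + 1)/2\<close>, the divergence of \<open>\<rho>\<^bsup>2s\<^esup> Z\<close> is at least
  \<open>\<rho>\<^bsup>2s\<^esup> (c (N\<^sup>2 + |\<nabla>N|\<^sup>2) - C |T N|\<^sup>2)\<close>. Integrating over the end, the contribution of
  the inner boundary has a favourable sign, so no boundary condition on \<open>N\<close> is needed there.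

  The integration is carried out chart by chart. It needs no partition of unity: bump functions \<open>b\<close> that
  are smooth up to infinity satisfy \<open>|db|\<^sub>g = O(\<rho>)\<close>, so their derivatives are absorbed.
\<close>

section \<open>Gradients and continuously differentiable functions\<close>

text \<open>In the model case with \<open>T N = 0\<close> the derivative of \<open>p\<close> along
  the gradient of \<open>t\<close> is \<open>N\<close>, so the equations for \<open>N + p\<close>
  and \<open>N - p\<close> decouple; this dictates the form of the multiplier. At \<kappa> = 1/4 the
  model flux is exactly a multiple of \<open>(N + p)^2\<close>, and the excess over 1/4 pays for
  \<open>|dt|\<close> not being 1. The obstacle is regularity at the inner boundary. There
  \<open>N\<close> is smooth from one side only, its derivatives are derivatives within the end, and
  the local extensions given by different charts agree on the end alone. These derivatives are
  determined because d\<rho> does not vanish on the end. Integration by parts stays off the inner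
  boundary: \<open>Z\<close> carries a nondecreasing cutoff \<open>z(t)\<close> that vanishes near
  \<open>t = 2 R\<close>, the term with \<open>z'\<close> is \<open>z'\<close> times the flux and is
  dropped, and at last \<open>z\<close> tends to 1 away from the level \<open>t = 2 R\<close>, a
  null set. Closeness of \<open>|dt|\<close> to 1 comes from small patches at infinity; the bounds
  of the finitely many patches are fixed before \<open>R\<close>, and enter only multiplied by
  quantities of order \<open>exp (- 2 * R)\<close> or in the final constant.\<close>

definition pd :: "'n::finite \<Rightarrow> (real^'n \<Rightarrow> real) \<Rightarrow> real^'n \<Rightarrow> real" where
  "pd i f x = frechet_derivative f (at x) (axis i 1)"

definition grad :: "(real^'n::finite \<Rightarrow> real) \<Rightarrow> real^'n \<Rightarrow> real^'n" where
  "grad f x = (\<chi> i. pd i f x)"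

lemma grad_nth [simp]: "grad f x $ i = pd i f x"
  by (simp add: grad_def)

lemma grad_unique:
  assumes "GDERIV f x :> D" shows "grad f x = D"
proof -
  have "frechet_derivative f (at x) = (\<lambda>h. h \<bullet> D)"
    using assms unfolding gderiv_def by (metis frechet_derivative_at)
  then show ?thesis by (simp add: vec_eq_iff pd_def inner_axis')
qed

lemma pd_unique: "GDERIV f x :> D \<Longrightarrow> pd i f x = D $ i"
  by (metis grad_nth grad_unique)

lemma GDERIV_grad:
  assumes "f differentiable (at x)" shows "GDERIV f x :> grad f x"
proof -
  let ?L = "frechet_derivative f (at x)"
  have d: "(f has_derivative ?L) (at x)" using assms frechet_derivative_works by blast
  then have lin: "linear ?L" by (simp add: has_derivative_linear)
  have "?L h = h \<bullet> grad f x" for h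
  proof -
    have "?L h = ?L (\<Sum>i\<in>UNIV. (h $ i) *\<^sub>R axis i 1)"
      using basis_expansion[of h] by (simp add: scalar_mult_eq_scaleR)
    also have "\<dots> = (\<Sum>i\<in>UNIV. h $ i * ?L (axis i 1))"
      by (simp add: linear_sum[OF lin] linear_cmul[OF lin])
    finally show ?thesis by (simp add: inner_vec_def pd_def)
  qed
  then have "?L = (\<lambda>h. h \<bullet> grad f x)" by auto
  with d show ?thesis by (simp add: gderiv_def)
qed

lemma GDERIV_imp_differentiable: "GDERIV f x :> D \<Longrightarrow> f differentiable (at x)"
  by (auto simp: gderiv_def differentiable_def)

lemma grad_transform:
  assumes "open U" "x \<in> U" "\<And>y. y \<in> U \<Longrightarrow> f y = g y"
  shows "grad f x = grad g x"
proof -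
  have "(f has_derivative L) (at x) \<longleftrightarrow> (g has_derivative L) (at x)" for L
    using has_derivative_transform_within_open[of f L x UNIV U g, OF _ assms]
      has_derivative_transform_within_open[of g L x UNIV U f, OF _ assms(1,2) assms(3)[symmetric]]
    by blast
  then have "frechet_derivative f (at x) = frechet_derivative g (at x)"
    by (simp add: frechet_derivative_def)
  then show ?thesis by (simp add: grad_def pd_def)
qed

lemma pd_transform:
  assumes "open U" "x \<in> U" "\<And>y. y \<in> U \<Longrightarrow> f y = g y"
  shows "pd i f x = pd i g x"
proof -
  have "grad f x $ i = grad g x $ i" by (simp only: grad_transform[OF assms])
  then show ?thesis by simp
qed

text \<open>Two derivatives of \<open>N\<close> and \<rho> and one of the metric are all that the
  calculus below consumes, so smoothness is weakened at once to these classes. Derivatives are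
  two-sided, and \<open>U\<close> is thought of as open.\<close>

definition C1_on :: "(real^'n::finite) set \<Rightarrow> (real^'n \<Rightarrow> real) \<Rightarrow> bool" where
  "C1_on U f \<longleftrightarrow> (\<forall>x\<in>U. f differentiable (at x)) \<and> continuous_on U (grad f)"

definition C2_on :: "(real^'n::finite) set \<Rightarrow> (real^'n \<Rightarrow> real) \<Rightarrow> bool" where
  "C2_on U f \<longleftrightarrow> C1_on U f \<and> (\<forall>i. C1_on U (pd i f))"

lemma C1_onI:
  assumes "\<And>x. x \<in> U \<Longrightarrow> GDERIV f x :> F x" "continuous_on U F"
  shows "C1_on U f"
proof -
  have "continuous_on U (grad f)"
    using assms(2) by (rule continuous_on_cong[THEN iffD1, rotated 2])
      (auto simp: grad_unique[OF assms(1)])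
  then show ?thesis using assms(1) by (auto simp: C1_on_def intro: GDERIV_imp_differentiable)
qed

lemma C1_on_GDERIV: "C1_on U f \<Longrightarrow> x \<in> U \<Longrightarrow> GDERIV f x :> grad f x"
  by (simp add: C1_on_def GDERIV_grad)

lemma C1_on_differentiable: "C1_on U f \<Longrightarrow> x \<in> U \<Longrightarrow> f differentiable (at x)"
  by (simp add: C1_on_def)

lemma C1_on_continuous_grad: "C1_on U f \<Longrightarrow> continuous_on U (grad f)"
  by (simp add: C1_on_def)

lemma C1_on_continuous_pd: "C1_on U f \<Longrightarrow> continuous_on U (pd i f)"
  using continuous_on_component[OF C1_on_continuous_grad, of U f i] by simp

lemma C1_on_continuous: "C1_on U f \<Longrightarrow> continuous_on U f"
  by (meson C1_on_differentiable continuous_at_imp_continuous_on differentiable_imp_continuous_within)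

lemma C1_on_subset: "C1_on U f \<Longrightarrow> V \<subseteq> U \<Longrightarrow> C1_on V f"
  by (auto simp: C1_on_def intro: continuous_on_subset)

lemma C2_on_subset: "C2_on U f \<Longrightarrow> V \<subseteq> U \<Longrightarrow> C2_on V f"
  by (auto simp: C2_on_def intro: C1_on_subset)

lemma C2_on_C1: "C2_on U f \<Longrightarrow> C1_on U f"
  by (simp add: C2_on_def)

lemma C2_on_pd: "C2_on U f \<Longrightarrow> C1_on U (pd i f)"
  by (simp add: C2_on_def)

lemma C1_on_cong:
  assumes "open U" "\<And>x. x \<in> U \<Longrightarrow> f x = g x" "C1_on U f"
  shows "C1_on U g"
proof (rule C1_onI)
  fix x assume x: "x \<in> U"
  show "GDERIV g x :> grad f x"
    using C1_on_GDERIV[OF assms(3) x] has_derivative_transform_within_open[of f _ x UNIV U g, OF _ assms(1) x assms(2)]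
    unfolding gderiv_def by blast
qed (rule C1_on_continuous_grad[OF assms(3)])

lemma C2_on_cong:
  assumes "open U" "\<And>x. x \<in> U \<Longrightarrow> f x = g x" "C2_on U f"
  shows "C2_on U g"
  unfolding C2_on_def
proof (intro conjI allI)
  show "C1_on U g" using assms C1_on_cong C2_on_C1 by blast
  fix i show "C1_on U (pd i g)"
    using C2_on_pd[OF assms(3), of i] pd_transform[OF assms(1) _ assms(2)]
    by (intro C1_on_cong[OF assms(1), of "pd i f" "pd i g"]) auto
qed

lemma C1_on_const [intro, simp]: "C1_on U (\<lambda>x. c)"
  by (rule C1_onI[where F = "\<lambda>_. 0"]) (auto simp: GDERIV_const)

lemma C1_on_add [intro]: "C1_on U f \<Longrightarrow> C1_on U g \<Longrightarrow> C1_on U (\<lambda>x. f x + g x)"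
  by (rule C1_onI[where F = "\<lambda>x. grad f x + grad g x"])
    (auto intro!: GDERIV_add C1_on_GDERIV continuous_on_add C1_on_continuous_grad)

lemma C1_on_diff [intro]: "C1_on U f \<Longrightarrow> C1_on U g \<Longrightarrow> C1_on U (\<lambda>x. f x - g x)"
  by (rule C1_onI[where F = "\<lambda>x. grad f x - grad g x"])
    (auto intro!: GDERIV_diff C1_on_GDERIV continuous_on_diff C1_on_continuous_grad)

lemma C1_on_minus [intro]: "C1_on U f \<Longrightarrow> C1_on U (\<lambda>x. - f x)"
  by (rule C1_onI[where F = "\<lambda>x. - grad f x"])
    (auto intro!: GDERIV_minus C1_on_GDERIV continuous_on_minus C1_on_continuous_grad)

lemma C1_on_mult [intro]: "C1_on U f \<Longrightarrow> C1_on U g \<Longrightarrow> C1_on U (\<lambda>x. f x * g x)"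
  by (rule C1_onI[where F = "\<lambda>x. f x *\<^sub>R grad g x + g x *\<^sub>R grad f x"])
    (auto intro!: GDERIV_mult C1_on_GDERIV continuous_intros C1_on_continuous_grad C1_on_continuous)

lemma C1_on_sum [intro]: "(\<And>i. i \<in> I \<Longrightarrow> C1_on U (f i)) \<Longrightarrow> C1_on U (\<lambda>x. \<Sum>i\<in>I. f i x)"
  by (induction I rule: infinite_finite_induct) auto

lemma C1_on_prod [intro]: "(\<And>i. i \<in> I \<Longrightarrow> C1_on U (f i)) \<Longrightarrow> C1_on U (\<lambda>x. \<Prod>i\<in>I. f i x)"
  by (induction I rule: infinite_finite_induct) auto

lemma C1_on_power [intro]: "C1_on U f \<Longrightarrow> C1_on U (\<lambda>x. f x ^ n)"
  by (induction n) auto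

lemma C1_on_compose:
  assumes "C1_on U f" "\<And>x. x \<in> U \<Longrightarrow> DERIV g (f x) :> g' (f x)" "continuous_on (f ` U) g'"
  shows "C1_on U (\<lambda>x. g (f x))"
proof (rule C1_onI)
  show "GDERIV (\<lambda>x. g (f x)) x :> g' (f x) *\<^sub>R grad f x" if "x \<in> U" for x
    by (rule GDERIV_DERIV_compose[OF C1_on_GDERIV[OF assms(1) that] assms(2)[OF that]])
  have "continuous_on U (\<lambda>x. g' (f x))"
    using assms by (auto intro: continuous_on_compose2[OF assms(3)] C1_on_continuous)
  then show "continuous_on U (\<lambda>x. g' (f x) *\<^sub>R grad f x)"
    by (intro continuous_intros C1_on_continuous_grad assms)
qed

lemma C1_on_inverse:
  assumes "C1_on U f" "\<And>x. x \<in> U \<Longrightarrow> f x \<noteq> 0"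
  shows "C1_on U (\<lambda>x. inverse (f x))"
  by (rule C1_on_compose[where g' = "\<lambda>y. - (inverse y ^ 2)"])
    (use assms in \<open>auto intro!: continuous_intros derivative_eq_intros simp: power2_eq_square\<close>)

lemma C1_on_divide:
  assumes "C1_on U f" "C1_on U g" "\<And>x. x \<in> U \<Longrightarrow> g x \<noteq> 0"
  shows "C1_on U (\<lambda>x. f x / g x)"
  using C1_on_mult[OF assms(1) C1_on_inverse[OF assms(2,3)]] by (simp add: field_simps)

lemma GDERIV_sum:
  "(\<And>i. i \<in> I \<Longrightarrow> GDERIV (f i) x :> D i) \<Longrightarrow> GDERIV (\<lambda>x. \<Sum>i\<in>I. f i x) x :> (\<Sum>i\<in>I. D i)"
  by (induction I rule: infinite_finite_induct) (auto intro: GDERIV_const GDERIV_add)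

subsection \<open>Symmetry of second derivatives\<close>

lemma DERIV_along_axis:
  assumes "f differentiable (at (x + s *\<^sub>R axis i 1))"
  shows "DERIV (\<lambda>s. f (x + s *\<^sub>R axis i 1)) s :> pd i f (x + s *\<^sub>R axis i 1)"
proof -
  let ?y = "x + s *\<^sub>R axis i 1"
  have 1: "(f has_derivative (\<lambda>h. h \<bullet> grad f ?y)) (at ?y)"
    using GDERIV_grad[OF assms] by (simp add: gderiv_def)
  have 2: "((\<lambda>s. x + s *\<^sub>R axis i 1) has_derivative (\<lambda>h. h *\<^sub>R axis i 1)) (at s)"
    by (auto intro!: derivative_eq_intros)
  have "((\<lambda>s. f (x + s *\<^sub>R axis i 1)) has_derivative (\<lambda>h. (h *\<^sub>R axis i 1) \<bullet> grad f ?y)) (at s)"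
    by (rule has_derivative_compose[OF 2 1])
  then show ?thesis
    by (simp add: has_field_derivative_def inner_axis' mult.commute[of _ "pd i f _"])
qed

text \<open>The mean value theorem is used along axis \<open>i\<close> for the increment of
  \<open>f\<close> along axis \<open>j\<close>, and then along axis \<open>j\<close> for
  \<open>pd i f\<close>.\<close>

lemma second_difference_mvt:
  fixes f :: "real^'n::finite \<Rightarrow> real"
  assumes C2: "C2_on U f" and "h > 0"
    and box: "\<And>a b. 0 \<le> a \<Longrightarrow> a \<le> h \<Longrightarrow> 0 \<le> b \<Longrightarrow> b \<le> h \<Longrightarrow> x + a *\<^sub>R axis i 1 + b *\<^sub>R axis j 1 \<in> U"
  shows "\<exists>a b. 0 < a \<and> a < h \<and> 0 < b \<and> b < h \<and>
    f (x + h *\<^sub>R axis i 1 + h *\<^sub>R axis j 1) - f (x + h *\<^sub>R axis i 1) - f (x + h *\<^sub>R axis j 1) + f x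
     = h * h * pd j (pd i f) (x + a *\<^sub>R axis i 1 + b *\<^sub>R axis j 1)"
proof -
  let ?\<phi> = "\<lambda>s. f (x + h *\<^sub>R axis j 1 + s *\<^sub>R axis i 1) - f (x + s *\<^sub>R axis i 1)"
  have d1: "f differentiable (at (x + b *\<^sub>R axis j 1 + a *\<^sub>R axis i 1))"
    and d2: "pd i f differentiable (at (x + a *\<^sub>R axis i 1 + b *\<^sub>R axis j 1))"
    if "0 \<le> a" "a \<le> h" "0 \<le> b" "b \<le> h" for a b
    using box[OF that] C2 by (auto simp: C2_on_def C1_on_def add.commute add.left_commute)
  have "\<exists>z>0. z < h \<and> ?\<phi> h - ?\<phi> 0 = (h - 0) *
      (pd i f (x + h *\<^sub>R axis j 1 + z *\<^sub>R axis i 1) - pd i f (x + z *\<^sub>R axis i 1))"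
    using \<open>h > 0\<close> d1[of _ h] d1[of _ 0]
    by (intro MVT2[where f = ?\<phi>]) (auto intro!: DERIV_diff DERIV_along_axis)
  then obtain a where a: "0 < a" "a < h" and ea: "?\<phi> h - ?\<phi> 0 = h *
      (pd i f (x + h *\<^sub>R axis j 1 + a *\<^sub>R axis i 1) - pd i f (x + a *\<^sub>R axis i 1))" by auto
  let ?\<psi> = "\<lambda>s. pd i f (x + a *\<^sub>R axis i 1 + s *\<^sub>R axis j 1)"
  have "\<exists>z>0. z < h \<and> ?\<psi> h - ?\<psi> 0 = (h - 0) * pd j (pd i f) (x + a *\<^sub>R axis i 1 + z *\<^sub>R axis j 1)"
    using \<open>h > 0\<close> d2[of a] a
    by (intro MVT2[where f = ?\<psi>]) (auto intro!: DERIV_along_axis)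
  then obtain b where "0 < b" "b < h"
    "?\<psi> h - ?\<psi> 0 = h * pd j (pd i f) (x + a *\<^sub>R axis i 1 + b *\<^sub>R axis j 1)" by auto
  with a ea show ?thesis
    by (intro exI[of _ a] exI[of _ b]) (simp add: algebra_simps)
qed

text \<open>The second difference is symmetric in the two directions, so evaluating it in both
  orders equates the two mixed derivatives at two points near \<open>x\<close>; continuity moves
  both points to \<open>x\<close>.\<close>

lemma pd_commute:
  fixes f :: "real^'n::finite \<Rightarrow> real"
  assumes "open U" "x \<in> U" and C2: "C2_on U f"
  shows "pd i (pd j f) x = pd j (pd i f) x"
proof (rule ccontr)
  assume ne: "\<not> ?thesis"
  define \<epsilon> where "\<epsilon> = \<bar>pd i (pd j f) x - pd j (pd i f) x\<bar> / 2"
  have "\<epsilon> > 0" using ne by (simp add: \<epsilon>_def)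
  obtain r where r: "r > 0" "ball x r \<subseteq> U" using assms by (meson open_contains_ball)
  have c: "continuous (at x) (pd k (pd l f))" for k l
    using C1_on_continuous_pd[OF C2_on_pd[OF C2]] assms by (simp add: continuous_on_eq_continuous_at)
  obtain d1 where d1: "d1 > 0" "\<And>y. dist y x < d1 \<Longrightarrow> dist (pd i (pd j f) y) (pd i (pd j f) x) < \<epsilon>"
    using c[of i j] \<open>\<epsilon> > 0\<close> unfolding continuous_at_eps_delta dist_norm by metis
  obtain d2 where d2: "d2 > 0" "\<And>y. dist y x < d2 \<Longrightarrow> dist (pd j (pd i f) y) (pd j (pd i f) x) < \<epsilon>"
    using c[of j i] \<open>\<epsilon> > 0\<close> unfolding continuous_at_eps_delta dist_norm by metis
  \<comment> \<open>The intermediate points lie within \<open>2 * h\<close> of \<open>x\<close>; a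
    third of the smallest radius keeps that below all three radii.\<close>
  define h where "h = min r (min d1 d2) / 3"
  have h: "h > 0" "2 * h < r" "2 * h < d1" "2 * h < d2" using r d1 d2 by (auto simp: h_def)
  have near: "dist (x + a *\<^sub>R axis k 1 + b *\<^sub>R axis l 1) x \<le> 2 * h"
    if "0 \<le> a" "a \<le> h" "0 \<le> b" "b \<le> h" for a b and k l :: 'n
  proof -
    have "norm (a *\<^sub>R axis k 1 + b *\<^sub>R axis l 1 :: real^'n) \<le> a + b"
      using norm_triangle_ineq[of "a *\<^sub>R axis k 1 :: real^'n" "b *\<^sub>R axis l 1"] that by (simp add: norm_axis_1)
    then show ?thesis using that by (simp add: dist_norm algebra_simps)
  qed
  have inU: "x + a *\<^sub>R axis k 1 + b *\<^sub>R axis l 1 \<in> U"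
    if "0 \<le> a" "a \<le> h" "0 \<le> b" "b \<le> h" for a b and k l :: 'n
    using near[OF that] h r(2) by (meson dist_commute_lessI le_less_trans mem_ball subsetD)
  obtain a b where ab: "0 < a" "a < h" "0 < b" "b < h" and e1:
    "f (x + h *\<^sub>R axis i 1 + h *\<^sub>R axis j 1) - f (x + h *\<^sub>R axis i 1) - f (x + h *\<^sub>R axis j 1) + f x
     = h * h * pd j (pd i f) (x + a *\<^sub>R axis i 1 + b *\<^sub>R axis j 1)"
    using second_difference_mvt[OF C2 h(1) inU] by blast
  obtain a' b' where ab': "0 < a'" "a' < h" "0 < b'" "b' < h" and e2:
    "f (x + h *\<^sub>R axis j 1 + h *\<^sub>R axis i 1) - f (x + h *\<^sub>R axis j 1) - f (x + h *\<^sub>R axis i 1) + f x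
     = h * h * pd i (pd j f) (x + a' *\<^sub>R axis j 1 + b' *\<^sub>R axis i 1)"
    using second_difference_mvt[OF C2 h(1) inU] by blast
  have sw: "x + h *\<^sub>R axis j 1 + h *\<^sub>R axis i 1 = x + h *\<^sub>R axis i 1 + h *\<^sub>R axis j 1" by simp
  have "h * h * pd j (pd i f) (x + a *\<^sub>R axis i 1 + b *\<^sub>R axis j 1)
      = h * h * pd i (pd j f) (x + a' *\<^sub>R axis j 1 + b' *\<^sub>R axis i 1)"
    using e1 e2 unfolding sw by linarith
  then have "pd j (pd i f) (x + a *\<^sub>R axis i 1 + b *\<^sub>R axis j 1)
      = pd i (pd j f) (x + a' *\<^sub>R axis j 1 + b' *\<^sub>R axis i 1)" using h by simp
  moreover have "dist (pd j (pd i f) (x + a *\<^sub>R axis i 1 + b *\<^sub>R axis j 1)) (pd j (pd i f) x) < \<epsilon>"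
    using near[of a b i j] ab h by (intro d2(2)) auto
  moreover have "dist (pd i (pd j f) (x + a' *\<^sub>R axis j 1 + b' *\<^sub>R axis i 1)) (pd i (pd j f) x) < \<epsilon>"
    using near[of a' b' j i] ab' h by (intro d1(2)) auto
  ultimately have "\<bar>pd i (pd j f) x - pd j (pd i f) x\<bar> < 2 * \<epsilon>"
    unfolding dist_real_def by linarith
  then show False by (simp add: \<epsilon>_def)
qed

section \<open>Determinants and inverses of matrix-valued functions\<close>

text \<open>The differential of the determinant at \<open>A\<close> in direction \<open>B\<close>,
  as the product rule yields it from the Leibniz formula.\<close>

definition det_diff :: "real^'n::finite^'n \<Rightarrow> real^'n^'n \<Rightarrow> real" where
  "det_diff A B = (\<Sum>p | p permutes (UNIV::'n set). of_int (sign p) *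
     (\<Sum>i\<in>UNIV. B $ i $ p i * (\<Prod>j\<in>UNIV - {i}. A $ j $ p j)))"

lemma has_derivative_det:
  fixes M :: "'a::real_normed_vector \<Rightarrow> real^'n::finite^'n"
  assumes "\<And>i j. ((\<lambda>y. M y $ i $ j) has_derivative D i j) (at x)"
  shows "((\<lambda>y. det (M y)) has_derivative (\<lambda>h. det_diff (M x) (\<chi> i j. D i j h))) (at x)"
  unfolding det_def det_diff_def
  by (rule has_derivative_eq_rhs)
     (auto intro!: has_derivative_sum has_derivative_mult_right has_derivative_prod assms)

text \<open>A permutation other than the identity moves at least two points, so after one factor is
  removed an off-diagonal entry of the identity matrix is still present.\<close>

lemma det_diff_mat_1:
  fixes B :: "real^'n::finite^'n"
  shows "det_diff (mat 1) B = trace B"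
proof -
  have z: "(\<Prod>j\<in>UNIV - {i}. (mat 1 :: real^'n^'n) $ j $ p j) = 0"
    if p: "p permutes UNIV" "p \<noteq> id" for p :: "'n \<Rightarrow> 'n" and i :: 'n
  proof -
    obtain a where a: "p a \<noteq> a" using p(2) by fastforce
    have "p (p a) \<noteq> p a" using a p(1) by (meson permutes_inj injD)
    then obtain b where "b \<noteq> i" "p b \<noteq> b" using a by (cases "a = i") auto
    then show ?thesis by (intro prod_zero) (auto simp: mat_def intro!: bexI[of _ b])
  qed
  have "det_diff (mat 1) B = (\<Sum>p \<in> {p. p permutes (UNIV::'n set)}.
      if p = id then (\<Sum>i\<in>UNIV. B $ i $ i) else 0)"
    unfolding det_diff_def
    by (rule sum.cong) (auto simp: z, simp add: mat_def)
  also have "\<dots> = trace B" by (simp add: finite_permutations permutes_id trace_def)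
  finally show ?thesis .
qed

lemma matrix_mult_scaleR_right:
  fixes A :: "real^'n::finite^'m" and B :: "real^'k^'n"
  shows "A ** (s *\<^sub>R B) = s *\<^sub>R (A ** B)"
  by (simp add: matrix_matrix_mult_def vec_eq_iff sum_distrib_left ac_simps)

lemma matrix_mult_scaleR_left:
  fixes A :: "real^'n::finite^'m" and B :: "real^'k^'n"
  shows "(s *\<^sub>R A) ** B = s *\<^sub>R (A ** B)"
  by (simp add: matrix_matrix_mult_def vec_eq_iff sum_distrib_left ac_simps)

text \<open>Jacobi's formula is carried from the identity to \<open>A\<close> by
  \<open>det (A + s B) = det A * det (1 + s A' B)\<close>; both sides are differentiated at
  \<open>s = 0\<close> and the uniqueness of derivatives is used.\<close>

lemma det_diff_invertible:
  fixes A A' B :: "real^'n::finite^'n"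
  assumes "A' ** A = mat 1" "A ** A' = mat 1"
  shows "det_diff A B = det A * trace (A' ** B)"
proof -
  have line: "((\<lambda>s. det (C + s *\<^sub>R D)) has_derivative (\<lambda>h. det_diff C (h *\<^sub>R D))) (at 0)"
    for C D :: "real^'n^'n"
  proof -
    have "((\<lambda>s. det (C + s *\<^sub>R D)) has_derivative
        (\<lambda>h. det_diff (C + 0 *\<^sub>R D) (\<chi> i j. h * D $ i $ j))) (at 0)"
      by (rule has_derivative_det) (auto intro!: derivative_eq_intros)
    moreover have "(\<lambda>h. \<chi> i j. h * D $ i $ j) = (\<lambda>h. h *\<^sub>R D)" by (simp add: vec_eq_iff fun_eq_iff)
    ultimately show ?thesis by (metis (no_types, lifting) ext add.right_neutral scaleR_zero_left)
  qed
  have eq: "det (A + s *\<^sub>R B) = det A * det (mat 1 + s *\<^sub>R (A' ** B))" for s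
  proof -
    have "A ** (mat 1 + s *\<^sub>R (A' ** B)) = A + s *\<^sub>R B"
      by (simp add: matrix_add_ldistrib matrix_mult_scaleR_right matrix_mul_assoc assms)
    then show ?thesis by (metis det_mul)
  qed
  have "((\<lambda>s. det (A + s *\<^sub>R B)) has_derivative
      (\<lambda>h. det A * det_diff (mat 1) (h *\<^sub>R (A' ** B)))) (at 0)"
    unfolding eq by (rule has_derivative_mult_right[OF line])
  from fun_cong[OF has_derivative_unique[OF this line], of 1]
  show ?thesis by (simp add: det_diff_mat_1)
qed

lemma matrix_inv_eq:
  fixes A :: "real^'n::finite^'n"
  assumes "A ** B = mat 1"
  shows "matrix_inv A = B"
proof -
  have "B ** A = mat 1" using assms matrix_left_right_inverse by blast
  then have "\<exists>A'. A ** A' = mat 1 \<and> A' ** A = mat 1" using assms by blast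
  then have "matrix_inv A ** A = mat 1" unfolding matrix_inv_def by (metis (mono_tags, lifting) someI_ex)
  then show ?thesis by (metis assms matrix_mul_assoc matrix_mul_lid matrix_mul_rid)
qed

lemma matrix_inv_mult:
  fixes A :: "real^'n::finite^'n"
  assumes "det A \<noteq> 0"
  shows "A ** matrix_inv A = mat 1" "matrix_inv A ** A = mat 1"
proof -
  obtain B where "A ** B = mat 1" using assms by (metis invertible_det_nz invertible_def)
  then show "A ** matrix_inv A = mat 1" by (simp add: matrix_inv_eq)
  then show "matrix_inv A ** A = mat 1" using matrix_left_right_inverse by blast
qed

text \<open>Cramer's rule makes the entries of the inverse quotients of polynomials in the entries
  of \<open>A\<close>; regularity of the inverse metric is read off from this.\<close>

lemma matrix_inv_cramer:
  fixes A :: "real^'n::finite^'n"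
  assumes "det A \<noteq> 0"
  shows "matrix_inv A $ k $ l = det (\<chi> i j. if j = k then (if i = l then 1 else 0) else A $ i $ j) / det A"
proof -
  have "A *v (matrix_inv A *v axis l 1) = axis l 1"
    by (simp add: matrix_vector_mul_assoc matrix_inv_mult[OF assms])
  then have "matrix_inv A *v axis l 1 = (\<chi> k. det(\<chi> i j. if j=k then axis l 1 $ i else A$i$j) / det A)"
    using cramer[OF assms] by blast
  then have "(matrix_inv A *v axis l 1) $ k = det(\<chi> i j. if j=k then axis l 1 $ i else A$i$j) / det A"
    by simp
  moreover have "(matrix_inv A *v axis l 1) $ k = matrix_inv A $ k $ l"
    by (simp add: matrix_vector_mult_def axis_def if_distrib cong: if_cong)
  ultimately show ?thesis by (simp add: axis_def cong: if_cong)
qed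

lemma C1_on_det:
  fixes M :: "real^'n::finite \<Rightarrow> real^'m::finite^'m"
  assumes "\<And>i j. C1_on U (\<lambda>y. M y $ i $ j)"
  shows "C1_on U (\<lambda>y. det (M y))"
  unfolding det_def using assms by (intro C1_on_sum C1_on_mult C1_on_prod C1_on_const)

lemma continuous_on_det:
  fixes M :: "'a::topological_space \<Rightarrow> real^'m::finite^'m"
  assumes "\<And>i j. continuous_on U (\<lambda>y. M y $ i $ j)"
  shows "continuous_on U (\<lambda>y. det (M y))"
  unfolding det_def by (intro continuous_on_sum continuous_on_mult continuous_on_prod continuous_on_const assms)

lemma C1_on_matrix_inv:
  fixes M :: "real^'n::finite \<Rightarrow> real^'m::finite^'m"
  assumes "\<And>i j. C1_on U (\<lambda>y. M y $ i $ j)" "open U" "\<And>x. x \<in> U \<Longrightarrow> det (M x) \<noteq> 0"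
  shows "C1_on U (\<lambda>y. matrix_inv (M y) $ k $ l)"
proof -
  have c: "C1_on U (\<lambda>y. (\<chi> i j. if j = k then (if i = l then 1 else 0) else M y $ i $ j) $ a $ b)"
    for a b using assms(1) by (cases "b = k") auto
  have "C1_on U (\<lambda>y. det (\<chi> i j. if j = k then (if i = l then 1 else 0) else M y $ i $ j) / det (M y))"
    by (intro C1_on_divide C1_on_det c assms(1)) (use assms in auto)
  then show ?thesis
    by (rule C1_on_cong[OF assms(2), rotated]) (simp add: matrix_inv_cramer assms(3))
qed

lemma continuous_on_matrix_inv:
  fixes M :: "'a::topological_space \<Rightarrow> real^'m::finite^'m"
  assumes "\<And>i j. continuous_on U (\<lambda>y. M y $ i $ j)" "\<And>x. x \<in> U \<Longrightarrow> det (M x) \<noteq> 0"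
  shows "continuous_on U (\<lambda>y. matrix_inv (M y) $ k $ l)"
proof -
  have c: "continuous_on U (\<lambda>y. (\<chi> i j. if j = k then (if i = l then 1 else 0) else M y $ i $ j) $ a $ b)"
    for a b using assms(1) by (cases "b = k") auto
  have "continuous_on U (\<lambda>y. det (\<chi> i j. if j = k then (if i = l then 1 else 0) else M y $ i $ j) / det (M y))"
    by (intro continuous_on_divide continuous_on_det c assms(1)) (use assms in auto)
  then show ?thesis
    by (rule continuous_on_cong[THEN iffD1, rotated 2]) (auto simp: matrix_inv_cramer assms(2))
qed

lemma pd_det:
  fixes M :: "real^'n::finite \<Rightarrow> real^'m::finite^'m"
  assumes "\<And>i j. (\<lambda>y. M y $ i $ j) differentiable (at x)" "det (M x) \<noteq> 0"
  shows "pd k (\<lambda>y. det (M y)) x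
    = det (M x) * (\<Sum>i\<in>UNIV. \<Sum>j\<in>UNIV. matrix_inv (M x) $ i $ j * pd k (\<lambda>y. M y $ j $ i) x)"
proof -
  let ?F = "\<lambda>i j. frechet_derivative (\<lambda>y. M y $ i $ j) (at x)"
  have "((\<lambda>y. det (M y)) has_derivative (\<lambda>h. det_diff (M x) (\<chi> i j. ?F i j h))) (at x)"
    by (rule has_derivative_det) (simp only: frechet_derivative_works[symmetric] assms(1))
  then have "frechet_derivative (\<lambda>y. det (M y)) (at x) = (\<lambda>h. det_diff (M x) (\<chi> i j. ?F i j h))"
    by (rule frechet_derivative_at[symmetric])
  then have "pd k (\<lambda>y. det (M y)) x = det_diff (M x) (\<chi> i j. pd k (\<lambda>y. M y $ i $ j) x)"
    by (simp add: pd_def)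
  also have "\<dots> = det (M x) * trace (matrix_inv (M x) ** (\<chi> i j. pd k (\<lambda>y. M y $ i $ j) x))"
    by (rule det_diff_invertible) (use matrix_inv_mult[OF assms(2)] in auto)
  finally show ?thesis by (simp add: trace_def matrix_matrix_mult_def)
qed

section \<open>Positive definite matrices\<close>

definition posdef :: "real^'n::finite^'n \<Rightarrow> bool" where
  "posdef G \<longleftrightarrow> transpose G = G \<and> (\<forall>v. v \<noteq> 0 \<longrightarrow> 0 < v \<bullet> (G *v v))"

lemma inner_matrix_symmetric:
  fixes G :: "real^'n::finite^'n"
  assumes "transpose G = G"
  shows "v \<bullet> (G *v w) = w \<bullet> (G *v v)"
  by (metis assms dot_lmul_matrix inner_commute vector_transpose_matrix)

text \<open>Gram-Schmidt, one index at a time. The vectors are indexed by \<open>'n\<close> itself,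
  so that the full family supplies the columns of a square matrix.\<close>

lemma posdef_orthonormal_family:
  fixes G :: "real^'n::finite^'n"
  assumes "posdef G"
  shows "\<exists>b::'n \<Rightarrow> real^'n. \<forall>i\<in>F. \<forall>j\<in>F. b i \<bullet> (G *v b j) = (if i = j then 1 else 0)"
proof -
  have sym: "v \<bullet> (G *v w) = w \<bullet> (G *v v)" for v w
    using assms inner_matrix_symmetric by (auto simp: posdef_def)
  have pos: "v \<noteq> 0 \<Longrightarrow> 0 < v \<bullet> (G *v v)" for v using assms by (auto simp: posdef_def)
  have "finite F" by simp
  then show ?thesis
  proof (induction F rule: finite_induct)
    case empty then show ?case by simp
  next
    case (insert k F)
    then obtain b where b: "\<forall>i\<in>F. \<forall>j\<in>F. b i \<bullet> (G *v b j) = (if i = j then 1 else 0)" by blast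
    \<comment> \<open>Fewer than \<open>CARD('n)\<close> vectors cannot span, which leaves a vector
      \<open>v\<close> to orthogonalise.\<close>
    have "dim (span (b ` F)) \<le> card F"
      by (metis card_image_le dim_le_card' dim_span finite_imageI insert.hyps(1) le_trans)
    also have "card F < CARD('n)"
      by (metis UNIV_I finite insert.hyps(2) psubsetI psubset_card_mono subset_UNIV)
    finally have "span (b ` F) \<noteq> UNIV" by (metis dim_UNIV DIM_cart DIM_real mult.right_neutral less_irrefl)
    then obtain v where v: "v \<notin> span (b ` F)" by blast
    define w where "w = v - (\<Sum>i\<in>F. (b i \<bullet> (G *v v)) *\<^sub>R b i)"
    have "w \<noteq> 0"
    proof
      assume "w = 0"
      then have "v = (\<Sum>i\<in>F. (b i \<bullet> (G *v v)) *\<^sub>R b i)" by (simp add: w_def)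
      then have "v \<in> span (b ` F)" by (metis (no_types, lifting) image_eqI span_base span_scale span_sum)
      with v show False by simp
    qed
    then have q: "0 < w \<bullet> (G *v w)" by (rule pos)
    have orth: "b j \<bullet> (G *v w) = 0" if "j \<in> F" for j
    proof -
      have "b j \<bullet> (G *v w) = b j \<bullet> (G *v v) - (\<Sum>i\<in>F. (b i \<bullet> (G *v v)) * (b j \<bullet> (G *v b i)))"
        by (simp add: w_def matrix_vector_mult_diff_distrib inner_diff_right
            inner_sum_right linear_sum[OF matrix_vector_mul_linear] linear_cmul[OF matrix_vector_mul_linear])
      also have "(\<Sum>i\<in>F. (b i \<bullet> (G *v v)) * (b j \<bullet> (G *v b i)))
          = (\<Sum>i\<in>F. if i = j then b i \<bullet> (G *v v) else 0)"
        using b that by (intro sum.cong) auto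
      finally show ?thesis using that insert.hyps(1) by simp
    qed
    define b' where "b' = b(k := (1 / sqrt (w \<bullet> (G *v w))) *\<^sub>R w)"
    have orth': "w \<bullet> (G *v b j) = 0" if "j \<in> F" for j
      using orth[OF that] sym by metis
    have b'k: "b' k = (1 / sqrt (w \<bullet> (G *v w))) *\<^sub>R w" and b'F: "\<And>j. j \<in> F \<Longrightarrow> b' j = b j"
      using insert.hyps(2) by (auto simp: b'_def)
    have "b' k \<bullet> (G *v b' k) = 1"
      using q by (simp add: b'k linear_cmul[OF matrix_vector_mul_linear])
    moreover have "b' k \<bullet> (G *v b' j) = 0" "b' j \<bullet> (G *v b' k) = 0" if "j \<in> F" for j
      using orth[OF that] orth'[OF that] by (simp_all add: b'k b'F[OF that] linear_cmul[OF matrix_vector_mul_linear])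
    ultimately have "b' i \<bullet> (G *v b' j) = (if i = j then 1 else 0)"
      if "i \<in> insert k F" "j \<in> insert k F" for i j
      using that insert.hyps(2) b by (cases "i = k"; cases "j = k") (auto simp: b'F)
    then show ?case by blast
  qed
qed

text \<open>The columns of \<open>B\<close> are an orthonormal frame for \<open>G\<close>. In such a
  frame every contraction with the metric becomes Euclidean, which is how all pointwise estimates
  are obtained.\<close>

lemma posdef_frame:
  fixes G :: "real^'n::finite^'n"
  assumes "posdef G"
  obtains B where "transpose B ** G ** B = mat 1" "matrix_inv G = B ** transpose B" "det G > 0"
    "det B \<noteq> 0"
proof -
  obtain b :: "'n \<Rightarrow> real^'n" where b: "\<And>i j. b i \<bullet> (G *v b j) = (if i = j then 1 else 0)"
    using posdef_orthonormal_family[OF assms, of UNIV] by auto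
  define B :: "real^'n^'n" where "B = (\<chi> r c. b c $ r)"
  have "(transpose B ** (G ** B)) $ i $ j = b i \<bullet> (G *v b j)" for i j
    by (simp add: matrix_matrix_mult_def transpose_def B_def inner_vec_def matrix_vector_mult_def)
  then have 1: "transpose B ** (G ** B) = mat 1" by (simp add: vec_eq_iff b mat_def)
  then have "G ** B ** transpose B = mat 1" using matrix_left_right_inverse by blast
  then have 2: "matrix_inv G = B ** transpose B" by (intro matrix_inv_eq) (simp add: matrix_mul_assoc)
  have "det B * det G * det B = 1"
    using arg_cong[OF 1, of det] by (simp add: det_mul det_transpose)
  then have "det G * (det B)\<^sup>2 = 1" by (simp add: power2_eq_square ac_simps)
  then have 3: "det G > 0" "det B \<noteq> 0"
    using mult_nonpos_nonneg[of "det G" "(det B)\<^sup>2"] by (force simp: not_less[symmetric], auto)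
  show ?thesis using that 1 2 3 by (simp add: matrix_mul_assoc)
qed

lemma posdef_det: "posdef G \<Longrightarrow> det G > 0"
  using posdef_frame by blast

lemma posdef_symmetric: "posdef G \<Longrightarrow> G $ i $ j = G $ j $ i"
  unfolding posdef_def by (metis (no_types, lifting) transpose_def vec_lambda_beta)

lemma matrix_inv_symmetric:
  fixes G :: "real^'n::finite^'n"
  assumes "posdef G" shows "matrix_inv G $ i $ j = matrix_inv G $ j $ i"
proof -
  obtain B :: "real^'n^'n" where "matrix_inv G = B ** transpose B" using posdef_frame[OF assms] by blast
  then show ?thesis by (simp add: matrix_matrix_mult_def transpose_def mult.commute)
qed

section \<open>Levi-Civita calculus in coordinates\<close>

lemma pd_add:
  "f differentiable (at x) \<Longrightarrow> g differentiable (at x) \<Longrightarrow> pd i (\<lambda>y. f y + g y) x = pd i f x + pd i g x"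
  using pd_unique[OF GDERIV_add[OF GDERIV_grad GDERIV_grad]] by auto

lemma pd_mult:
  "f differentiable (at x) \<Longrightarrow> g differentiable (at x) \<Longrightarrow>
    pd i (\<lambda>y. f y * g y) x = pd i f x * g x + f x * pd i g x"
  using pd_unique[OF GDERIV_mult[OF GDERIV_grad GDERIV_grad], of f x g i] by simp

lemma pd_sum:
  "(\<And>a. a \<in> I \<Longrightarrow> f a differentiable (at x)) \<Longrightarrow> pd i (\<lambda>y. \<Sum>a\<in>I. f a y) x = (\<Sum>a\<in>I. pd i (f a) x)"
  using pd_unique[OF GDERIV_sum[of I f x "\<lambda>a. grad (f a) x"]] by (auto simp: GDERIV_grad)

lemma pd_compose_real:
  "f differentiable (at x) \<Longrightarrow> DERIV g (f x) :> d \<Longrightarrow> pd i (\<lambda>y. g (f y)) x = d * pd i f x"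
  using pd_unique[OF GDERIV_DERIV_compose[OF GDERIV_grad]] by auto

text \<open>Christoffel symbols of the first kind. With the index \<open>m\<close> kept down,
  \<open>hess\<close> pairs it with the raised gradient, and the inverse metric enters the
  transformation laws through gradients only.\<close>

definition chr_low :: "(real^'n::finite \<Rightarrow> real^'n^'n) \<Rightarrow> real^'n \<Rightarrow> 'n \<Rightarrow> 'n \<Rightarrow> 'n \<Rightarrow> real" where
  "chr_low G x m i j =
     (pd i (\<lambda>y. G y $ m $ j) x + pd j (\<lambda>y. G y $ m $ i) x - pd m (\<lambda>y. G y $ i $ j) x) / 2"

definition rgrad :: "(real^'n::finite \<Rightarrow> real^'n^'n) \<Rightarrow> (real^'n \<Rightarrow> real) \<Rightarrow> real^'n \<Rightarrow> real^'n" where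
  "rgrad G f x = matrix_inv (G x) *v grad f x"

definition hess :: "(real^'n::finite \<Rightarrow> real^'n^'n) \<Rightarrow> (real^'n \<Rightarrow> real) \<Rightarrow> real^'n \<Rightarrow> real^'n^'n" where
  "hess G f x = (\<chi> i j. pd i (pd j f) x - (\<Sum>m\<in>UNIV. chr_low G x m i j * rgrad G f x $ m))"

definition C1_metric :: "(real^'n::finite) set \<Rightarrow> (real^'n \<Rightarrow> real^'n^'n) \<Rightarrow> bool" where
  "C1_metric U G \<longleftrightarrow> open U \<and> (\<forall>x\<in>U. posdef (G x)) \<and> (\<forall>i j. C1_on U (\<lambda>x. G x $ i $ j))"

lemma rgrad_lower:
  assumes "det (G x) \<noteq> 0"
  shows "(\<Sum>a\<in>UNIV. G x $ b $ a * rgrad G f x $ a) = pd b f x"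
proof -
  have "G x *v rgrad G f x = grad f x"
    by (simp add: rgrad_def matrix_vector_mul_assoc matrix_inv_mult[OF assms])
  then have "(G x *v rgrad G f x) $ b = pd b f x" by simp
  then show ?thesis by (simp add: matrix_vector_mult_def)
qed

context
  fixes U :: "(real^'n::finite) set" and G :: "real^'n \<Rightarrow> real^'n^'n"
  assumes met: "C1_metric U G"
begin

section \<open>Gradient, Hessian and divergence for a metric of class C1\<close>

lemma C1_metric_det: "x \<in> U \<Longrightarrow> det (G x) > 0"
  using met by (auto simp: C1_metric_def posdef_det)

lemma C1_on_metric: "C1_on U (\<lambda>x. G x $ i $ j)"
  using met by (auto simp: C1_metric_def)

lemma C1_on_metric_inv: "C1_on U (\<lambda>x. matrix_inv (G x) $ i $ j)"
  using met C1_metric_det by (intro C1_on_matrix_inv) (force simp: C1_metric_def)+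

lemma C1_on_rgrad:
  assumes "C2_on U f" shows "C1_on U (\<lambda>x. rgrad G f x $ i)"
  unfolding rgrad_def matrix_vector_mult_def
  by (simp, intro C1_on_sum C1_on_mult C1_on_metric_inv C2_on_pd assms)

lemma C1_on_sqrt_det: "C1_on U (\<lambda>x. sqrt (det (G x)))"
proof (rule C1_on_compose[where f = "\<lambda>x. det (G x)" and g = sqrt and g' = "\<lambda>y. inverse (sqrt y) / 2"])
  show "C1_on U (\<lambda>x. det (G x))" by (intro C1_on_det C1_on_metric)
  show "DERIV sqrt (det (G x)) :> inverse (sqrt (det (G x))) / 2" if x: "x \<in> U" for x
    by (rule DERIV_real_sqrt[OF C1_metric_det[OF x]])
  show "continuous_on ((\<lambda>x. det (G x)) ` U) (\<lambda>y. inverse (sqrt y) / 2)"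
    using C1_metric_det by (intro continuous_intros ballI) force+
qed

lemma C1_on_inner_rgrad:
  assumes "C2_on U f" "C2_on U q"
  shows "C1_on U (\<lambda>y. grad f y \<bullet> rgrad G q y)"
  by (simp add: inner_vec_def) (intro C1_on_sum C1_on_mult C1_on_rgrad C2_on_pd assms)

lemma pd_metric_symmetric:
  assumes "x \<in> U" shows "pd k (\<lambda>y. G y $ a $ b) x = pd k (\<lambda>y. G y $ b $ a) x"
  by (rule pd_transform[of U]) (use met assms in \<open>auto simp: C1_metric_def posdef_symmetric\<close>)

text \<open>Compatibility of the connection with the metric: the other two derivatives cancel
  because \<open>G\<close> is symmetric.\<close>

lemma chr_low_metric:
  assumes "x \<in> U" shows "chr_low G x a k b + chr_low G x b k a = pd k (\<lambda>y. G y $ a $ b) x"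
proof -
  have s: "pd k (\<lambda>y. G y $ b $ a) x = pd k (\<lambda>y. G y $ a $ b) x"
    "pd b (\<lambda>y. G y $ k $ a) x = pd b (\<lambda>y. G y $ a $ k) x"
    "pd a (\<lambda>y. G y $ k $ b) x = pd a (\<lambda>y. G y $ b $ k) x"
    by (rule pd_metric_symmetric[OF assms])+
  show ?thesis by (simp add: chr_low_def s field_simps)
qed

text \<open>Differentiating \<open>G * rgrad G q = grad q\<close> gives the derivative of the raised
  gradient without a formula for the derivative of the inverse matrix.\<close>

lemma pd_rgrad_lower:
  assumes x: "x \<in> U" and q: "C2_on U q"
  shows "(\<Sum>a\<in>UNIV. G x $ b $ a * pd k (\<lambda>y. rgrad G q y $ a) x)
    = pd k (pd b q) x - (\<Sum>a\<in>UNIV. pd k (\<lambda>y. G y $ b $ a) x * rgrad G q x $ a)"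
proof -
  have "pd k (pd b q) x = pd k (\<lambda>y. \<Sum>a\<in>UNIV. G y $ b $ a * rgrad G q y $ a) x"
    using met x C1_metric_det by (intro pd_transform[of U]) (auto simp: rgrad_lower C1_metric_def less_le)
  also have "\<dots> = (\<Sum>a\<in>UNIV. pd k (\<lambda>y. G y $ b $ a) x * rgrad G q x $ a
      + G x $ b $ a * pd k (\<lambda>y. rgrad G q y $ a) x)"
    using C1_on_differentiable[OF C1_on_metric x] C1_on_differentiable[OF C1_on_rgrad[OF q] x]
    by (subst pd_sum) (auto intro!: derivative_intros simp: pd_mult)
  finally show ?thesis by (simp add: sum.distrib)
qed

text \<open>The product rule for the inner product of two gradients. The derivative of the metric
  splits into two Christoffel symbols by \<open>chr_low_metric\<close>, and each of them completes
  one of the two ordinary second derivatives to a covariant Hessian.\<close>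

lemma pd_inner_rgrad:
  assumes x: "x \<in> U" and f: "C2_on U f" and q: "C2_on U q"
  shows "pd k (\<lambda>y. grad f y \<bullet> rgrad G q y) x
    = (hess G f x *v rgrad G q x) $ k + (hess G q x *v rgrad G f x) $ k"
proof -
  have pdG: "posdef (G x)" using met x by (simp add: C1_metric_def)
  define F where "F a = rgrad G f x $ a" for a
  define Q where "Q a = rgrad G q x $ a" for a
  define D where "D a b = pd k (\<lambda>y. G y $ a $ b) x" for a b
  define dQ where "dQ a = pd k (\<lambda>y. rgrad G q y $ a) x" for a
  define H where "H a b = chr_low G x a k b" for a b
  have D: "D a b = D b a" "H a b + H b a = D a b" for a b
    using pd_metric_symmetric[OF x] chr_low_metric[OF x] by (auto simp: D_def H_def)
  have "pd k (\<lambda>y. grad f y \<bullet> rgrad G q y) x = pd k (\<lambda>y. \<Sum>a\<in>UNIV. pd a f y * rgrad G q y $ a) x"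
    by (simp add: inner_vec_def)
  also have "\<dots> = (\<Sum>a\<in>UNIV. pd k (pd a f) x * Q a) + (\<Sum>a\<in>UNIV. pd a f x * dQ a)"
    using C1_on_differentiable[OF C2_on_pd[OF f] x] C1_on_differentiable[OF C1_on_rgrad[OF q] x]
    by (subst pd_sum) (auto intro!: derivative_intros simp: pd_mult sum.distrib Q_def dQ_def)
  also have "(\<Sum>a\<in>UNIV. pd a f x * dQ a) = (\<Sum>a\<in>UNIV. (\<Sum>b\<in>UNIV. G x $ a $ b * F b) * dQ a)"
    using C1_metric_det[OF x] by (simp add: rgrad_lower F_def less_le)
  also have "\<dots> = (\<Sum>a\<in>UNIV. \<Sum>b\<in>UNIV. F b * (G x $ b $ a * dQ a))"
    unfolding sum_distrib_right
    by (intro sum.cong refl) (simp add: posdef_symmetric[OF pdG, of _ a for a] ac_simps)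
  also have "\<dots> = (\<Sum>b\<in>UNIV. F b * (\<Sum>a\<in>UNIV. G x $ b $ a * dQ a))"
    by (subst sum.swap) (simp add: sum_distrib_left)
  also have "\<dots> = (\<Sum>b\<in>UNIV. F b * pd k (pd b q) x) - (\<Sum>b\<in>UNIV. \<Sum>a\<in>UNIV. F b * D b a * Q a)"
    by (simp add: dQ_def pd_rgrad_lower[OF x q] right_diff_distrib sum_subtractf sum_distrib_left
        D_def Q_def ac_simps)
  also have "(\<Sum>b\<in>UNIV. \<Sum>a\<in>UNIV. F b * D b a * Q a)
      = (\<Sum>b\<in>UNIV. \<Sum>a\<in>UNIV. H b a * F b * Q a) + (\<Sum>b\<in>UNIV. \<Sum>a\<in>UNIV. H a b * F b * Q a)"
    unfolding sum.distrib[symmetric] D(2)[symmetric] by (simp add: algebra_simps)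
  also have "(\<Sum>b\<in>UNIV. \<Sum>a\<in>UNIV. H b a * F b * Q a) = (\<Sum>a\<in>UNIV. (\<Sum>b\<in>UNIV. H b a * F b) * Q a)"
    by (subst sum.swap) (simp add: sum_distrib_right)
  also have "(\<Sum>b\<in>UNIV. \<Sum>a\<in>UNIV. H a b * F b * Q a) = (\<Sum>b\<in>UNIV. (\<Sum>a\<in>UNIV. H a b * Q a) * F b)"
    by (simp add: sum_distrib_left sum_distrib_right ac_simps)
  finally show ?thesis
    by (simp add: hess_def matrix_vector_mult_def left_diff_distrib sum_subtractf F_def Q_def H_def
        mult.commute[of "rgrad _ _ _ $ _"])
qed

text \<open>The identity \<open>div (\<Phi> \<nabla>q) = \<langle>\<nabla>\<Phi>, \<nabla>q\<rangle>
  + \<Phi> \<Delta>q\<close>, multiplied by the volume density. By Jacobi's formula the logarithmic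
  derivative of \<open>sqrt (det G)\<close> is half the trace of the derivative of the metric, which
  is the part of the trace of the Christoffel symbols not already contained in the derivative of
  \<open>rgrad\<close>.\<close>

lemma divergence_rgrad:
  assumes x: "x \<in> U" and q: "C2_on U q" and \<Phi>: "C1_on U \<Phi>"
  shows "(\<Sum>i\<in>UNIV. pd i (\<lambda>y. sqrt (det (G y)) * (\<Phi> y * rgrad G q y $ i)) x)
    = sqrt (det (G x)) * (grad \<Phi> x \<bullet> rgrad G q x + \<Phi> x * trace (matrix_inv (G x) ** hess G q x))"
proof -
  define Q where "Q a = rgrad G q x $ a" for a
  define D where "D k a b = pd k (\<lambda>y. G y $ a $ b) x" for k a b
  define K where "K a b = matrix_inv (G x) $ a $ b" for a b
  define dQ where "dQ k a = pd k (\<lambda>y. rgrad G q y $ a) x" for k a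
  define s where "s = sqrt (det (G x))"
  have det: "det (G x) > 0" and pdG: "posdef (G x)" using met x C1_metric_det[OF x] by (auto simp: C1_metric_def)
  have s: "s > 0" "s * s = det (G x)" using det by (auto simp: s_def)
  have D: "D k a b = D k b a" for k a b using pd_metric_symmetric[OF x] by (auto simp: D_def)
  have K: "K a b = K b a" for a b unfolding K_def by (rule matrix_inv_symmetric[OF pdG])
  have KG: "(\<Sum>b\<in>UNIV. K i b * G x $ b $ a) = (if i = a then 1 else 0)" for i a
  proof -
    have "(matrix_inv (G x) ** G x) $ i $ a = (if i = a then 1 else 0)"
      using matrix_inv_mult[of "G x"] det by (simp add: mat_def)
    then show ?thesis by (simp add: K_def matrix_matrix_mult_def)
  qed
  have ds: "pd i (\<lambda>y. sqrt (det (G y))) x = s * (\<Sum>a\<in>UNIV. \<Sum>b\<in>UNIV. K a b * D i b a) / 2" for i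
  proof -
    have "pd i (\<lambda>y. sqrt (det (G y))) x = inverse (sqrt (det (G x))) / 2 * pd i (\<lambda>y. det (G y)) x"
      by (rule pd_compose_real[OF C1_on_differentiable[OF C1_on_det[OF C1_on_metric] x] DERIV_real_sqrt[OF det]])
    also have "pd i (\<lambda>y. det (G y)) x = (s * s) * (\<Sum>a\<in>UNIV. \<Sum>b\<in>UNIV. K a b * D i b a)"
      unfolding s(2) K_def D_def
      by (rule pd_det) (use det C1_on_differentiable[OF C1_on_metric x] in auto)
    finally have "pd i (\<lambda>y. sqrt (det (G y))) x
        = inverse s / 2 * (s * s * (\<Sum>a\<in>UNIV. \<Sum>b\<in>UNIV. K a b * D i b a))" by (simp only: s_def)
    then show ?thesis using s(1) by (simp add: field_simps)
  qed
  have dQ: "dQ k i = (\<Sum>b\<in>UNIV. K i b * (pd k (pd b q) x - (\<Sum>a\<in>UNIV. D k b a * Q a)))" for k i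
  proof -
    have "(\<Sum>b\<in>UNIV. K i b * (pd k (pd b q) x - (\<Sum>a\<in>UNIV. D k b a * Q a)))
        = (\<Sum>b\<in>UNIV. K i b * (\<Sum>a\<in>UNIV. G x $ b $ a * dQ k a))"
      by (simp add: dQ_def pd_rgrad_lower[OF x q] D_def Q_def)
    also have "\<dots> = (\<Sum>a\<in>UNIV. (\<Sum>b\<in>UNIV. K i b * G x $ b $ a) * dQ k a)"
      by (simp add: sum_distrib_left sum_distrib_right mult.assoc) (rule sum.swap)
    also have "\<dots> = dQ k i" by (simp add: KG if_distrib[of "\<lambda>z. z * _"] cong: if_cong)
    finally show ?thesis by simp
  qed
  have tr: "trace (matrix_inv (G x) ** hess G q x) = (\<Sum>i\<in>UNIV. dQ i i)
      + (\<Sum>i\<in>UNIV. (\<Sum>a\<in>UNIV. \<Sum>b\<in>UNIV. K a b * D i b a) / 2 * Q i)"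
  proof -
    \<comment> \<open>\<open>P\<close> collects the second derivatives of \<open>q\<close>;
      \<open>R\<close> and \<open>W\<close> are the two possible contractions of the derivative of
      the metric. Of the three Christoffel terms two give \<open>R / 2\<close> each and one gives
      \<open>W / 2\<close> with the opposite sign. Then \<open>P - R\<close> is the coordinate
      divergence of \<open>rgrad\<close>, and \<open>W / 2\<close> comes from the volume
      density.\<close>
    define P where "P = (\<Sum>i\<in>UNIV. \<Sum>b\<in>UNIV. K i b * pd i (pd b q) x)"
    define R where "R = (\<Sum>i\<in>UNIV. \<Sum>b\<in>UNIV. \<Sum>m\<in>UNIV. K i b * D i b m * Q m)"
    define W where "W = (\<Sum>i\<in>UNIV. \<Sum>b\<in>UNIV. \<Sum>m\<in>UNIV. K i b * D m b i * Q m)"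
    have "trace (matrix_inv (G x) ** hess G q x) = (\<Sum>i\<in>UNIV. \<Sum>b\<in>UNIV. K i b * pd b (pd i q) x)
      - (\<Sum>i\<in>UNIV. \<Sum>b\<in>UNIV. \<Sum>m\<in>UNIV. K i b * ((D b m i + D i m b - D m b i) / 2) * Q m)"
      unfolding trace_def matrix_matrix_mult_def hess_def chr_low_def D_def[symmetric] K_def[symmetric]
        Q_def[symmetric] by (simp add: sum_subtractf[symmetric] sum_distrib_left right_diff_distrib[of "K _ _" "pd _ _ _"] mult.assoc)
    also have "(\<Sum>i\<in>UNIV. \<Sum>b\<in>UNIV. K i b * pd b (pd i q) x) = P"
      unfolding P_def by (subst sum.swap) (simp add: K)
    also have "(\<Sum>i\<in>UNIV. \<Sum>b\<in>UNIV. \<Sum>m\<in>UNIV. K i b * ((D b m i + D i m b - D m b i) / 2) * Q m)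
       = (\<Sum>i\<in>UNIV. \<Sum>b\<in>UNIV. \<Sum>m\<in>UNIV. K i b * D b i m * Q m) / 2 + R / 2 - W / 2"
      unfolding R_def W_def by (simp add: sum_divide_distrib sum.distrib[symmetric] sum_subtractf[symmetric]
          D[of _ _ i for i] algebra_simps add_divide_distrib diff_divide_distrib D)
    also have "(\<Sum>i\<in>UNIV. \<Sum>b\<in>UNIV. \<Sum>m\<in>UNIV. K i b * D b i m * Q m) = R"
      unfolding R_def by (subst sum.swap) (simp add: K)
    finally have 1: "trace (matrix_inv (G x) ** hess G q x) = P - R + W / 2" by simp
    have 2: "(\<Sum>i\<in>UNIV. dQ i i) = P - R"
      by (simp add: dQ right_diff_distrib sum_subtractf sum_distrib_left P_def R_def mult.assoc)
    have "W = (\<Sum>i\<in>UNIV. \<Sum>m\<in>UNIV. \<Sum>b\<in>UNIV. K i b * D m b i * Q m)"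
      unfolding W_def by (rule sum.cong[OF refl], rule sum.swap)
    also have "\<dots> = (\<Sum>m\<in>UNIV. \<Sum>i\<in>UNIV. \<Sum>b\<in>UNIV. K i b * D m b i * Q m)"
      by (rule sum.swap)
    finally have "W / 2 = (\<Sum>i\<in>UNIV. (\<Sum>a\<in>UNIV. \<Sum>b\<in>UNIV. K a b * D i b a) / 2 * Q i)"
      by (simp add: sum_distrib_right sum_divide_distrib)
    with 1 2 show ?thesis by simp
  qed
  have "pd i (\<lambda>y. sqrt (det (G y)) * (\<Phi> y * rgrad G q y $ i)) x
     = s * (pd i \<Phi> x * Q i) + \<Phi> x * s * (dQ i i + (\<Sum>a\<in>UNIV. \<Sum>b\<in>UNIV. K a b * D i b a) / 2 * Q i)" for i
    using C1_on_differentiable[OF C1_on_sqrt_det x] C1_on_differentiable[OF \<Phi> x]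
      C1_on_differentiable[OF C1_on_rgrad[OF q] x]
    by (simp add: pd_mult derivative_intros ds s_def[symmetric] Q_def[symmetric] dQ_def[symmetric] algebra_simps)
  then have "(\<Sum>i\<in>UNIV. pd i (\<lambda>y. sqrt (det (G y)) * (\<Phi> y * rgrad G q y $ i)) x)
    = s * (grad \<Phi> x \<bullet> rgrad G q x) + \<Phi> x * s * trace (matrix_inv (G x) ** hess G q x)"
    by (simp add: sum.distrib tr inner_vec_def Q_def sum_distrib_left distrib_left mult.assoc)
  then show ?thesis by (simp add: s_def algebra_simps)
qed

end

subsection \<open>Norms of tensors and their invariance\<close>

lemma frame_matrix_inv:
  fixes G B :: "real^'n::finite^'n"
  assumes "transpose B ** G ** B = mat 1"
  shows "matrix_inv G = B ** transpose B"
proof -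
  have "transpose B ** (G ** B) = mat 1" using assms by (simp add: matrix_mul_assoc)
  then have "G ** B ** transpose B = mat 1" using matrix_left_right_inverse by blast
  then show ?thesis by (intro matrix_inv_eq) (simp add: matrix_mul_assoc)
qed

definition norm2_vec :: "real^'n::finite^'n \<Rightarrow> real^'n \<Rightarrow> real" where
  "norm2_vec G v = v \<bullet> (matrix_inv G *v v)"

text \<open>The squared norm of a covariant 2-tensor: both slots are raised with the inverse metric
  and contracted against \<open>T\<close>.\<close>

definition norm2_mat :: "real^'n::finite^'n \<Rightarrow> real^'n^'n \<Rightarrow> real" where
  "norm2_mat G T = trace (matrix_inv G ** T ** matrix_inv G ** transpose T)"

lemma frame_inner:
  fixes G B :: "real^'n::finite^'n"
  assumes "transpose B ** G ** B = mat 1"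
  shows "v \<bullet> (matrix_inv G *v w) = (transpose B *v v) \<bullet> (transpose B *v w)"
  unfolding frame_matrix_inv[OF assms]
  by (metis dot_lmul_matrix matrix_vector_mul_assoc transpose_matrix_vector)

lemma frame_norm2_vec:
  fixes G B :: "real^'n::finite^'n"
  assumes "transpose B ** G ** B = mat 1"
  shows "norm2_vec G v = (norm (transpose B *v v))\<^sup>2"
  by (simp add: norm2_vec_def frame_inner[OF assms] power2_norm_eq_inner)

lemma trace_mult_transpose:
  fixes M :: "real^'n::finite^'n"
  shows "trace (M ** transpose M) = (norm M)\<^sup>2"
  by (simp add: power2_norm_eq_inner inner_vec_def trace_def matrix_matrix_mult_def transpose_def)

lemma frame_trace:
  fixes G B T :: "real^'n::finite^'n"
  assumes "transpose B ** G ** B = mat 1"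
  shows "trace (matrix_inv G ** T) = trace (transpose B ** T ** B)"
  unfolding frame_matrix_inv[OF assms]
  by (metis matrix_mul_assoc trace_mul_sym)

text \<open>Cyclicity of the trace turns the contraction into the Frobenius norm of the components
  of \<open>T\<close> in the frame.\<close>

lemma frame_norm2_mat:
  fixes G B T :: "real^'n::finite^'n"
  assumes "transpose B ** G ** B = mat 1"
  shows "norm2_mat G T = (norm (transpose B ** T ** B))\<^sup>2"
proof -
  have "norm2_mat G T = trace (transpose B ** (T ** (B ** transpose B) ** transpose T) ** B)"
    unfolding norm2_mat_def using frame_trace[OF assms, of "T ** matrix_inv G ** transpose T"]
    by (simp add: frame_matrix_inv[OF assms] matrix_mul_assoc)
  also have "\<dots> = trace ((transpose B ** T ** B) ** transpose (transpose B ** T ** B))"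
    by (simp add: matrix_transpose_mul matrix_mul_assoc)
  finally show ?thesis by (simp add: trace_mult_transpose)
qed

lemma norm2_vec_nonneg: "posdef G \<Longrightarrow> 0 \<le> norm2_vec G v"
  using posdef_frame[of G] frame_norm2_vec[of _ G v] by (metis zero_le_power2)

lemma norm2_mat_nonneg: "posdef G \<Longrightarrow> 0 \<le> norm2_mat G T"
  using posdef_frame[of G] frame_norm2_mat[of _ G T] by (metis zero_le_power2)

context
  fixes G G' J :: "real^'n::finite^'n"
  assumes G: "posdef G" and G': "posdef G'" and tr: "G = transpose J ** G' ** J"
begin

text \<open>The Jacobian carries an orthonormal frame of \<open>G\<close> to one of
  \<open>G'\<close>, and in matching frames a tensor has the same components; this is the reason why
  the norms are invariant.\<close>

lemma transform_frame:
  fixes B :: "real^'n^'n"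
  assumes "transpose B ** G ** B = mat 1"
  shows "transpose (J ** B) ** G' ** (J ** B) = mat 1"
  using assms unfolding tr by (simp add: matrix_transpose_mul matrix_mul_assoc)

lemma norm2_vec_transform: "norm2_vec G (transpose J *v v) = norm2_vec G' v"
proof -
  obtain B :: "real^'n^'n" where B: "transpose B ** G ** B = mat 1" using posdef_frame[OF G] by blast
  show ?thesis
    unfolding frame_norm2_vec[OF B] frame_norm2_vec[OF transform_frame[OF B]]
    by (simp only: matrix_transpose_mul matrix_vector_mul_assoc)
qed

lemma norm2_mat_transform: "norm2_mat G (transpose J ** T ** J) = norm2_mat G' T"
proof -
  obtain B :: "real^'n^'n" where B: "transpose B ** G ** B = mat 1" using posdef_frame[OF G] by blast
  show ?thesis
    unfolding frame_norm2_mat[OF B] frame_norm2_mat[OF transform_frame[OF B]]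
    by (simp add: matrix_transpose_mul matrix_mul_assoc)
qed

text \<open>The Jacobian pushes gradients forward. It is invertible because the determinant of
  \<open>G\<close> is that of \<open>G'\<close> times the square of its own, so the lowered equation
  can be cancelled by \<open>transpose J\<close>.\<close>

lemma raise_transform: "J *v (matrix_inv G *v (transpose J *v v)) = matrix_inv G' *v v"
proof -
  define F where "F = matrix_inv G *v (transpose J *v v)"
  have "det G \<noteq> 0" "det G' \<noteq> 0" using posdef_det[OF G] posdef_det[OF G'] by auto
  then have "det (transpose J) \<noteq> 0" unfolding tr by (auto simp: det_mul)
  have "G *v F = transpose J *v v"
    using matrix_inv_mult[OF \<open>det G \<noteq> 0\<close>] by (simp add: F_def matrix_vector_mul_assoc)
  then have "transpose J *v (G' *v (J *v F)) = transpose J *v v"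
    unfolding tr by (simp add: matrix_vector_mul_assoc matrix_mul_assoc)
  then have "matrix_inv (transpose J) *v (transpose J *v (G' *v (J *v F)))
      = matrix_inv (transpose J) *v (transpose J *v v)" by simp
  then have "G' *v (J *v F) = v"
    by (simp only: matrix_vector_mul_assoc[of "matrix_inv (transpose J)" "transpose J"]
        matrix_inv_mult[OF \<open>det (transpose J) \<noteq> 0\<close>] matrix_vector_mul_lid)
  then have "matrix_inv G' *v (G' *v (J *v F)) = matrix_inv G' *v v" by simp
  then show ?thesis
    using matrix_inv_mult[OF \<open>det G' \<noteq> 0\<close>] by (simp only: F_def matrix_vector_mul_assoc[of "matrix_inv G'"] matrix_vector_mul_lid)
qed

end

subsection \<open>Change of coordinates\<close>

lemma GDERIV_chain:
  fixes \<psi> :: "real^'n::finite \<Rightarrow> real^'m::finite"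
  assumes "f differentiable (at (\<psi> x))" "\<And>k. (\<lambda>y. \<psi> y $ k) differentiable (at x)"
  shows "GDERIV (\<lambda>y. f (\<psi> y)) x :> (\<chi> i. \<Sum>k\<in>UNIV. pd i (\<lambda>y. \<psi> y $ k) x * pd k f (\<psi> x))"
proof -
  let ?L = "\<lambda>h. \<chi> k. h \<bullet> grad (\<lambda>y. \<psi> y $ k) x"
  have "(\<psi> has_derivative ?L) (at x)"
    using GDERIV_grad[OF assms(2)]
    by (subst has_derivative_componentwise_within) (auto simp: Basis_vec_def inner_axis gderiv_def)
  from has_derivative_compose[OF this, of f] GDERIV_grad[OF assms(1)]
  have d: "((\<lambda>y. f (\<psi> y)) has_derivative (\<lambda>h. ?L h \<bullet> grad f (\<psi> x))) (at x)"
    by (simp add: gderiv_def)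
  have e: "?L h \<bullet> grad f (\<psi> x) = h \<bullet> (\<chi> i. \<Sum>k\<in>UNIV. pd i (\<lambda>y. \<psi> y $ k) x * pd k f (\<psi> x))" for h
  proof -
    have "?L h \<bullet> grad f (\<psi> x)
        = (\<Sum>k\<in>UNIV. \<Sum>i\<in>UNIV. h $ i * (pd i (\<lambda>y. \<psi> y $ k) x * pd k f (\<psi> x)))"
      by (simp add: inner_vec_def sum_distrib_right mult.assoc)
    also have "\<dots> = (\<Sum>i\<in>UNIV. \<Sum>k\<in>UNIV. h $ i * (pd i (\<lambda>y. \<psi> y $ k) x * pd k f (\<psi> x)))"
      by (rule sum.swap)
    finally show ?thesis by (simp add: inner_vec_def sum_distrib_left)
  qed
  show ?thesis using d by (simp only: e gderiv_def)
qed

lemma pd_chain: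
  fixes \<psi> :: "real^'n::finite \<Rightarrow> real^'m::finite"
  assumes "f differentiable (at (\<psi> x))" "\<And>k. (\<lambda>y. \<psi> y $ k) differentiable (at x)"
  shows "pd i (\<lambda>y. f (\<psi> y)) x = (\<Sum>k\<in>UNIV. pd i (\<lambda>y. \<psi> y $ k) x * pd k f (\<psi> x))"
  using pd_unique[OF GDERIV_chain[of f \<psi> x, OF assms], of i] by simp

text \<open>The inhomogeneous part of the transformed Christoffel symbols cancels the second
  derivatives of \<psi>. The chain rule for \<open>e\<close> is assumed at the point
  \<open>x\<close> alone: \<open>e\<close> and \<open>e'\<close> will be extensions of one function
  from a one-sided domain, and \<open>e = e' \<circ> \<psi>\<close> may fail off that
  domain.\<close>

lemma hess_transform:
  fixes \<psi> :: "real^'n::finite \<Rightarrow> real^'n" and G G' :: "real^'n \<Rightarrow> real^'n^'n"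
  defines "J \<equiv> \<lambda>y. (\<chi> k i. pd i (\<lambda>y. \<psi> y $ k) y)"
  assumes U: "open U" "x \<in> U" and \<psi>: "\<And>k. C2_on U (\<lambda>y. \<psi> y $ k)"
    and G': "\<And>k l. (\<lambda>z. G' z $ k $ l) differentiable (at (\<psi> x))"
    and pos: "posdef (G x)" "posdef (G' (\<psi> x))"
    and sym: "\<And>k l s. pd s (\<lambda>z. G' z $ k $ l) (\<psi> x) = pd s (\<lambda>z. G' z $ l $ k) (\<psi> x)"
    and tr: "\<And>y. y \<in> U \<Longrightarrow> G y = transpose (J y) ** G' (\<psi> y) ** J y"
    and e1: "\<And>i. pd i e x = (\<Sum>k\<in>UNIV. pd i (\<lambda>y. \<psi> y $ k) x * pd k e' (\<psi> x))"
    and e2: "\<And>i j. pd i (pd j e) x = (\<Sum>k\<in>UNIV. pd i (pd j (\<lambda>y. \<psi> y $ k)) x * pd k e' (\<psi> x))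
        + (\<Sum>k\<in>UNIV. \<Sum>l\<in>UNIV. J x $ k $ i * J x $ l $ j * pd k (pd l e') (\<psi> x))"
  shows "hess G e x = transpose (J x) ** hess G' e' (\<psi> x) ** J x"
proof -
  define j where "j k i = pd i (\<lambda>y. \<psi> y $ k) x" for k i
  define P where "P k i l = pd i (pd l (\<lambda>y. \<psi> y $ k)) x" for k i l
  define g where "g k l = G' (\<psi> x) $ k $ l" for k l
  define D where "D s k l = pd s (\<lambda>z. G' z $ k $ l) (\<psi> x)" for s k l
  define F where "F m = rgrad G e x $ m" for m
  define Q where "Q m = rgrad G' e' (\<psi> x) $ m" for m
  \<comment> \<open>In the derivative of \<open>G = transpose J ** G' ** J\<close> the derivative
    falls either on a Jacobian, which gives \<Theta> twice, or on \<open>G'\<close>, which gives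
    \<Xi>. Since \<Theta> is symmetric in its first two indices, one copy of it survives in the
    Christoffel symbol, and this is the inhomogeneous part.\<close>
  define \<Theta> where "\<Theta> r a b = (\<Sum>k\<in>UNIV. \<Sum>l\<in>UNIV. P k r a * j l b * g k l)" for r a b
  define \<Xi> where "\<Xi> r a b = (\<Sum>k\<in>UNIV. \<Sum>l\<in>UNIV. \<Sum>s\<in>UNIV. j k a * j l b * j s r * D s k l)" for r a b
  have P: "P k i l = P k l i" for k i l unfolding P_def by (rule pd_commute[OF U \<psi>])
  have g: "g k l = g l k" for k l unfolding g_def by (rule posdef_symmetric[OF pos(2)])
  have D: "D s k l = D s l k" for s k l unfolding D_def by (rule sym)
  have \<psi>d: "(\<lambda>y. \<psi> y $ k) differentiable (at x)" for k
    using C1_on_differentiable[OF C2_on_C1[OF \<psi>] U(2)] .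
  have \<psi>dd: "pd i (\<lambda>y. \<psi> y $ k) differentiable (at x)" for i k
    using C1_on_differentiable[OF C2_on_pd[OF \<psi>] U(2)] .
  have G'd: "(\<lambda>y. G' (\<psi> y) $ k $ l) differentiable (at x)" for k l
    using GDERIV_imp_differentiable[OF GDERIV_chain[of "\<lambda>z. G' z $ k $ l" \<psi> x, OF G' \<psi>d]] .
  have dG: "pd r (\<lambda>y. G y $ a $ b) x = \<Theta> r a b + \<Theta> r b a + \<Xi> r a b" for r a b
  proof -
    have "pd r (\<lambda>y. G y $ a $ b) x = pd r (\<lambda>y. \<Sum>l\<in>UNIV. \<Sum>k\<in>UNIV.
        pd a (\<lambda>y. \<psi> y $ k) y * G' (\<psi> y) $ k $ l * pd b (\<lambda>y. \<psi> y $ l) y) x"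
      by (rule pd_transform[OF U]) (simp add: tr J_def matrix_matrix_mult_def transpose_def sum_distrib_right)
    also have "\<dots> = (\<Sum>l\<in>UNIV. \<Sum>k\<in>UNIV. P k r a * g k l * j l b
       + j k a * (\<Sum>s\<in>UNIV. j s r * D s k l) * j l b + j k a * g k l * P l r b)"
      by (simp add: pd_sum pd_mult \<psi>dd G'd derivative_intros P_def g_def j_def
          pd_chain[of "\<lambda>z. G' z $ _ $ _" \<psi> x, OF G' \<psi>d] D_def distrib_right)
    also have "\<dots> = (\<Sum>l\<in>UNIV. \<Sum>k\<in>UNIV. P k r a * j l b * g k l)
       + (\<Sum>l\<in>UNIV. \<Sum>k\<in>UNIV. \<Sum>s\<in>UNIV. j k a * j l b * j s r * D s k l)
       + (\<Sum>l\<in>UNIV. \<Sum>k\<in>UNIV. P l r b * j k a * g l k)"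
      by (simp add: sum.distrib sum_distrib_left sum_distrib_right g[of _ "_::'n"] ac_simps)
    also have "(\<Sum>l\<in>UNIV. \<Sum>k\<in>UNIV. P k r a * j l b * g k l) = \<Theta> r a b"
      unfolding \<Theta>_def by (rule sum.swap)
    also have "(\<Sum>l\<in>UNIV. \<Sum>k\<in>UNIV. \<Sum>s\<in>UNIV. j k a * j l b * j s r * D s k l) = \<Xi> r a b"
      unfolding \<Xi>_def by (rule sum.swap)
    finally show ?thesis by (simp add: \<Theta>_def)
  qed
  have \<Theta>: "\<Theta> r a b = \<Theta> a r b" for r a b by (simp add: \<Theta>_def P)
  have chr: "chr_low G x m a b = \<Theta> a b m + (\<Xi> a m b + \<Xi> b m a - \<Xi> m a b) / 2" for m a b
    by (simp add: chr_low_def dG \<Theta>[of a m] \<Theta>[of b m] \<Theta>[of b a] field_simps)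
  have JF: "(\<Sum>m\<in>UNIV. j k m * F m) = Q k" for k
  proof -
    have ge: "grad e x = transpose (J x) *v grad e' (\<psi> x)"
      by (simp add: vec_eq_iff e1 matrix_vector_mult_def transpose_def J_def)
    have "J x *v rgrad G e x = rgrad G' e' (\<psi> x)"
      unfolding rgrad_def ge by (rule raise_transform[OF pos tr[OF U(2)]])
    from arg_cong[OF this, of "\<lambda>v. v $ k"]
    show ?thesis by (simp add: matrix_vector_mult_def J_def j_def F_def Q_def)
  qed
  have \<Theta>F: "(\<Sum>m\<in>UNIV. \<Theta> a b m * F m) = (\<Sum>k\<in>UNIV. P k a b * pd k e' (\<psi> x))" for a b
  proof -
    have gQ: "(\<Sum>l\<in>UNIV. g k l * Q l) = pd k e' (\<psi> x)" for k
      using rgrad_lower[of G' "\<psi> x" k e'] posdef_det[OF pos(2)] by (simp add: g_def Q_def)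
    have "(\<Sum>m\<in>UNIV. \<Theta> a b m * F m)
        = (\<Sum>k\<in>UNIV. \<Sum>m\<in>UNIV. \<Sum>l\<in>UNIV. P k a b * j l m * g k l * F m)"
      unfolding \<Theta>_def sum_distrib_right by (rule sum.swap)
    also have "\<dots> = (\<Sum>k\<in>UNIV. \<Sum>l\<in>UNIV. P k a b * g k l * (\<Sum>m\<in>UNIV. j l m * F m))"
      unfolding sum_distrib_left
      by (rule sum.cong[OF refl], subst sum.swap) (simp add: ac_simps)
    also have "\<dots> = (\<Sum>k\<in>UNIV. P k a b * (\<Sum>l\<in>UNIV. g k l * Q l))"
      by (simp add: JF sum_distrib_left mult.assoc)
    finally show ?thesis by (simp add: gQ)
  qed
  have \<Xi>1: "(\<Sum>m\<in>UNIV. \<Xi> r m b * F m) = (\<Sum>k\<in>UNIV. \<Sum>l\<in>UNIV. \<Sum>s\<in>UNIV. j l b * j s r * (D s k l * Q k))"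
    for r b
  proof -
    have "(\<Sum>m\<in>UNIV. \<Xi> r m b * F m)
        = (\<Sum>k\<in>UNIV. \<Sum>m\<in>UNIV. \<Sum>l\<in>UNIV. \<Sum>s\<in>UNIV. j k m * j l b * j s r * D s k l * F m)"
      unfolding \<Xi>_def sum_distrib_right by (rule sum.swap)
    also have "\<dots> = (\<Sum>k\<in>UNIV. \<Sum>m\<in>UNIV. (j k m * F m) * (\<Sum>l\<in>UNIV. \<Sum>s\<in>UNIV. j l b * j s r * D s k l))"
      by (simp add: sum_distrib_left ac_simps)
    also have "\<dots> = (\<Sum>k\<in>UNIV. Q k * (\<Sum>l\<in>UNIV. \<Sum>s\<in>UNIV. j l b * j s r * D s k l))"
      by (simp add: sum_distrib_right[symmetric] JF)
    finally show ?thesis by (simp add: sum_distrib_left ac_simps)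
  qed
  have \<Xi>2: "(\<Sum>m\<in>UNIV. \<Xi> m a b * F m) = (\<Sum>k\<in>UNIV. \<Sum>l\<in>UNIV. \<Sum>s\<in>UNIV. j k a * j l b * (D s k l * Q s))"
    for a b
  proof -
    have "(\<Sum>m\<in>UNIV. \<Xi> m a b * F m)
        = (\<Sum>k\<in>UNIV. \<Sum>m\<in>UNIV. \<Sum>l\<in>UNIV. \<Sum>s\<in>UNIV. j k a * j l b * j s m * D s k l * F m)"
      unfolding \<Xi>_def sum_distrib_right by (rule sum.swap)
    also have "\<dots> = (\<Sum>k\<in>UNIV. \<Sum>l\<in>UNIV. \<Sum>m\<in>UNIV. \<Sum>s\<in>UNIV. j k a * j l b * j s m * D s k l * F m)"
      by (rule sum.cong[OF refl], rule sum.swap)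
    also have "\<dots> = (\<Sum>k\<in>UNIV. \<Sum>l\<in>UNIV. \<Sum>s\<in>UNIV. \<Sum>m\<in>UNIV. j k a * j l b * D s k l * (j s m * F m))"
      by (rule sum.cong[OF refl], rule sum.cong[OF refl], subst sum.swap) (simp add: ac_simps)
    also have "\<dots> = (\<Sum>k\<in>UNIV. \<Sum>l\<in>UNIV. \<Sum>s\<in>UNIV. j k a * j l b * D s k l * Q s)"
      by (simp add: sum_distrib_left[symmetric] JF)
    finally show ?thesis by (simp add: mult.assoc)
  qed
  have chrF: "(\<Sum>m\<in>UNIV. chr_low G x m a b * F m) = (\<Sum>k\<in>UNIV. P k a b * pd k e' (\<psi> x))
     + (\<Sum>k\<in>UNIV. \<Sum>l\<in>UNIV. j k a * j l b * (\<Sum>m\<in>UNIV. chr_low G' (\<psi> x) m k l * Q m))" for a b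
  proof -
    have "(\<Sum>k\<in>UNIV. \<Sum>l\<in>UNIV. j k a * j l b * (\<Sum>m\<in>UNIV. chr_low G' (\<psi> x) m k l * Q m))
      = ((\<Sum>k\<in>UNIV. \<Sum>l\<in>UNIV. \<Sum>m\<in>UNIV. j k a * j l b * (D k m l * Q m))
        + (\<Sum>k\<in>UNIV. \<Sum>l\<in>UNIV. \<Sum>m\<in>UNIV. j k a * j l b * (D l m k * Q m))
        - (\<Sum>k\<in>UNIV. \<Sum>l\<in>UNIV. \<Sum>m\<in>UNIV. j k a * j l b * (D m k l * Q m))) / 2"
      by (simp add: chr_low_def D_def sum_distrib_left sum.distrib[symmetric] sum_subtractf[symmetric]
          sum_divide_distrib field_simps)
    also have "(\<Sum>k\<in>UNIV. \<Sum>l\<in>UNIV. \<Sum>m\<in>UNIV. j k a * j l b * (D m k l * Q m)) = (\<Sum>m\<in>UNIV. \<Xi> m a b * F m)"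
      by (simp add: \<Xi>2)
    also have "(\<Sum>k\<in>UNIV. \<Sum>l\<in>UNIV. \<Sum>m\<in>UNIV. j k a * j l b * (D k m l * Q m)) = (\<Sum>m\<in>UNIV. \<Xi> a m b * F m)"
    proof -
      have "(\<Sum>k\<in>UNIV. \<Sum>l\<in>UNIV. \<Sum>m\<in>UNIV. j k a * j l b * (D k m l * Q m))
        = (\<Sum>k\<in>UNIV. \<Sum>m\<in>UNIV. \<Sum>l\<in>UNIV. j k a * j l b * (D k m l * Q m))"
        by (rule sum.cong[OF refl], rule sum.swap)
      also have "\<dots> = (\<Sum>m\<in>UNIV. \<Sum>k\<in>UNIV. \<Sum>l\<in>UNIV. j k a * j l b * (D k m l * Q m))" by (rule sum.swap)
      also have "\<dots> = (\<Sum>m\<in>UNIV. \<Sum>l\<in>UNIV. \<Sum>k\<in>UNIV. j k a * j l b * (D k m l * Q m))"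
        by (rule sum.cong[OF refl], rule sum.swap)
      finally show ?thesis by (simp add: \<Xi>1 mult.commute[of "j _ a"])
    qed
    also have "(\<Sum>k\<in>UNIV. \<Sum>l\<in>UNIV. \<Sum>m\<in>UNIV. j k a * j l b * (D l m k * Q m)) = (\<Sum>m\<in>UNIV. \<Xi> b m a * F m)"
    proof -
      have "(\<Sum>k\<in>UNIV. \<Sum>l\<in>UNIV. \<Sum>m\<in>UNIV. j k a * j l b * (D l m k * Q m))
        = (\<Sum>k\<in>UNIV. \<Sum>m\<in>UNIV. \<Sum>l\<in>UNIV. j k a * j l b * (D l m k * Q m))"
        by (rule sum.cong[OF refl], rule sum.swap)
      also have "\<dots> = (\<Sum>m\<in>UNIV. \<Sum>k\<in>UNIV. \<Sum>l\<in>UNIV. j k a * j l b * (D l m k * Q m))" by (rule sum.swap)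
      finally show ?thesis by (simp add: \<Xi>1)
    qed
    finally show ?thesis
      by (simp add: chr distrib_right sum.distrib \<Theta>F[symmetric] sum_subtractf[symmetric] left_diff_distrib
          sum_divide_distrib add_divide_distrib diff_divide_distrib) (simp add: sum.distrib sum_subtractf)
  qed
  have "hess G e x $ a $ b = (\<Sum>k\<in>UNIV. \<Sum>l\<in>UNIV. j k a * j l b * hess G' e' (\<psi> x) $ k $ l)" for a b
    by (simp add: hess_def e2 F_def[symmetric] Q_def[symmetric] chrF P_def J_def j_def
        right_diff_distrib sum_subtractf)
  then show ?thesis
    by (simp add: vec_eq_iff matrix_matrix_mult_def transpose_def J_def j_def sum_distrib_right)
       (intro allI, subst sum.swap, simp add: ac_simps)
qed

subsection \<open>Conformal change\<close>

lemma matrix_inv_scaleR: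
  fixes h :: "real^'n::finite^'n"
  assumes "det h \<noteq> 0" "c \<noteq> 0"
  shows "matrix_inv (c *\<^sub>R h) = (1 / c) *\<^sub>R matrix_inv h"
  using assms matrix_inv_mult[OF assms(1)]
  by (intro matrix_inv_eq) (simp add: matrix_mult_scaleR_left matrix_mult_scaleR_right)

lemma posdef_scaleR: "posdef h \<Longrightarrow> c > 0 \<Longrightarrow> posdef (c *\<^sub>R h)"
  by (auto simp: posdef_def vec_eq_iff transpose_def scaleR_matrix_vector_assoc[symmetric])

locale conformal_chart =
  fixes U :: "(real^'n::finite) set" and h :: "real^'n \<Rightarrow> real^'n^'n" and \<rho> :: "real^'n \<Rightarrow> real"
  assumes h: "C1_metric U h" and \<rho>: "C2_on U \<rho>" and \<rho>_pos: "\<And>x. x \<in> U \<Longrightarrow> \<rho> x > 0"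
begin

definition G :: "real^'n \<Rightarrow> real^'n^'n" where "G x = (1 / (\<rho> x)\<^sup>2) *\<^sub>R h x"
definition t :: "real^'n \<Rightarrow> real" where "t x = - ln (\<rho> x)"

lemma open_U: "open U" using h by (simp add: C1_metric_def)

lemma posdef_h: "x \<in> U \<Longrightarrow> posdef (h x)" using h by (simp add: C1_metric_def)

lemma metric_G: "C1_metric U G"
  unfolding C1_metric_def
proof (intro conjI ballI allI open_U)
  show "posdef (G x)" if "x \<in> U" for x
    unfolding G_def using posdef_h[OF that] \<rho>_pos[OF that] by (intro posdef_scaleR) auto
  have "C1_on U (\<lambda>x. 1 / (\<rho> x)\<^sup>2 * h x $ i $ j)" for i j
    using \<rho>_pos by (intro C1_on_mult C1_on_divide C1_on_power C1_on_const C2_on_C1[OF \<rho>] C1_on_metric[OF h]) force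
  then show "C1_on U (\<lambda>x. G x $ i $ j)" for i j by (simp add: G_def)
qed

lemma pd_t: assumes "x \<in> U" shows "pd i t x = - pd i \<rho> x / \<rho> x"
proof -
  have "pd i (\<lambda>y. - ln (\<rho> y)) x = (- (1 / \<rho> x)) * pd i \<rho> x"
    using \<rho>_pos[OF assms]
    by (intro pd_compose_real[where g = "\<lambda>y. - ln y"] C1_on_differentiable[OF C2_on_C1[OF \<rho>] assms])
       (auto intro!: derivative_eq_intros)
  then show ?thesis by (simp add: t_def[abs_def])
qed

lemma C2_t: "C2_on U t"
  unfolding C2_on_def
proof (intro conjI allI)
  have "C1_on U (\<lambda>x. - ln (\<rho> x))"
    using \<rho>_pos
    by (intro C1_on_compose[where f = \<rho> and g = "\<lambda>y. - ln y" and g' = "\<lambda>y. - (1 / y)"] C2_on_C1[OF \<rho>])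
       (force intro!: derivative_eq_intros continuous_intros)+
  then show "C1_on U t" by (simp add: t_def[abs_def])
  have "C1_on U (\<lambda>x. - pd i \<rho> x / \<rho> x)" for i
    using \<rho>_pos by (intro C1_on_divide C1_on_minus C2_on_pd[OF \<rho>] C2_on_C1[OF \<rho>]) force
  then show "C1_on U (pd i t)" for i
    by (intro C1_on_cong[OF open_U, of "\<lambda>x. - pd i \<rho> x / \<rho> x" "pd i t"]) (simp_all add: pd_t)
qed

lemma rgrad_G:
  assumes "x \<in> U" shows "rgrad G q x = (\<rho> x)\<^sup>2 *\<^sub>R rgrad h q x"
  using \<rho>_pos[OF assms] posdef_det[OF posdef_h[OF assms]]
  by (simp add: rgrad_def G_def matrix_inv_scaleR scaleR_matrix_vector_assoc[symmetric])

lemma grad_t: "x \<in> U \<Longrightarrow> grad t x = - (1 / \<rho> x) *\<^sub>R grad \<rho> x"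
  by (simp add: vec_eq_iff pd_t)

lemma norm2_vec_G: "x \<in> U \<Longrightarrow> norm2_vec (G x) v = (\<rho> x)\<^sup>2 * norm2_vec (h x) v"
  using \<rho>_pos[of x] posdef_det[OF posdef_h[of x]]
  by (simp add: norm2_vec_def G_def matrix_inv_scaleR scaleR_matrix_vector_assoc[symmetric])

lemma norm2_mat_G: "x \<in> U \<Longrightarrow> norm2_mat (G x) T = (\<rho> x) ^ 4 * norm2_mat (h x) T"
  using \<rho>_pos[of x] posdef_det[OF posdef_h[of x]]
  by (simp add: norm2_mat_def G_def matrix_inv_scaleR matrix_mult_scaleR_left matrix_mult_scaleR_right
      trace_def sum_distrib_left power4_eq_xxxx power2_eq_square mult.assoc)

text \<open>This is the source of \<open>\<nabla>\<^sup>2t \<approx> g - dt dt\<close>. The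
  conformal factor contributes terms in d\<rho> only, which combine to
  \<open>- dt dt + |d\<rho>|\<^sup>2 g\<close>. The remaining Hessian of \<rho> is divided by
  \<rho>, but passing from \<open>h\<close> to \<open>G\<close> multiplies the norm of a 2-tensor by
  \<rho> squared, so its norm is of order \<rho>.\<close>

lemma hess_t:
  assumes x: "x \<in> U"
  shows "hess G t x $ i $ j = - (1 / \<rho> x) * hess h \<rho> x $ i $ j
     - pd i t x * pd j t x + norm2_vec (h x) (grad \<rho> x) * G x $ i $ j"
proof -
  define r where "r = \<rho> x"
  have r: "r > 0" using \<rho>_pos[OF x] by (simp add: r_def)
  define p where "p k = pd k \<rho> x" for k
  define P where "P m = rgrad h \<rho> x $ m" for m
  have d\<rho>: "\<rho> differentiable (at x)" "pd k \<rho> differentiable (at x)" for k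
    using C1_on_differentiable[OF C2_on_C1[OF \<rho>] x] C1_on_differentiable[OF C2_on_pd[OF \<rho>] x] by auto
  have dh: "(\<lambda>y. h y $ a $ b) differentiable (at x)" for a b
    using C1_on_differentiable[OF C1_on_metric[OF h] x] .
  have inv: "pd k (\<lambda>y. 1 / (\<rho> y)\<^sup>2) x = - 2 * p k / r ^ 3" for k
  proof -
    have "pd k (\<lambda>y. 1 / (\<rho> y)\<^sup>2) x = (- 2 / (\<rho> x) ^ 3) * pd k \<rho> x"
      using r d\<rho>(1) by (intro pd_compose_real[where g = "\<lambda>y. 1 / y\<^sup>2"])
        (auto intro!: derivative_eq_intros simp: r_def field_simps power2_eq_square power3_eq_cube)
    then show ?thesis by (simp add: p_def r_def)
  qed
  have dinv: "(\<lambda>y. 1 / (\<rho> y)\<^sup>2) differentiable (at x)"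
    using d\<rho>(1) r by (intro derivative_intros) (auto simp: r_def)
  have dG: "pd k (\<lambda>y. G y $ a $ b) x = - 2 * p k / r ^ 3 * h x $ a $ b + 1 / r\<^sup>2 * pd k (\<lambda>y. h y $ a $ b) x"
    for k a b
    using pd_mult[OF dinv dh, of k a b] by (simp add: G_def inv r_def)
  have chr: "chr_low G x m i j = chr_low h x m i j / r\<^sup>2
      - (p i * h x $ m $ j + p j * h x $ m $ i - p m * h x $ i $ j) / r ^ 3" for m
    unfolding chr_low_def dG by (simp add: algebra_simps add_divide_distrib diff_divide_distrib)
  have up: "rgrad G t x $ m = - r * P m" for m
    unfolding rgrad_G[OF x] using r
    by (simp add: rgrad_def grad_t[OF x] P_def r_def matrix_vector_mult_scaleR power2_eq_square)
      (simp add: linear_neg[OF matrix_vector_mul_linear] matrix_vector_mult_scaleR field_simps)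
  have low: "(\<Sum>m\<in>UNIV. h x $ m $ k * P m) = p k" for k
    using rgrad_lower[of h x k \<rho>] posdef_det[OF posdef_h[OF x]] posdef_symmetric[OF posdef_h[OF x], of _ k]
    by (simp add: P_def p_def)
  have l: "(\<Sum>m\<in>UNIV. p m * P m) = norm2_vec (h x) (grad \<rho> x)"
    by (simp add: norm2_vec_def rgrad_def P_def p_def inner_vec_def)
  have tt: "pd i (pd j t) x = - pd i (pd j \<rho>) x / r + p i * p j / r\<^sup>2"
  proof -
    have "pd i (pd j t) x = pd i (\<lambda>y. pd j \<rho> y * (- (1 / \<rho> y))) x"
      by (rule pd_transform[OF open_U x]) (simp add: pd_t)
    also have "\<dots> = pd i (pd j \<rho>) x * (- (1 / \<rho> x)) + pd j \<rho> x * pd i (\<lambda>y. - (1 / \<rho> y)) x"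
      using d\<rho> r by (intro pd_mult) (auto intro!: derivative_intros simp: r_def)
    also have "pd i (\<lambda>y. - (1 / \<rho> y)) x = (1 / r\<^sup>2) * pd i \<rho> x"
      using r d\<rho>(1) unfolding r_def by (intro pd_compose_real[where g = "\<lambda>y. - (1 / y)"])
        (auto intro!: derivative_eq_intros simp: field_simps power2_eq_square)
    finally show ?thesis by (simp add: r_def p_def)
  qed
  have "(\<Sum>m\<in>UNIV. chr_low G x m i j * rgrad G t x $ m)
      = - (1 / r) * (\<Sum>m\<in>UNIV. chr_low h x m i j * P m)
        + (p i * (\<Sum>m\<in>UNIV. h x $ m $ j * P m) + p j * (\<Sum>m\<in>UNIV. h x $ m $ i * P m)
           - h x $ i $ j * (\<Sum>m\<in>UNIV. p m * P m)) / r\<^sup>2"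
    unfolding sum_distrib_left sum.distrib[symmetric] sum_subtractf[symmetric] sum_divide_distrib
    using r by (intro sum.cong refl) (simp add: chr up field_simps power2_eq_square power3_eq_cube)
  also have "\<dots> = - (1 / r) * (\<Sum>m\<in>UNIV. chr_low h x m i j * P m)
      + (2 * p i * p j - h x $ i $ j * norm2_vec (h x) (grad \<rho> x)) / r\<^sup>2"
    by (simp add: low l)
  finally have Z: "(\<Sum>m\<in>UNIV. chr_low G x m i j * rgrad G t x $ m)
      = - (1 / r) * (\<Sum>m\<in>UNIV. chr_low h x m i j * P m)
      + (2 * p i * p j - h x $ i $ j * norm2_vec (h x) (grad \<rho> x)) / r\<^sup>2" .
  have "hess G t x $ i $ j = - pd i (pd j \<rho>) x / r + p i * p j / r\<^sup>2
      - (- (1 / r) * (\<Sum>m\<in>UNIV. chr_low h x m i j * P m)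
      + (2 * p i * p j - h x $ i $ j * norm2_vec (h x) (grad \<rho> x)) / r\<^sup>2)"
    by (simp add: hess_def tt Z)
  also have "\<dots> = - (1 / r) * (pd i (pd j \<rho>) x - (\<Sum>m\<in>UNIV. chr_low h x m i j * P m))
      - (- p i / r) * (- p j / r) + norm2_vec (h x) (grad \<rho> x) * (1 / r\<^sup>2 * h x $ i $ j)"
    using r by (simp add: field_simps power2_eq_square)
  finally show ?thesis
    by (simp add: hess_def P_def[symmetric] pd_t[OF x] G_def r_def[symmetric] p_def[symmetric])
qed

end

section \<open>Integration in coordinates\<close>

lemma integrable_compact_support:
  fixes f :: "real^'n::finite \<Rightarrow> real"
  assumes "open \<Omega>" "compact C" "C \<subseteq> \<Omega>" "continuous_on \<Omega> f" "\<And>x. x \<in> \<Omega> - C \<Longrightarrow> f x = 0"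
  shows "integrable lborel (\<lambda>x. indicator \<Omega> x * f x)"
proof -
  have "integrable lborel (\<lambda>x. indicator C x *\<^sub>R f x)"
    using assms by (intro borel_integrable_compact) (auto intro: continuous_on_subset)
  moreover have "(\<lambda>x. indicator C x *\<^sub>R f x) = (\<lambda>x. indicator \<Omega> x * f x)"
    using assms(3,5) by (auto simp: indicator_def fun_eq_iff)
  ultimately show ?thesis by simp
qed

text \<open>Difference quotients of a compactly supported function have integral zero by translation
  invariance of Lebesgue measure, and they converge to the partial derivative under domination. No
  Fubini argument or shape of \<Omega> enters.\<close>

lemma integral_pd_eq_0:
  fixes F :: "real^'n::finite \<Rightarrow> real"
  assumes \<Omega>: "open \<Omega>" and C: "compact C" "C \<subseteq> \<Omega>" and F: "C1_on \<Omega> F"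
    and supp: "\<And>x. x \<in> \<Omega> - C \<Longrightarrow> F x = 0"
  shows "integrable lborel (\<lambda>x. indicator \<Omega> x * pd i F x)"
    and "(\<integral>x. indicator \<Omega> x * pd i F x \<partial>lborel) = 0"
proof -
  \<comment> \<open>Extension by zero: \<Omega> and the complement of \<open>C\<close> are open,
    cover the space, and \<open>f\<close> is differentiable on both.\<close>
  define f where "f x = (if x \<in> \<Omega> then F x else 0)" for x
  define e :: "real^'n" where "e = axis i 1"
  have oC: "open (- C)" using C compact_imp_closed by blast
  have f\<Omega>: "f y = F y" if "y \<in> \<Omega>" for y using that by (simp add: f_def)
  have fC: "f y = 0" if "y \<notin> C" for y using that supp by (auto simp: f_def)
  have C1: "C1_on \<Omega> f" by (rule C1_on_cong[OF \<Omega> _ F]) (simp add: f\<Omega>)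
  have C1': "C1_on (- C) f" by (rule C1_on_cong[OF oC _ C1_on_const[of _ 0]]) (simp add: fC)
  have diff: "f differentiable (at x)" for x
    using C1_on_differentiable[OF C1, of x] C1_on_differentiable[OF C1', of x] C(2) by auto
  have cont: "continuous_on UNIV f"
    using diff by (meson continuous_at_imp_continuous_on differentiable_imp_continuous_within)
  have pd0: "pd i f x = 0" if "x \<notin> C" for x
    using pd_transform[OF oC, of x f "\<lambda>_. 0" i] that fC pd_unique[OF GDERIV_const, of i 0 x] by auto
  have pdF: "pd i f x = indicator \<Omega> x * pd i F x" for x
    using pd0[of x] C(2) pd_transform[OF \<Omega>, of x f F i] f\<Omega> by (cases "x \<in> \<Omega>") (auto simp: indicator_def)
  have "compact (pd i f ` C)"
    using C C1_on_continuous_pd[OF C1_on_subset[OF C1 C(2)]] by (intro compact_continuous_image) auto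
  then obtain M where M: "\<And>x. x \<in> C \<Longrightarrow> \<bar>pd i f x\<bar> \<le> M"
    by (meson bounded_real compact_imp_bounded imageI)
  define M' where "M' = max M 0"
  have M': "\<bar>pd i f x\<bar> \<le> M'" "0 \<le> M'" for x
    using M[of x] pd0[of x] by (cases "x \<in> C"; force simp: M'_def)+
  obtain R where R: "C \<subseteq> cball 0 R"
    using compact_imp_bounded[OF C(1)] unfolding bounded_iff by (meson mem_cball_0 subsetI)
  \<comment> \<open>The shift \<open>1 / Suc m\<close> is at most 1, so all quotients vanish outside
    the ball of radius \<open>R + 1\<close>, and the mean value theorem bounds them by
    \<open>M'\<close> inside.\<close>
  define w where "w x = M' * indicator (cball 0 (R + 1)) x" for x :: "real^'n"
  define s where "s m x = (f (x + (1 / Suc m) *\<^sub>R e) - f x) * real (Suc m)" for m :: nat and x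
  have lip: "\<bar>f (x + a *\<^sub>R e) - f x\<bar> \<le> a * M'" if "a > 0" for x a
  proof -
    have "\<exists>z>0. z < a \<and> f (x + a *\<^sub>R e) - f (x + 0 *\<^sub>R e) = (a - 0) * pd i f (x + z *\<^sub>R e)"
      unfolding e_def using that diff by (intro MVT2) (auto intro!: DERIV_along_axis)
    then obtain z where z: "f (x + a *\<^sub>R e) - f x = a * pd i f (x + z *\<^sub>R e)" by auto
    show ?thesis unfolding z using M'(1)[of "x + z *\<^sub>R e"] that by (simp add: abs_mult)
  qed
  have s_le: "norm (s m x) \<le> w x" for m x
  proof (cases "x \<in> cball 0 (R + 1)")
    case True
    then show ?thesis using mult_right_mono[OF lip[of "1 / Suc m" x], of "Suc m"]
      by (simp add: s_def w_def abs_mult)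
  next
    case False
    have "x + (1 / Suc m) *\<^sub>R e \<notin> cball 0 R"
    proof
      assume a: "x + (1 / Suc m) *\<^sub>R e \<in> cball 0 R"
      have "norm x \<le> norm (x + (1 / Suc m) *\<^sub>R e) + norm ((1 / Suc m) *\<^sub>R e)"
        using norm_triangle_ineq4[of "x + (1 / Suc m) *\<^sub>R e" "(1 / Suc m) *\<^sub>R e"] by simp
      also have "norm ((1 / Suc m) *\<^sub>R e) \<le> 1" by (simp add: e_def norm_axis_1)
      finally show False using a False by simp
    qed
    moreover have "x \<notin> cball 0 R" using False by auto
    ultimately have "f (x + (1 / Suc m) *\<^sub>R e) = 0" "f x = 0" using R fC by blast+
    then show ?thesis using M'(2) by (simp add: s_def w_def)
  qed
  have s_lim: "(\<lambda>m. s m x) \<longlonglongrightarrow> pd i f x" for x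
  proof -
    have "DERIV (\<lambda>a. f (x + a *\<^sub>R e)) 0 :> pd i f (x + 0 *\<^sub>R axis i 1)"
      unfolding e_def by (rule DERIV_along_axis) (simp add: diff)
    then have "((\<lambda>a. (f (x + a *\<^sub>R e) - f x) / a) \<longlongrightarrow> pd i f x) (at 0)" by (simp add: DERIV_def)
    moreover have "filterlim (\<lambda>m. 1 / real (Suc m)) (at 0) sequentially"
      unfolding filterlim_at using LIMSEQ_inverse_real_of_nat
      by (auto simp: inverse_eq_divide)
    ultimately have "(\<lambda>m. (f (x + (1 / Suc m) *\<^sub>R e) - f x) / (1 / Suc m)) \<longlonglongrightarrow> pd i f x"
      by (rule filterlim_compose)
    then show ?thesis by (simp add: s_def[abs_def])
  qed
  have fi: "integrable lborel f"
  proof -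
    have "integrable lborel (\<lambda>x. indicator UNIV x * f x)"
      by (rule integrable_compact_support[of _ C]) (use C cont fC in auto)
    then show ?thesis by simp
  qed
  have fm: "f \<in> borel_measurable borel" using cont by (rule borel_measurable_continuous_onI)
  have tr: "integrable lborel (\<lambda>x. f (x + a))" "(\<integral>x. f (x + a) \<partial>lborel) = (\<integral>x. f x \<partial>lborel)" for a
  proof -
    have d: "distr lborel borel (\<lambda>x. x + a) = lborel"
    proof -
      have "(\<lambda>x. x + a) = (+) a" by (simp add: fun_eq_iff)
      then show ?thesis by (simp add: lborel_distr_plus)
    qed
    have "integrable (distr lborel borel (\<lambda>x. x + a)) f" using fi by (simp add: d)
    then show "integrable lborel (\<lambda>x. f (x + a))" by (subst (asm) integrable_distr_eq) (auto simp: fm)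
    have "(\<integral>x. f x \<partial>lborel) = (\<integral>x. f x \<partial>distr lborel borel (\<lambda>x. x + a))" by (simp add: d)
    also have "\<dots> = (\<integral>x. f (x + a) \<partial>lborel)" using fm by (subst integral_distr) auto
    finally show "(\<integral>x. f (x + a) \<partial>lborel) = (\<integral>x. f x \<partial>lborel)" by simp
  qed
  have s0: "(\<integral>x. s m x \<partial>lborel) = 0" for m
    using tr[of "(1 / Suc m) *\<^sub>R e"] fi by (simp add: s_def)
  have si: "integrable lborel (s m)" for m
    unfolding s_def[abs_def] using tr(1) fi by (intro integrable_mult_left Bochner_Integration.integrable_diff)
  have wi: "integrable lborel w"
    unfolding w_def[abs_def] using emeasure_bounded_finite[of "cball (0::real^'n) (R + 1)"]
    by (intro integrable_mult_right integrable_real_indicator) auto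
  have mb: "pd i f \<in> borel_measurable lborel"
    by (rule borel_measurable_LIMSEQ_real[OF s_lim]) (use si in auto)
  have "integrable lborel (pd i f)"
    by (rule integrable_dominated_convergence[where w = w and s = s]) (use mb si wi s_lim s_le in auto)
  then show "integrable lborel (\<lambda>x. indicator \<Omega> x * pd i F x)" by (simp add: pdF[symmetric])
  have "(\<lambda>m. \<integral>x. s m x \<partial>lborel) \<longlonglongrightarrow> (\<integral>x. pd i f x \<partial>lborel)"
    by (rule integral_dominated_convergence[where w = w]) (use mb si wi s_lim s_le in auto)
  then have "(\<integral>x. pd i f x \<partial>lborel) = 0" by (simp add: s0 LIMSEQ_const_iff)
  then show "(\<integral>x. indicator \<Omega> x * pd i F x \<partial>lborel) = 0" by (simp add: pdF[symmetric])
qed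

text \<open>Infinitely many pairwise disjoint translates of a bounded piece stay in a bounded region.\<close>

lemma null_set_transversal:
  fixes S :: "(real^'n::finite) set"
  assumes S: "S \<in> sets borel" and tr: "\<And>x a. x \<in> S \<Longrightarrow> x + a *\<^sub>R axis i 1 \<in> S \<Longrightarrow> a = 0"
  shows "emeasure lborel S = 0"
proof -
  have b0: "S \<inter> cball 0 (real k) \<in> null_sets lebesgue" for k :: nat
  proof -
    define B where "B = S \<inter> cball 0 (real k)"
    have B: "B \<in> lmeasurable"
        unfolding B_def using S by (intro fmeasurable_Int_fmeasurable[of "cball 0 (real k)" lebesgue S, simplified Int_commute]) auto
    define T where "T m = (+) ((1 / Suc m) *\<^sub>R axis i 1) ` B" for m :: nat
    have T: "T m \<in> lmeasurable" "measure lebesgue (T m) = measure lebesgue B" for m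
      unfolding T_def by (auto intro: measurable_translation[OF B] measure_translation)
    have disj: "disjoint_family T"
    proof (unfold disjoint_family_on_def, intro ballI impI)
      fix m k :: nat assume "m \<noteq> k"
      have "m = k" if "x \<in> B" "y \<in> B" "(1 / Suc m) *\<^sub>R axis i 1 + x = (1 / Suc k) *\<^sub>R axis i 1 + y" for x y
      proof -
        have "y = x + (1 / Suc m - 1 / Suc k) *\<^sub>R axis i 1"
          using that(3) by (simp add: algebra_simps)
        then have "1 / real (Suc m) - 1 / real (Suc k) = 0" using tr[of x] that(1,2) by (metis B_def IntD1)
        then show ?thesis by (simp add: field_simps del: of_nat_Suc)
      qed
      then show "T m \<inter> T k = {}" using \<open>m \<noteq> k\<close> by (auto simp: T_def)
    qed
    have sub: "T m \<subseteq> cball 0 (real k + 1)" for m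
    proof
      fix y assume "y \<in> T m"
      then obtain x where x: "x \<in> B" "y = (1 / Suc m) *\<^sub>R axis i 1 + x" by (auto simp: T_def)
      have "norm y \<le> norm ((1 / Suc m) *\<^sub>R axis i 1 :: real^'n) + norm x"
        unfolding x(2) by (rule norm_triangle_ineq)
      also have "norm ((1 / Suc m) *\<^sub>R axis i 1 :: real^'n) \<le> 1" by (simp add: norm_axis_1)
      finally show "y \<in> cball 0 (real k + 1)" using x(1) by (simp add: B_def)
    qed
    have "real m * measure lebesgue B \<le> measure lebesgue (cball (0::real^'n) (real k + 1))" for m :: nat
    proof -
      have "real m * measure lebesgue B = (\<Sum>j<m. measure lebesgue (T j))" by (simp add: T)
      also have "\<dots> = measure lebesgue (\<Union>j<m. T j)"
        using disj T by (intro measure_UNION'[symmetric])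
          (auto simp: disjoint_family_on_def pairwise_def disjnt_def)
      also have "\<dots> \<le> measure lebesgue (cball (0::real^'n) (real k + 1))"
        using sub T by (intro measure_mono_fmeasurable) auto
      finally show ?thesis .
    qed
    then have "measure lebesgue B \<le> 0"
      by (metis reals_Archimedean3 not_le linorder_not_less)
    then have "measure lebesgue B = 0" by (simp add: antisym)
    then show ?thesis using B unfolding B_def[symmetric]
      by (simp add: null_sets_def fmeasurableD emeasure_eq_measure2)
  qed
  have "S = (\<Union>k::nat. S \<inter> cball 0 (real k))"
    using real_arch_simple by (auto simp: subset_iff)
  then have "S \<in> null_sets lebesgue" using b0 by (metis null_sets_UN)
  then show ?thesis using S by (auto simp: null_sets_def)
qed

section \<open>The pointwise multiplier inequality\<close>

text \<open>Here \<open>p\<close> plays the role of the derivative of \<open>N\<close> in the direction of the gradient of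
  \<open>t = - ln \<rho>\<close>. In the exactly hyperbolic case \<open>N + p\<close> and \<open>N - p\<close> grow like \<open>exp t\<close> and
  \<open>exp (- t)\<close> for solutions of \<open>T N = 0\<close>. The first is controlled by its own growth; the wrong
  sign of the second is compensated by the identity for the divergence of \<open>N \<nabla>N\<close>.\<close>

lemma multiplier_constants:
  fixes n s :: real
  assumes "n \<ge> 2" "s < (n + 1) / 2"
  obtains K \<kappa> c where "K > 0" "\<kappa> > 1/4" "c > 0" "c \<le> 1"
    "\<And>N p. K * (n + 1 - 2 * s) * (N + p)\<^sup>2 + \<kappa> * (n - 3 - 2 * s) * (N - p)\<^sup>2
        + p\<^sup>2 + n * N\<^sup>2 - 2 * s * N * p \<ge> c * (N\<^sup>2 + p\<^sup>2)"
proof -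
  \<comment> \<open>The rates \<open>n + 1 - 2 * s\<close> and \<open>n - 3 - 2 * s\<close> are made
    up of \<open>2\<close> and \<open>- 2\<close>, from the growth of the squares of
    \<open>N + p\<close> and \<open>N - p\<close>, of the Laplacian \<open>n - 1\<close> of
    \<open>t\<close>, and of \<open>- 2 * s\<close> from the weight. \<sigma> is the excess of
    \<kappa> over 1/4, small enough to cost at most \<open>a\<close>; \<open>K\<close> is scaled to
    produce the coefficient \<open>5 * a / 2\<close>.\<close>
  define a where "a = (n - 1) / 4"
  define \<sigma> where "\<sigma> = a / (\<bar>n - 3 - 2 * s\<bar> + 1)"
  define K where "K = 5 * a / (2 * (n + 1 - 2 * s))"
  have a: "a > 0" using assms by (simp add: a_def)
  have g: "n + 1 - 2 * s > 0" using assms by simp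
  have \<sigma>: "\<sigma> > 0" using a by (simp add: \<sigma>_def add_nonneg_pos)
  have K: "K > 0" using a g by (simp add: K_def)
  have Kg: "K * (n + 1 - 2 * s) = 5 * a / 2" unfolding K_def using g by (simp only: times_divide_eq_left) (simp add: field_simps)
  define w where "w = n - 3 - 2 * s"
  have "\<bar>w\<bar> + 1 \<noteq> 0" by linarith
  then have "\<sigma> * (\<bar>w\<bar> + 1) = a" by (simp add: \<sigma>_def w_def)
  moreover have "\<sigma> * (- w) \<le> \<sigma> * (\<bar>w\<bar> + 1)" using \<sigma> by (intro mult_left_mono) auto
  ultimately have "\<sigma> * w \<ge> - a" by simp
  then have \<sigma>b: "\<sigma> * (n - 3 - 2 * s) \<ge> - a" by (simp only: w_def)
  have main: "K * (n + 1 - 2 * s) * (N + p)\<^sup>2 + (1/4 + \<sigma>) * (n - 3 - 2 * s) * (N - p)\<^sup>2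
        + p\<^sup>2 + n * N\<^sup>2 - 2 * s * N * p \<ge> a * (N\<^sup>2 + p\<^sup>2)" for N p
  proof -
    \<comment> \<open>At \<kappa> = 1/4 the coefficient of the square of \<open>Q\<close> is
      \<open>(n - 1) / 2 = 2 * a\<close>, whatever \<open>s\<close> is; this is how the possibly
      negative rate is compensated.\<close>
    define S Q where "S = N + p" and "Q = N - p"
    have "K * (n + 1 - 2 * s) * S\<^sup>2 + (1/4 + \<sigma>) * (n - 3 - 2 * s) * Q\<^sup>2 + p\<^sup>2 + n * N\<^sup>2 - 2 * s * N * p
      = (5 * a / 2 + (n + 1 - 2 * s) / 4) * S\<^sup>2 + (2 * a + \<sigma> * (n - 3 - 2 * s)) * Q\<^sup>2 + 2 * a * (S * Q)"
      unfolding Kg by (simp add: S_def Q_def a_def power2_eq_square field_simps)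
    also have "\<dots> \<ge> (5 * a / 2) * S\<^sup>2 + a * Q\<^sup>2 + 2 * a * (S * Q)"
      using g \<sigma>b by (intro add_mono mult_right_mono order.refl) auto
    \<comment> \<open>The factor 5/2 is chosen so that the mixed term is absorbed in one complete
      square and half of \<open>S\<^sup>2 + Q\<^sup>2\<close> remains.\<close>
    moreover have "(5 * a / 2) * S\<^sup>2 + a * Q\<^sup>2 + 2 * a * (S * Q)
        = a * ((2 * S + Q)\<^sup>2 / 2 + (S\<^sup>2 + Q\<^sup>2) / 2)"
      by (simp add: power2_eq_square field_simps)
    moreover have "\<dots> \<ge> a * ((S\<^sup>2 + Q\<^sup>2) / 2)" using a by (intro mult_left_mono) auto
    moreover have "a * ((S\<^sup>2 + Q\<^sup>2) / 2) = a * (N\<^sup>2 + p\<^sup>2)"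
      by (simp add: S_def Q_def power2_eq_square field_simps)
    ultimately show ?thesis unfolding S_def[symmetric] Q_def[symmetric] by linarith
  qed
  show ?thesis
  proof (rule that[of K "1/4 + \<sigma>" "min a 1"])
    show "K * (n + 1 - 2 * s) * (N + p)\<^sup>2 + (1/4 + \<sigma>) * (n - 3 - 2 * s) * (N - p)\<^sup>2
        + p\<^sup>2 + n * N\<^sup>2 - 2 * s * N * p \<ge> min a 1 * (N\<^sup>2 + p\<^sup>2)" for N p
      using main[of N p] mult_right_mono[of "min a 1" a "N\<^sup>2 + p\<^sup>2"] by simp
  qed (use K \<sigma> a in auto)
qed

lemma norm_matrix_vector_mult_le:
  fixes T :: "real^'n::finite^'m::finite"
  shows "norm (T *v v) \<le> norm T * norm v"
proof (rule power2_le_imp_le)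
  have "(norm (T *v v))\<^sup>2 = (\<Sum>i\<in>UNIV. (T $ i \<bullet> v)\<^sup>2)"
    unfolding power2_norm_eq_inner inner_vec_def[of "T *v v"] by (simp add: matrix_mult_dot power2_eq_square)
  also have "\<dots> \<le> (\<Sum>i\<in>UNIV. (norm (T $ i))\<^sup>2 * (norm v)\<^sup>2)"
    by (intro sum_mono) (metis Cauchy_Schwarz_ineq power2_norm_eq_inner)
  also have "\<dots> = (norm T)\<^sup>2 * (norm v)\<^sup>2"
    by (simp add: power2_norm_eq_inner inner_vec_def[of T] sum_distrib_right)
  finally show "(norm (T *v v))\<^sup>2 \<le> (norm T * norm v)\<^sup>2" by (simp add: power_mult_distrib)
qed simp

lemma inner_matrix_le:
  fixes T :: "real^'n::finite^'m::finite"
  shows "\<bar>a \<bullet> (T *v v)\<bar> \<le> norm T * norm a * norm v"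
proof -
  have "\<bar>a \<bullet> (T *v v)\<bar> \<le> norm a * norm (T *v v)" by (rule Cauchy_Schwarz_ineq2)
  also have "\<dots> \<le> norm a * (norm T * norm v)" by (intro mult_left_mono norm_matrix_vector_mult_le) auto
  finally show ?thesis by (simp add: ac_simps)
qed

lemma trace_le:
  fixes T :: "real^'n::finite^'n"
  shows "\<bar>trace T\<bar> \<le> real CARD('n) * norm T"
proof -
  have "\<bar>trace T\<bar> \<le> (\<Sum>i\<in>(UNIV::'n set). norm T)"
    unfolding trace_def
  proof (rule order.trans[OF sum_abs sum_mono])
    fix i show "\<bar>T $ i $ i\<bar> \<le> norm T"
      using component_le_norm_cart[of "T $ i" i] Finite_Cartesian_Product.norm_nth_le[of T i] by linarith
  qed
  then show ?thesis by simp
qed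

text \<open>The scalar form of the perturbation argument: \<open>l\<close> is
  \<open>|dt|\<^sup>2\<close>, \<theta> is the deviation from \<open>N\<close> of the derivative of
  \<open>p\<close> along the gradient of \<open>t\<close>, \<tau> is the size of \<open>T\<close>,
  and \<open>m\<^sup>2\<close> is the energy. Errors of order \<eta> are quadratic in
  \<open>m\<close> and are absorbed; errors with \<tau> are linear in \<open>m\<close> and are split
  by Young's inequality. Each uses a quarter of \<open>c\<close>.\<close>

lemma multiplier_perturbation:
  fixes n s K \<kappa> c N p l V \<theta> e \<tau> trE trT m :: real
  assumes K: "K > 0" "\<kappa> > 0" and c: "0 < c" "c \<le> 1" and n: "n \<ge> 2"
    and main: "K * (n + 1 - 2 * s) * (N + p)\<^sup>2 + \<kappa> * (n - 3 - 2 * s) * (N - p)\<^sup>2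
        + p\<^sup>2 + n * N\<^sup>2 - 2 * s * N * p \<ge> c * (N\<^sup>2 + p\<^sup>2)"
    and m: "m \<ge> 0" "m\<^sup>2 = N\<^sup>2 + V" "V \<ge> 0" and pV: "p\<^sup>2 \<le> l * V" and l: "\<bar>l - 1\<bar> \<le> \<eta>" "\<eta> \<le> 1" "0 \<le> \<eta>"
    and \<tau>: "\<tau> \<ge> 0" and \<theta>: "\<bar>\<theta>\<bar> \<le> 2 * \<tau> + 5 * \<eta> * m"
    and tr: "\<bar>trE\<bar> \<le> n * \<eta>" "\<bar>trT\<bar> \<le> n * \<tau>"
    and \<eta>: "\<eta> * (1 + (K + \<kappa>) * (39 + 18 * \<bar>s\<bar> + 9 * n)) \<le> c / 4"
  shows "2 * K * (N + p) * (p + (N + \<theta>)) + 2 * \<kappa> * (N - p) * (p - (N + \<theta>))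
     + (K * (N + p)\<^sup>2 + \<kappa> * (N - p)\<^sup>2) * (n - l + trE - 2 * s * l) + V + N * (n * N + trT) - 2 * s * N * p
     \<ge> c / 2 * m\<^sup>2 - (12 * (K + \<kappa>) + n)\<^sup>2 / c * \<tau>\<^sup>2"
proof -
  define S Q u where "S = N + p" and "Q = N - p" and "u = K * S\<^sup>2 + \<kappa> * Q\<^sup>2"
  define L where "L = 12 * (K + \<kappa>) + n"
  have "N\<^sup>2 \<le> m\<^sup>2" using m by simp
  then have Nm: "\<bar>N\<bar> \<le> m" using m(1) by (metis abs_le_square_iff abs_of_nonneg)
  have "V \<le> m\<^sup>2" using m by simp
  have "p\<^sup>2 \<le> 2 * V" using pV mult_right_mono[of l 2 V] l m by linarith
  also have "\<dots> \<le> (2 * m)\<^sup>2" using \<open>V \<le> m\<^sup>2\<close> m by (simp add: power_mult_distrib)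
  finally have pm: "\<bar>p\<bar> \<le> 2 * m" using m(1) by (metis abs_le_square_iff abs_of_nonneg mult_nonneg_nonneg zero_le_numeral)
  have Sm: "\<bar>S\<bar> \<le> 3 * m" "\<bar>Q\<bar> \<le> 3 * m" using Nm pm by (auto simp: S_def Q_def)
  have S2: "S\<^sup>2 \<le> 9 * m\<^sup>2" "Q\<^sup>2 \<le> 9 * m\<^sup>2"
    using power_mono[OF Sm(1), of 2] power_mono[OF Sm(2), of 2] by (auto simp: power_mult_distrib)
  have u: "0 \<le> u" "u \<le> 9 * (K + \<kappa>) * m\<^sup>2"
  proof -
    show "0 \<le> u" using K by (simp add: u_def)
    have "u \<le> K * (9 * m\<^sup>2) + \<kappa> * (9 * m\<^sup>2)"
      unfolding u_def using K S2 by (intro add_mono mult_left_mono) auto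
    then show "u \<le> 9 * (K + \<kappa>) * m\<^sup>2" by (simp add: algebra_simps)
  qed
  have e1: "\<bar>2 * (K * S - \<kappa> * Q) * \<theta>\<bar> \<le> 6 * (K + \<kappa>) * m * (2 * \<tau> + 5 * \<eta> * m)"
  proof -
    have "\<bar>2 * (K * S - \<kappa> * Q)\<bar> \<le> 2 * (K * \<bar>S\<bar> + \<kappa> * \<bar>Q\<bar>)"
      using K abs_triangle_ineq4[of "K * S" "\<kappa> * Q"] by (simp add: abs_mult)
    also have "\<dots> \<le> 2 * (K * (3 * m) + \<kappa> * (3 * m))"
      using K Sm by (intro mult_left_mono add_mono) auto
    finally have "\<bar>2 * (K * S - \<kappa> * Q)\<bar> \<le> 6 * (K + \<kappa>) * m" by (simp add: algebra_simps)
    then have "\<bar>2 * (K * S - \<kappa> * Q)\<bar> * \<bar>\<theta>\<bar> \<le> 6 * (K + \<kappa>) * m * (2 * \<tau> + 5 * \<eta> * m)"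
      using \<theta> K m by (intro mult_mono) auto
    then show ?thesis by (simp add: abs_mult)
  qed
  have e2: "\<bar>u * ((1 - l) * (1 + 2 * s) + trE)\<bar> \<le> 9 * (K + \<kappa>) * m\<^sup>2 * (\<eta> * (1 + 2 * \<bar>s\<bar> + n))"
  proof -
    have "\<bar>(1 - l) * (1 + 2 * s)\<bar> \<le> \<eta> * (1 + 2 * \<bar>s\<bar>)"
      unfolding abs_mult using l by (intro mult_mono) auto
    then have "\<bar>(1 - l) * (1 + 2 * s) + trE\<bar> \<le> \<eta> * (1 + 2 * \<bar>s\<bar> + n)"
      using tr(1) by (simp add: algebra_simps)
    then have "u * \<bar>(1 - l) * (1 + 2 * s) + trE\<bar> \<le> 9 * (K + \<kappa>) * m\<^sup>2 * (\<eta> * (1 + 2 * \<bar>s\<bar> + n))"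
      using u K by (intro mult_mono) auto
    then show ?thesis using u by (simp add: abs_mult)
  qed
  have e3: "\<bar>N * trT\<bar> \<le> n * m * \<tau>"
  proof -
    have "\<bar>N\<bar> * \<bar>trT\<bar> \<le> m * (n * \<tau>)" using Nm tr m by (intro mult_mono) auto
    then show ?thesis by (simp add: abs_mult ac_simps)
  qed
  have e4: "V - p\<^sup>2 \<ge> - \<eta> * m\<^sup>2"
  proof -
    have "V - l * V \<ge> - (\<eta> * V)" using l mult_right_mono[of "l - 1" \<eta> V] m(3) by (simp add: algebra_simps)
    moreover have "\<eta> * V \<le> \<eta> * m\<^sup>2" using \<open>V \<le> m\<^sup>2\<close> l(3) by (rule mult_left_mono)
    ultimately show ?thesis using pV by linarith
  qed
  \<comment> \<open>\<open>main\<close> controls only the radial part \<open>p\<close> of the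
    gradient. The full square \<open>V\<close> enters with coefficient 1, so for
    \<open>c \<le> 1\<close> the tangential part \<open>V - p\<^sup>2\<close> supplies the rest; it
    is nonnegative up to the error \<open>\<eta> m\<^sup>2\<close>.\<close>
  have e5: "c * (N\<^sup>2 + p\<^sup>2) + (V - p\<^sup>2) \<ge> c * m\<^sup>2 - \<eta> * m\<^sup>2"
  proof -
    have "c * (N\<^sup>2 + p\<^sup>2) + (V - p\<^sup>2) = c * m\<^sup>2 + (1 - c) * (V - p\<^sup>2)"
      unfolding m(2) by (simp add: algebra_simps)
    also have "(1 - c) * (V - p\<^sup>2) \<ge> (1 - c) * (- \<eta> * m\<^sup>2)" using e4 c by (intro mult_left_mono) auto
    moreover have "(1 - c) * (- \<eta> * m\<^sup>2) \<ge> - \<eta> * m\<^sup>2" using c l(3) by (simp add: algebra_simps)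
    ultimately show ?thesis by simp
  qed
  \<comment> \<open>The expression is separated exactly into its model value, the tangential part of
    the gradient, and three error terms.\<close>
  have ee: "2 * K * S * (p + (N + \<theta>)) + 2 * \<kappa> * Q * (p - (N + \<theta>))
     + u * (n - l + trE - 2 * s * l) + V + N * (n * N + trT) - 2 * s * N * p
    = (K * (n + 1 - 2 * s) * S\<^sup>2 + \<kappa> * (n - 3 - 2 * s) * Q\<^sup>2 + p\<^sup>2 + n * N\<^sup>2 - 2 * s * N * p)
      + (V - p\<^sup>2) + 2 * (K * S - \<kappa> * Q) * \<theta> + u * ((1 - l) * (1 + 2 * s) + trE) + N * trT"
    by (simp add: u_def S_def Q_def power2_eq_square algebra_simps)
  have "\<dots> \<ge> c * m\<^sup>2 - \<eta> * m\<^sup>2 - 6 * (K + \<kappa>) * m * (2 * \<tau> + 5 * \<eta> * m)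
      - 9 * (K + \<kappa>) * m\<^sup>2 * (\<eta> * (1 + 2 * \<bar>s\<bar> + n)) - n * m * \<tau>"
    using main e1 e2 e3 e5 unfolding S_def[symmetric] Q_def[symmetric] by linarith
  moreover have "c * m\<^sup>2 - \<eta> * m\<^sup>2 - 6 * (K + \<kappa>) * m * (2 * \<tau> + 5 * \<eta> * m)
      - 9 * (K + \<kappa>) * m\<^sup>2 * (\<eta> * (1 + 2 * \<bar>s\<bar> + n)) - n * m * \<tau>
    = c * m\<^sup>2 - \<eta> * (1 + (K + \<kappa>) * (39 + 18 * \<bar>s\<bar> + 9 * n)) * m\<^sup>2 - L * m * \<tau>"
    by (simp add: L_def power2_eq_square algebra_simps)
  moreover have "\<eta> * (1 + (K + \<kappa>) * (39 + 18 * \<bar>s\<bar> + 9 * n)) * m\<^sup>2 \<le> c / 4 * m\<^sup>2"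
    using \<eta> by (intro mult_right_mono) auto
  moreover have "L * m * \<tau> \<le> c / 4 * m\<^sup>2 + L\<^sup>2 / c * \<tau>\<^sup>2"
  proof -
    have "0 \<le> (c * m / 2 - L * \<tau>)\<^sup>2 / c" using c by simp
    also have "\<dots> = c / 4 * m\<^sup>2 + L\<^sup>2 / c * \<tau>\<^sup>2 - L * m * \<tau>"
      using c by (simp add: power2_eq_square field_simps)
    finally show ?thesis by simp
  qed
  ultimately show ?thesis unfolding S_def[symmetric] Q_def[symmetric] u_def[symmetric] L_def[symmetric] ee
    by linarith
qed

definition multiplier :: "real \<Rightarrow> real \<Rightarrow> real \<Rightarrow> real \<Rightarrow> real" where
  "multiplier K \<kappa> N p = K * (N + p)\<^sup>2 + \<kappa> * (N - p)\<^sup>2"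

text \<open>The density of the divergence of \<open>b z(t) exp (- 2 s t) (u \<nabla>t + N \<nabla>N)\<close>, \<open>u\<close> the multiplier, in an
  orthonormal frame: \<open>a\<close>, \<open>v\<close>, \<open>d\<close> are the gradients of \<open>t\<close>, \<open>N\<close>, \<open>b\<close>, and \<open>T\<close>, \<open>E\<close> are the
  tensors \<open>\<nabla>\<^sup>2N - N g\<close> and \<open>\<nabla>\<^sup>2t - g + dt dt\<close>.\<close>

definition mult_flux ::
    "real \<Rightarrow> real \<Rightarrow> real \<Rightarrow> real^'n::finite \<Rightarrow> real^'n \<Rightarrow> real^'n \<Rightarrow> real^'n^'n \<Rightarrow> real^'n^'n \<Rightarrow>
     real \<Rightarrow> real \<Rightarrow> real \<Rightarrow> real \<Rightarrow> real" where
  "mult_flux s K \<kappa> a v d T E N b z z' =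
     b * (z' - 2 * s * z) * (multiplier K \<kappa> N (v \<bullet> a) * (a \<bullet> a) + N * (v \<bullet> a))
         + z * (multiplier K \<kappa> N (v \<bullet> a) * (d \<bullet> a) + N * (d \<bullet> v))
         + b * z * (2 * K * (N + v \<bullet> a) * (v \<bullet> a + (a \<bullet> (T *v a) + N * (a \<bullet> a) + v \<bullet> a - (a \<bullet> a) * (v \<bullet> a) + a \<bullet> (E *v v)))
            + 2 * \<kappa> * (N - v \<bullet> a) * (v \<bullet> a - (a \<bullet> (T *v a) + N * (a \<bullet> a) + v \<bullet> a - (a \<bullet> a) * (v \<bullet> a) + a \<bullet> (E *v v)))
            + multiplier K \<kappa> N (v \<bullet> a) * (real CARD('n) - a \<bullet> a + trace E)
            + v \<bullet> v + N * (real CARD('n) * N + trace T))"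

text \<open>The term with \<open>z'\<close> has the sign of the flux and is discarded. The gradient
  \<open>d\<close> of the bump function is not estimated here: it appears on the left at the cost of
  \<open>C * norm d\<close> times the energy, to be absorbed once \<open>norm d\<close> is known to
  be small.\<close>

lemma multiplier_pointwise:
  fixes s :: real
  assumes n: "CARD('n::finite) \<ge> 2" and s: "s < (real CARD('n) + 1) / 2"
  obtains K \<kappa> c C \<eta> where "K > 0" "\<kappa> > 0" "c > 0" "C > 0" "\<eta> > 0"
    "\<And>(a::real^'n) v d T E N b z z'. \<lbrakk>b \<ge> 0; z \<ge> 0; z' \<ge> 0; \<bar>a \<bullet> a - 1\<bar> \<le> \<eta>; norm E \<le> \<eta>\<rbrakk> \<Longrightarrow>
       z * (b * (c * (N\<^sup>2 + v \<bullet> v) - C * (norm T)\<^sup>2) - C * norm d * (N\<^sup>2 + v \<bullet> v))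
       \<le> mult_flux s K \<kappa> a v d T E N b z z'"
proof -
  define n where "n = real CARD('n)"
  have n2: "n \<ge> 2" using n by (simp add: n_def)
  obtain K \<kappa> c where K: "K > 0" "\<kappa> > 1/4" "c > 0" "c \<le> 1" and main:
    "\<And>N p. K * (n + 1 - 2 * s) * (N + p)\<^sup>2 + \<kappa> * (n - 3 - 2 * s) * (N - p)\<^sup>2
        + p\<^sup>2 + n * N\<^sup>2 - 2 * s * N * p \<ge> c * (N\<^sup>2 + p\<^sup>2)"
    using multiplier_constants[OF n2] s by (metis n_def)
  have \<kappa>: "\<kappa> > 0" using K by simp
  define A where "A = 1 + (K + \<kappa>) * (39 + 18 * \<bar>s\<bar> + 9 * n)"
  have A: "A > 0" unfolding A_def using K \<kappa> n2 by (intro add_pos_nonneg mult_nonneg_nonneg) auto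
  \<comment> \<open>The bound \<open>1 - 1 / (4 * \<kappa>)\<close>, positive since \<kappa> > 1/4,
    keeps \<open>\<kappa> * (1 - \<eta>) \<ge> 1/4\<close> for the sign of the flux;
    \<open>c / (4 * A)\<close> is what the perturbation lemma asks for.\<close>
  define \<eta> where "\<eta> = min (min 1 (1 - 1 / (4 * \<kappa>))) (c / (4 * A))"
  have \<eta>: "\<eta> > 0" "\<eta> \<le> 1" "\<eta> * A \<le> c / 4" "\<kappa> * (1 - \<eta>) \<ge> 1 / 4"
  proof -
    show "\<eta> > 0" using K A by (auto simp: \<eta>_def field_simps)
    show "\<eta> \<le> 1" by (simp add: \<eta>_def)
    have "\<eta> * A \<le> c / (4 * A) * A" unfolding \<eta>_def using A by (intro mult_right_mono) auto
    then show "\<eta> * A \<le> c / 4" using A by simp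
    have "\<eta> \<le> 1 - 1 / (4 * \<kappa>)" by (simp add: \<eta>_def)
    then have "\<kappa> * (1 / (4 * \<kappa>)) \<le> \<kappa> * (1 - \<eta>)" using \<kappa> by (intro mult_left_mono) auto
    then show "\<kappa> * (1 - \<eta>) \<ge> 1 / 4" using \<kappa> by simp
  qed
  define C1 where "C1 = (12 * (K + \<kappa>) + n)\<^sup>2 / c"
  \<comment> \<open>The multiplier is at most \<open>9 * (K + \<kappa>)\<close> times the energy and
    \<open>norm a \<le> 2\<close>, which gives 18; the 1 accounts for the part
    \<open>N * (d \<bullet> v)\<close>.\<close>
  define C2 where "C2 = 18 * (K + \<kappa>) + 1"
  have C1: "C1 > 0" "C2 > 0" using K \<kappa> n2 by (auto simp: C1_def C2_def add_pos_pos)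
  show ?thesis
  proof (rule that[of K \<kappa> "c / 2" "max C1 C2" \<eta>])
    fix a v d :: "real^'n" and T E :: "real^'n^'n" and N b z z' :: real
    assume b: "b \<ge> 0" and z: "z \<ge> 0" "z' \<ge> 0" and l1: "\<bar>a \<bullet> a - 1\<bar> \<le> \<eta>" and E: "norm E \<le> \<eta>"
    define p l u V e where "p = v \<bullet> a" and "l = a \<bullet> a" and "u = multiplier K \<kappa> N p" and "V = v \<bullet> v" and "e = N\<^sup>2 + V"
    define m where "m = sqrt e"
    define \<theta> where "\<theta> = a \<bullet> (T *v a) + N * (l - 1) + p * (1 - l) + a \<bullet> (E *v v)"
    have V: "V \<ge> 0" "V = (norm v)\<^sup>2" by (auto simp: V_def power2_norm_eq_inner)
    have m: "m \<ge> 0" "m\<^sup>2 = N\<^sup>2 + V" using V by (auto simp: m_def e_def)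
    have l: "\<bar>l - 1\<bar> \<le> \<eta>" "l = (norm a)\<^sup>2" using l1 by (auto simp: l_def power2_norm_eq_inner)
    have l2: "l \<le> 2" "l \<ge> 0" using l \<eta> by auto
    have "(norm a)\<^sup>2 \<le> 2\<^sup>2" using l2 l(2) by simp
    then have na: "norm a \<le> 2" by (rule power2_le_imp_le) simp
    have pV: "p\<^sup>2 \<le> l * V" unfolding p_def l_def V_def using Cauchy_Schwarz_ineq[of v a] by (simp add: mult.commute)
    have "N\<^sup>2 \<le> m\<^sup>2" "V \<le> m\<^sup>2" using m V by auto
    then have Nm: "\<bar>N\<bar> \<le> m" and vm: "norm v \<le> m"
      using m(1) V(2) abs_le_square_iff[of N m] by (auto simp: power2_le_iff_abs_le)
    have "p\<^sup>2 \<le> (2 * m)\<^sup>2"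
      using pV mult_right_mono[OF l2(1) V(1)] \<open>V \<le> m\<^sup>2\<close> V(1) by (simp add: power_mult_distrib)
    then have pm: "\<bar>p\<bar> \<le> 2 * m" using m(1) power2_le_iff_abs_le[of "2 * m" p] by simp
    have \<theta>: "\<bar>\<theta>\<bar> \<le> 2 * norm T + 5 * \<eta> * m"
    proof -
      have "\<bar>a \<bullet> (T *v a)\<bar> \<le> norm T * l" using inner_matrix_le[of a T a] l(2) by (simp add: power2_eq_square mult.assoc)
      also have "\<dots> \<le> norm T * 2" using l2 by (intro mult_left_mono) auto
      finally have 1: "\<bar>a \<bullet> (T *v a)\<bar> \<le> 2 * norm T" by simp
      have 2: "\<bar>N * (l - 1)\<bar> \<le> m * \<eta>" unfolding abs_mult using Nm l m by (intro mult_mono) auto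
      have 3: "\<bar>p * (1 - l)\<bar> \<le> 2 * m * \<eta>" unfolding abs_mult using pm l m by (intro mult_mono) auto
      have "\<bar>a \<bullet> (E *v v)\<bar> \<le> norm E * norm a * norm v" by (rule inner_matrix_le)
      also have "\<dots> \<le> \<eta> * 2 * m" using E na vm \<eta> by (intro mult_mono) auto
      finally show ?thesis unfolding \<theta>_def using 1 2 3 by (simp add: algebra_simps)
    qed
    have trE: "\<bar>trace E\<bar> \<le> n * \<eta>" using order.trans[OF trace_le mult_left_mono[OF E]] by (simp add: n_def)
    have trT: "\<bar>trace T\<bar> \<le> n * norm T" using trace_le[of T] by (simp add: n_def)
    define I where "I = 2 * K * (N + p) * (p + (N + \<theta>)) + 2 * \<kappa> * (N - p) * (p - (N + \<theta>))
     + (K * (N + p)\<^sup>2 + \<kappa> * (N - p)\<^sup>2) * (n - l + trace E - 2 * s * l) + V + N * (n * N + trace T) - 2 * s * N * p"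
    have I: "I \<ge> c / 2 * m\<^sup>2 - (12 * (K + \<kappa>) + n)\<^sup>2 / c * (norm T)\<^sup>2"
      unfolding I_def
      by (rule multiplier_perturbation[OF K(1) \<kappa> K(3,4) n2 main m V(1) pV l(1) \<eta>(2) _ _ \<theta> trE trT])
         (use \<eta> in \<open>auto simp: A_def\<close>)
    have I': "I \<ge> c / 2 * e - max C1 C2 * (norm T)\<^sup>2"
    proof -
      have "C1 * (norm T)\<^sup>2 \<le> max C1 C2 * (norm T)\<^sup>2" by (intro mult_right_mono) auto
      then show ?thesis using I m(2) by (simp add: C1_def e_def)
    qed
    have u0: "u \<ge> 0" unfolding u_def multiplier_def using K \<kappa> by simp
    \<comment> \<open>Nonnegativity of the flux rests on
      \<open>(N - p)\<^sup>2 / 4 + N * p = (N + p)\<^sup>2 / 4\<close>; the indefinite product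
      \<open>N * p\<close> needs exactly a quarter of the square.\<close>
    have bd: "u * l + N * p \<ge> 0"
    proof -
      have "l \<ge> 1 - \<eta>" using l by auto
      have "u * l \<ge> \<kappa> * (N - p)\<^sup>2 * (1 - \<eta>)"
        unfolding u_def multiplier_def using K \<kappa> \<open>l \<ge> 1 - \<eta>\<close> \<eta> l2 by (intro mult_mono) auto
      also have "\<kappa> * (N - p)\<^sup>2 * (1 - \<eta>) = \<kappa> * (1 - \<eta>) * (N - p)\<^sup>2" by simp
      finally have "u * l \<ge> \<kappa> * (1 - \<eta>) * (N - p)\<^sup>2" .
      moreover have "\<kappa> * (1 - \<eta>) * (N - p)\<^sup>2 \<ge> 1 / 4 * (N - p)\<^sup>2" using \<eta> by (intro mult_right_mono) auto
      moreover have "1 / 4 * (N - p)\<^sup>2 + N * p = 1 / 4 * (N + p)\<^sup>2" by (simp add: power2_eq_square field_simps)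
      moreover have "1 / 4 * (N + p)\<^sup>2 \<ge> 0" by simp
      ultimately show ?thesis by linarith
    qed
    have um: "u \<le> 9 * (K + \<kappa>) * e"
    proof -
      have "\<bar>N + p\<bar> \<le> 3 * m" "\<bar>N - p\<bar> \<le> 3 * m" using Nm pm by auto
      then have "(N + p)\<^sup>2 \<le> 9 * m\<^sup>2" "(N - p)\<^sup>2 \<le> 9 * m\<^sup>2"
        using power_mono[of "\<bar>N + p\<bar>" "3 * m" 2] power_mono[of "\<bar>N - p\<bar>" "3 * m" 2] by (auto simp: power_mult_distrib)
      then have "K * (N + p)\<^sup>2 + \<kappa> * (N - p)\<^sup>2 \<le> K * (9 * m\<^sup>2) + \<kappa> * (9 * m\<^sup>2)"
        using K \<kappa> by (intro add_mono mult_left_mono) auto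
      then show ?thesis by (simp add: u_def multiplier_def m e_def algebra_simps)
    qed
    have db: "\<bar>u * (d \<bullet> a) + N * (d \<bullet> v)\<bar> \<le> max C1 C2 * norm d * e"
    proof -
      have "\<bar>d \<bullet> a\<bar> \<le> norm d * norm a" by (rule Cauchy_Schwarz_ineq2)
      also have "\<dots> \<le> norm d * 2" using na by (intro mult_left_mono) auto
      finally have "u * \<bar>d \<bullet> a\<bar> \<le> (9 * (K + \<kappa>) * e) * (norm d * 2)"
        using u0 um by (intro mult_mono) auto
      then have 1: "\<bar>u * (d \<bullet> a)\<bar> \<le> 18 * (K + \<kappa>) * e * norm d" using u0 by (simp add: abs_mult algebra_simps)
      have "\<bar>d \<bullet> v\<bar> \<le> norm d * norm v" by (rule Cauchy_Schwarz_ineq2)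
      also have "\<dots> \<le> norm d * m" using vm by (intro mult_left_mono) auto
      finally have "\<bar>N\<bar> * \<bar>d \<bullet> v\<bar> \<le> m * (norm d * m)" using Nm m by (intro mult_mono) auto
      also have "m * (norm d * m) = m\<^sup>2 * norm d" by (simp add: power2_eq_square)
      finally have 2: "\<bar>N * (d \<bullet> v)\<bar> \<le> e * norm d" by (simp add: abs_mult e_def m)
      have "C2 * (norm d * e) \<le> max C1 C2 * (norm d * e)"
        using V by (intro mult_right_mono) (auto simp: e_def)
      then show ?thesis using 1 2 by (simp add: C2_def algebra_simps)
    qed
    have q: "a \<bullet> (T *v a) + N * l + p - l * p + a \<bullet> (E *v v) = N + \<theta>"
      by (simp add: \<theta>_def algebra_simps)
    have "b * (z' - 2 * s * z) * (u * l + N * p) + z * (u * (d \<bullet> a) + N * (d \<bullet> v))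
         + b * z * (2 * K * (N + p) * (p + (N + \<theta>)) + 2 * \<kappa> * (N - p) * (p - (N + \<theta>))
            + u * (n - l + trace E) + V + N * (n * N + trace T))
        = b * z' * (u * l + N * p) + z * (u * (d \<bullet> a) + N * (d \<bullet> v)) + z * (b * I)"
      by (simp add: I_def u_def multiplier_def algebra_simps)
    also have "\<dots> \<ge> 0 + z * (- (max C1 C2 * norm d * e)) + z * (b * (c / 2 * e - max C1 C2 * (norm T)\<^sup>2))"
      using b z bd db I' by (intro add_mono mult_left_mono mult_nonneg_nonneg) auto
    finally show "z * (b * (c / 2 * (N\<^sup>2 + v \<bullet> v) - max C1 C2 * (norm T)\<^sup>2) - max C1 C2 * norm d * (N\<^sup>2 + v \<bullet> v))
       \<le> mult_flux s K \<kappa> a v d T E N b z z'"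
      unfolding mult_flux_def p_def[symmetric] l_def[symmetric] V_def[symmetric] u_def[symmetric] n_def[symmetric] e_def[symmetric] q
      by (simp add: algebra_simps)
  qed (use K \<kappa> C1 \<eta> in auto)
qed

section \<open>The integrated inequality in a chart\<close>

lemma matrix_mult_add_left:
  fixes A B :: "real^'n::finite^'m" and C :: "real^'k^'n"
  shows "(A + B) ** C = A ** C + B ** C"
  by (simp add: matrix_matrix_mult_def vec_eq_iff sum.distrib distrib_right)

lemma matrix_mult_diff_right:
  fixes A B :: "real^'k^'n::finite" and C :: "real^'n^'m"
  shows "C ** (A - B) = C ** A - C ** B"
  by (simp add: matrix_matrix_mult_def vec_eq_iff sum_subtractf right_diff_distrib)

lemma continuous_on_hess_entries:
  fixes g :: "real^'n::finite \<Rightarrow> real^'n^'n"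
  assumes "\<And>i j. C1_on U (\<lambda>x. g x $ i $ j)" "\<And>x. x \<in> U \<Longrightarrow> det (g x) \<noteq> 0" "C2_on U N"
  shows "continuous_on U (\<lambda>x. hess g N x $ i $ j)"
proof -
  have "continuous_on U (\<lambda>x. rgrad g N x $ m)" for m
    unfolding rgrad_def matrix_vector_mult_def
    using continuous_on_matrix_inv[OF C1_on_continuous[OF assms(1)] assms(2)] C1_on_continuous_pd[OF C2_on_C1[OF assms(3)]]
    by (auto intro!: continuous_on_sum continuous_on_mult)
  then show ?thesis
    unfolding hess_def chr_low_def
    using C1_on_continuous_pd[OF C2_on_pd[OF assms(3)]] C1_on_continuous_pd[OF assms(1)]
    by (auto intro!: continuous_on_diff continuous_on_sum continuous_on_mult continuous_on_divide continuous_on_add)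
qed

lemma continuous_on_hess:
  assumes "C1_metric U g" "C2_on U N" shows "continuous_on U (\<lambda>x. hess g N x $ i $ j)"
  using C1_metric_det[OF assms(1)] by (intro continuous_on_hess_entries C1_on_metric[OF assms(1)] assms(2)) force

lemma continuous_on_norm2_mat:
  fixes M :: "'x::topological_space \<Rightarrow> real^'n::finite^'n"
  assumes "\<And>i j. continuous_on S (\<lambda>y. M y $ i $ j)" "\<And>y. y \<in> S \<Longrightarrow> det (M y) \<noteq> 0"
    "\<And>i j. continuous_on S (\<lambda>y. T y $ i $ j)"
  shows "continuous_on S (\<lambda>y. norm2_mat (M y) (T y))"
  unfolding norm2_mat_def trace_def matrix_matrix_mult_def transpose_def
  using continuous_on_matrix_inv[OF assms(1,2)] assms(3)
  by (auto intro!: continuous_on_sum continuous_on_mult)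

lemma continuous_on_norm2_vec:
  fixes M :: "'x::topological_space \<Rightarrow> real^'n::finite^'n"
  assumes "\<And>i j. continuous_on S (\<lambda>y. M y $ i $ j)" "\<And>y. y \<in> S \<Longrightarrow> det (M y) \<noteq> 0"
    "\<And>i. continuous_on S (\<lambda>y. v y $ i)"
  shows "continuous_on S (\<lambda>y. norm2_vec (M y) (v y))"
  unfolding norm2_vec_def inner_vec_def matrix_vector_mult_def
  using continuous_on_matrix_inv[OF assms(1,2)] assms(3)
  by (auto intro!: continuous_on_sum continuous_on_mult)

section \<open>The divergence identity and its integral in a conformal chart\<close>

context conformal_chart
begin

definition energy :: "(real^'n \<Rightarrow> real) \<Rightarrow> real^'n \<Rightarrow> real" where
  "energy N x = (N x)\<^sup>2 + norm2_vec (G x) (grad N x)"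

definition Tmat :: "(real^'n \<Rightarrow> real) \<Rightarrow> real^'n \<Rightarrow> real^'n^'n" where
  "Tmat N x = hess G N x - N x *\<^sub>R G x"

definition Emat :: "real^'n \<Rightarrow> real^'n^'n" where
  "Emat x = hess G t x - G x + (\<chi> i j. pd i t x * pd j t x)"

lemma grad_multiplier:
  fixes N :: "real^'n \<Rightarrow> real"
  assumes x: "x \<in> U" and N: "C2_on U N"
  defines "p \<equiv> \<lambda>y. grad N y \<bullet> rgrad G t y"
  shows "grad (\<lambda>y. multiplier K \<kappa> (N y) (p y)) x =
    (2 * K * (N x + p x)) *\<^sub>R (grad N x + (hess G N x *v rgrad G t x + hess G t x *v rgrad G N x))
    + (2 * \<kappa> * (N x - p x)) *\<^sub>R (grad N x - (hess G N x *v rgrad G t x + hess G t x *v rgrad G N x))"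
proof -
  have gN: "GDERIV N x :> grad N x" by (rule C1_on_GDERIV[OF C2_on_C1[OF N] x])
  have "grad p x = hess G N x *v rgrad G t x + hess G t x *v rgrad G N x"
    unfolding p_def by (simp add: vec_eq_iff pd_inner_rgrad[OF metric_G x N C2_t])
  moreover have "GDERIV p x :> grad p x"
    unfolding p_def by (rule C1_on_GDERIV[OF C1_on_inner_rgrad[OF metric_G N C2_t] x])
  ultimately have gp: "GDERIV p x :> hess G N x *v rgrad G t x + hess G t x *v rgrad G N x" by simp
  define D where "D = hess G N x *v rgrad G t x + hess G t x *v rgrad G N x"
  have gp: "GDERIV p x :> D" using gp by (simp only: D_def)
  have "grad (\<lambda>y. multiplier K \<kappa> (N y) (p y)) x
      = (K *\<^sub>R ((N x + p x) *\<^sub>R (grad N x + D) + (N x + p x) *\<^sub>R (grad N x + D)) + ((N x + p x) * (N x + p x)) *\<^sub>R 0)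
       + (\<kappa> *\<^sub>R ((N x - p x) *\<^sub>R (grad N x - D) + (N x - p x) *\<^sub>R (grad N x - D)) + ((N x - p x) * (N x - p x)) *\<^sub>R 0)"
    unfolding multiplier_def power2_eq_square
    by (rule grad_unique, intro GDERIV_add GDERIV_mult GDERIV_const GDERIV_diff gN gp)
  also have "\<dots> = (2 * K * (N x + p x)) *\<^sub>R (grad N x + D) + (2 * \<kappa> * (N x - p x)) *\<^sub>R (grad N x - D)"
    by (simp add: vec_eq_iff) (simp add: algebra_simps)
  finally show ?thesis by (simp only: D_def)
qed

lemma grad_cutoff:
  assumes x: "x \<in> U" and b: "C1_on U b" and z: "\<And>r. DERIV z r :> z' r"
  shows "grad (\<lambda>y. b y * (z (t y) * exp (- 2 * s * t y))) x =
    (b x * exp (- 2 * s * t x) * (z' (t x) - 2 * s * z (t x))) *\<^sub>R grad t x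
    + (exp (- 2 * s * t x) * z (t x)) *\<^sub>R grad b x"
proof -
  have d: "DERIV (\<lambda>r. z r * exp (- 2 * s * r)) (t x) :> exp (- 2 * s * t x) * (z' (t x) - 2 * s * z (t x))"
    by (auto intro!: derivative_eq_intros z simp: algebra_simps)
  have "GDERIV (\<lambda>y. z (t y) * exp (- 2 * s * t y)) x :>
      (exp (- 2 * s * t x) * (z' (t x) - 2 * s * z (t x))) *\<^sub>R grad t x"
    by (rule GDERIV_DERIV_compose[OF C1_on_GDERIV[OF C2_on_C1[OF C2_t] x] d])
  from grad_unique[OF GDERIV_mult[OF C1_on_GDERIV[OF b x] this]]
  show ?thesis by (simp add: mult.assoc mult.commute[of _ "z _"])
qed

lemma frame_form:
  fixes B H :: "real^'n^'n"
  shows "(B *v a) \<bullet> (H *v (B *v c)) = a \<bullet> ((transpose B ** H ** B) *v c)"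
proof -
  have "a \<bullet> ((transpose B ** H ** B) *v c) = a \<bullet> (transpose B *v (H *v (B *v c)))"
    by (simp only: matrix_vector_mul_assoc matrix_mul_assoc)
  also have "\<dots> = (B *v a) \<bullet> (H *v (B *v c))"
    by (metis dot_lmul_matrix inner_commute transpose_matrix_vector)
  finally show ?thesis by simp
qed

text \<open>Both Hessians are split into their model value and a remainder, \<open>N g + T\<close>
  for \<open>N\<close> and \<open>g - dt dt + E\<close> for \<open>t\<close>, and all contractions
  needed for the divergence are read in the frame.\<close>

lemma frame_expansion:
  fixes B :: "real^'n^'n" and N :: "real^'n \<Rightarrow> real"
  assumes x: "x \<in> U" and B: "transpose B ** G x ** B = mat 1"
  defines "a \<equiv> transpose B *v grad t x" and "v \<equiv> transpose B *v grad N x"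
  shows "w \<bullet> rgrad G t x = (transpose B *v w) \<bullet> a" "w \<bullet> rgrad G N x = (transpose B *v w) \<bullet> v"
    and "rgrad G t x \<bullet> (hess G N x *v rgrad G t x)
        = a \<bullet> ((transpose B ** Tmat N x ** B) *v a) + N x * (a \<bullet> a)"
    and "rgrad G t x \<bullet> (hess G t x *v rgrad G N x)
        = a \<bullet> ((transpose B ** Emat x ** B) *v v) + v \<bullet> a - (a \<bullet> a) * (v \<bullet> a)"
    and "trace (matrix_inv (G x) ** hess G t x) = real CARD('n) - a \<bullet> a + trace (transpose B ** Emat x ** B)"
    and "trace (matrix_inv (G x) ** hess G N x) = real CARD('n) * N x + trace (transpose B ** Tmat N x ** B)"
proof -
  let ?O = "\<chi> i j. pd i t x * pd j t x"
  have \<nu>: "rgrad G t x = B *v a" and V: "rgrad G N x = B *v v"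
    by (simp_all only: rgrad_def frame_matrix_inv[OF B] a_def v_def matrix_vector_mul_assoc)
  have Ba: "w \<bullet> (B *v c) = (transpose B *v w) \<bullet> c" for w c :: "real^'n"
    by (metis dot_lmul_matrix transpose_matrix_vector)
  show "w \<bullet> rgrad G t x = (transpose B *v w) \<bullet> a" "w \<bullet> rgrad G N x = (transpose B *v w) \<bullet> v"
    by (simp_all only: \<nu> V Ba)
  have HN: "hess G N x = Tmat N x + N x *\<^sub>R G x" by (simp add: Tmat_def)
  have Ht: "hess G t x = Emat x + G x - ?O" by (simp add: Emat_def)
  have O: "?O *v w = (grad t x \<bullet> w) *\<^sub>R grad t x" for w
    by (simp add: vec_eq_iff matrix_vector_mult_def inner_vec_def sum_distrib_left ac_simps)
  have G1: "(B *v c) \<bullet> (G x *v (B *v d)) = c \<bullet> d" for c d by (simp add: frame_form B)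
  show "rgrad G t x \<bullet> (hess G N x *v rgrad G t x)
        = a \<bullet> ((transpose B ** Tmat N x ** B) *v a) + N x * (a \<bullet> a)"
    unfolding \<nu> HN matrix_vector_mult_add_rdistrib scaleR_matrix_vector_assoc[symmetric]
      inner_add_right inner_scaleR_right G1 by (simp only: frame_form)
  have "(B *v a) \<bullet> (?O *v (B *v v)) = (a \<bullet> v) * (a \<bullet> a)"
    unfolding O inner_scaleR_right inner_commute[of "B *v a"] Ba a_def[symmetric] by simp
  then show "rgrad G t x \<bullet> (hess G t x *v rgrad G N x)
        = a \<bullet> ((transpose B ** Emat x ** B) *v v) + v \<bullet> a - (a \<bullet> a) * (v \<bullet> a)"
    unfolding \<nu> V Ht matrix_vector_mult_add_rdistrib matrix_vector_mult_diff_rdistrib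
      inner_add_right inner_diff_right G1 by (simp add: frame_form inner_commute)
  have "det (G x) \<noteq> 0" using C1_metric_det[OF metric_G x] by simp
  then have trG: "trace (matrix_inv (G x) ** G x) = real CARD('n)"
    by (simp add: matrix_inv_mult trace_def mat_def)
  have "trace (matrix_inv (G x) ** ?O) = grad t x \<bullet> (matrix_inv (G x) *v grad t x)"
    by (simp add: trace_def matrix_matrix_mult_def inner_vec_def matrix_vector_mult_def sum_distrib_left ac_simps)
  also have "\<dots> = a \<bullet> a" by (simp add: frame_inner[OF B] a_def)
  finally have trO: "trace (matrix_inv (G x) ** ?O) = a \<bullet> a" .
  show "trace (matrix_inv (G x) ** hess G t x) = real CARD('n) - a \<bullet> a + trace (transpose B ** Emat x ** B)"
    unfolding Ht by (simp add: matrix_add_ldistrib matrix_mult_diff_right trace_add trace_sub trG trO frame_trace[OF B, of "Emat x"])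
  show "trace (matrix_inv (G x) ** hess G N x) = real CARD('n) * N x + trace (transpose B ** Tmat N x ** B)"
    unfolding HN using trG
    by (simp add: matrix_add_ldistrib trace_add matrix_mult_scaleR_right frame_trace[OF B, of "Tmat N x"])
       (simp add: trace_def sum_distrib_left[symmetric])
qed

text \<open>Connects geometry with the scalar inequality: after \<open>grad_multiplier\<close> and
  \<open>grad_cutoff\<close> the divergence involves the two Hessians only in the contractions of
  \<open>frame_expansion\<close>, and these form \<open>mult_flux\<close>.\<close>

lemma multiplier_divergence:
  fixes B :: "real^'n^'n" and N b :: "real^'n \<Rightarrow> real" and z z' :: "real \<Rightarrow> real" and s K \<kappa> :: real
  assumes x: "x \<in> U" and N: "C2_on U N" and b: "C1_on U b"
    and z: "\<And>r. DERIV z r :> z' r" "continuous_on UNIV z'"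
    and B: "transpose B ** G x ** B = mat 1"
  defines "a \<equiv> transpose B *v grad t x" and "v \<equiv> transpose B *v grad N x"
    and "d \<equiv> transpose B *v grad b x" and "T \<equiv> transpose B ** Tmat N x ** B"
    and "E \<equiv> transpose B ** Emat x ** B"
  defines "\<Phi> \<equiv> \<lambda>y. b y * (z (t y) * exp (- 2 * s * t y))"
    and "u \<equiv> \<lambda>y. multiplier K \<kappa> (N y) (grad N y \<bullet> rgrad G t y)"
  shows "(\<Sum>i\<in>UNIV. pd i (\<lambda>y. sqrt (det (G y)) * (\<Phi> y * u y * rgrad G t y $ i)
        + sqrt (det (G y)) * (\<Phi> y * N y * rgrad G N y $ i)) x)
    = sqrt (det (G x)) * (exp (- 2 * s * t x) * (
         mult_flux s K \<kappa> a v d T E (N x) (b x) (z (t x)) (z' (t x))))"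
    and "C1_on U (\<lambda>y. sqrt (det (G y)) * (\<Phi> y * u y * rgrad G t y $ i)
        + sqrt (det (G y)) * (\<Phi> y * N y * rgrad G N y $ i))"
proof -
  have C1z: "C1_on U (\<lambda>y. z (t y))"
    by (rule C1_on_compose[where f = t and g = z and g' = z'])
       (use C2_on_C1[OF C2_t] z continuous_on_subset in blast)+
  have C1e: "C1_on U (\<lambda>y. exp (- 2 * s * t y))"
    by (rule C1_on_compose[where f = t and g = "\<lambda>r. exp (- 2 * s * r)" and g' = "\<lambda>r. - 2 * s * exp (- 2 * s * r)"])
       (auto intro!: C2_on_C1[OF C2_t] derivative_eq_intros continuous_intros)
  have C1\<Phi>: "C1_on U \<Phi>" unfolding \<Phi>_def by (intro C1_on_mult b C1z C1e)
  have C1u: "C1_on U u" unfolding u_def multiplier_def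
    by (intro C1_on_add C1_on_diff C1_on_mult C1_on_power C1_on_const C2_on_C1[OF N] C1_on_inner_rgrad[OF metric_G N C2_t])
  have C1N: "C1_on U N" by (rule C2_on_C1[OF N])
  have c1: "C1_on U (\<lambda>y. \<Phi> y * u y)" "C1_on U (\<lambda>y. \<Phi> y * N y)" by (intro C1_on_mult C1\<Phi> C1u C1N)+
  have cc: "C1_on U (\<lambda>y. sqrt (det (G y)) * (\<Phi> y * u y * rgrad G t y $ i))"
     "C1_on U (\<lambda>y. sqrt (det (G y)) * (\<Phi> y * N y * rgrad G N y $ i))" for i
    by (intro C1_on_mult C1_on_sqrt_det[OF metric_G] c1 C1_on_rgrad[OF metric_G] C2_t N C1\<Phi> C1u C1N)+
  then show "C1_on U (\<lambda>y. sqrt (det (G y)) * (\<Phi> y * u y * rgrad G t y $ i)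
        + sqrt (det (G y)) * (\<Phi> y * N y * rgrad G N y $ i))" by (intro C1_on_add)
  note fe = frame_expansion(1)[OF x B, folded a_def] frame_expansion(2)[OF x B, where N = N, folded v_def]
    frame_expansion(3,4)[OF x B, where N = N, folded a_def v_def T_def E_def]
    frame_expansion(5)[OF x B, folded a_def E_def] frame_expansion(6)[OF x B, where N = N, folded T_def]
  have p: "grad N x \<bullet> rgrad G t x = v \<bullet> a" using fe(1)[of "grad N x"] by (simp add: v_def)
  have g1: "grad (\<lambda>y. \<Phi> y * u y) x = \<Phi> x *\<^sub>R grad u x + u x *\<^sub>R grad \<Phi> x"
    by (rule grad_unique[OF GDERIV_mult]) (auto intro: C1_on_GDERIV[OF _ x] C1\<Phi> C1u)
  have g2: "grad (\<lambda>y. \<Phi> y * N y) x = \<Phi> x *\<^sub>R grad N x + N x *\<^sub>R grad \<Phi> x"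
    by (rule grad_unique[OF GDERIV_mult]) (auto intro: C1_on_GDERIV[OF _ x] C1\<Phi> C1N)
  define \<omega> where "\<omega> = exp (- 2 * s * t x)"
  define q where "q = a \<bullet> (T *v a) + N x * (a \<bullet> a) + v \<bullet> a - (a \<bullet> a) * (v \<bullet> a) + a \<bullet> (E *v v)"
  define dp where "dp = hess G N x *v rgrad G t x + hess G t x *v rgrad G N x"
  have dpq: "dp \<bullet> rgrad G t x = q"
    unfolding dp_def q_def inner_commute[of _ "rgrad G t x"] inner_add_right fe(3,4) by simp
  have gu: "grad u x = (2 * K * (N x + v \<bullet> a)) *\<^sub>R (grad N x + dp) + (2 * \<kappa> * (N x - v \<bullet> a)) *\<^sub>R (grad N x - dp)"
    unfolding u_def using grad_multiplier[OF x N] by (simp add: p dp_def)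
  have g\<Phi>: "grad \<Phi> x = (b x * \<omega> * (z' (t x) - 2 * s * z (t x))) *\<^sub>R grad t x + (\<omega> * z (t x)) *\<^sub>R grad b x"
    unfolding \<Phi>_def \<omega>_def by (rule grad_cutoff[OF x b z(1)])
  have ux: "u x = multiplier K \<kappa> (N x) (v \<bullet> a)" by (simp add: u_def p)
  have \<Phi>x: "\<Phi> x = \<omega> * (b x * z (t x))" by (simp add: \<Phi>_def \<omega>_def)
  have "(\<Sum>i\<in>UNIV. pd i (\<lambda>y. sqrt (det (G y)) * (\<Phi> y * u y * rgrad G t y $ i)
        + sqrt (det (G y)) * (\<Phi> y * N y * rgrad G N y $ i)) x)
     = (\<Sum>i\<in>UNIV. pd i (\<lambda>y. sqrt (det (G y)) * (\<Phi> y * u y * rgrad G t y $ i)) x)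
     + (\<Sum>i\<in>UNIV. pd i (\<lambda>y. sqrt (det (G y)) * (\<Phi> y * N y * rgrad G N y $ i)) x)"
    by (simp add: pd_add[OF C1_on_differentiable[OF cc(1) x] C1_on_differentiable[OF cc(2) x]] sum.distrib)
  also have "\<dots> = sqrt (det (G x)) * (
      (grad (\<lambda>y. \<Phi> y * u y) x \<bullet> rgrad G t x + \<Phi> x * u x * (real CARD('n) - a \<bullet> a + trace E))
      + (grad (\<lambda>y. \<Phi> y * N y) x \<bullet> rgrad G N x + \<Phi> x * N x * (real CARD('n) * N x + trace T)))"
    by (simp only: divergence_rgrad[OF metric_G x C2_t c1(1)] divergence_rgrad[OF metric_G x N c1(2)] fe(5,6)
        distrib_left)
  also have "grad (\<lambda>y. \<Phi> y * u y) x \<bullet> rgrad G t x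
      = \<Phi> x * (2 * K * (N x + v \<bullet> a) * (v \<bullet> a + q) + 2 * \<kappa> * (N x - v \<bullet> a) * (v \<bullet> a - q))
        + u x * (b x * \<omega> * (z' (t x) - 2 * s * z (t x)) * (a \<bullet> a) + \<omega> * z (t x) * (d \<bullet> a))"
    unfolding g1 gu g\<Phi> inner_add_left inner_scaleR_left inner_diff_left p dpq
    unfolding fe(1) a_def[symmetric] d_def[symmetric] by (rule refl)
  also have "grad (\<lambda>y. \<Phi> y * N y) x \<bullet> rgrad G N x
      = \<Phi> x * (v \<bullet> v) + N x * (b x * \<omega> * (z' (t x) - 2 * s * z (t x)) * (v \<bullet> a) + \<omega> * z (t x) * (d \<bullet> v))"
    unfolding g2 g\<Phi> inner_add_left inner_scaleR_left
    unfolding fe(2) v_def[symmetric] a_def[symmetric] d_def[symmetric] by (simp only: inner_commute[of a v])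
  finally show "(\<Sum>i\<in>UNIV. pd i (\<lambda>y. sqrt (det (G y)) * (\<Phi> y * u y * rgrad G t y $ i)
        + sqrt (det (G y)) * (\<Phi> y * N y * rgrad G N y $ i)) x)
    = sqrt (det (G x)) * (exp (- 2 * s * t x) * (
         mult_flux s K \<kappa> a v d T E (N x) (b x) (z (t x)) (z' (t x))))"
    unfolding mult_flux_def q_def[symmetric] \<omega>_def[symmetric] ux \<Phi>x by (simp add: algebra_simps)
qed

text \<open>By \<open>hess_t\<close> the tensor \<open>E\<close> is
  \<open>- \<rho>\<^sup>-\<^sup>1\<close> times the Hessian of \<rho> plus a multiple of the metric.
  Rescaling the norm turns the first factor into \<rho>, and the norm of the identity matrix is at
  most \<open>CARD('n)\<close>.\<close>

lemma norm_Emat: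
  fixes B :: "real^'n^'n"
  assumes x: "x \<in> U" and B: "transpose B ** G x ** B = mat 1"
  shows "norm (transpose B ** Emat x ** B) \<le> \<rho> x * sqrt (norm2_mat (h x) (hess h \<rho> x))
      + real CARD('n) * \<bar>norm2_vec (h x) (grad \<rho> x) - 1\<bar>"
proof -
  define l where "l = norm2_vec (h x) (grad \<rho> x)"
  have E: "Emat x = (- (1 / \<rho> x)) *\<^sub>R hess h \<rho> x + (l - 1) *\<^sub>R G x"
    by (simp add: vec_eq_iff Emat_def hess_t[OF x] l_def algebra_simps)
  have r: "\<rho> x > 0" by (rule \<rho>_pos[OF x])
  have "transpose B ** Emat x ** B
      = (- (1 / \<rho> x)) *\<^sub>R (transpose B ** hess h \<rho> x ** B) + (l - 1) *\<^sub>R mat 1"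
    unfolding E matrix_add_ldistrib matrix_mult_add_left
    by (simp only: matrix_mult_scaleR_right matrix_mult_scaleR_left B)
  then have "norm (transpose B ** Emat x ** B)
      \<le> norm ((- (1 / \<rho> x)) *\<^sub>R (transpose B ** hess h \<rho> x ** B)) + norm ((l - 1) *\<^sub>R (mat 1 :: real^'n^'n))"
    by (metis norm_triangle_ineq)
  also have "norm ((- (1 / \<rho> x)) *\<^sub>R (transpose B ** hess h \<rho> x ** B)) = \<rho> x * sqrt (norm2_mat (h x) (hess h \<rho> x))"
  proof -
    have "(norm (transpose B ** hess h \<rho> x ** B))\<^sup>2 = ((\<rho> x)\<^sup>2)\<^sup>2 * norm2_mat (h x) (hess h \<rho> x)"
      using frame_norm2_mat[OF B, of "hess h \<rho> x"] norm2_mat_G[OF x, of "hess h \<rho> x"] by simp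
    then have "norm (transpose B ** hess h \<rho> x ** B) = (\<rho> x)\<^sup>2 * sqrt (norm2_mat (h x) (hess h \<rho> x))"
      by (metis abs_of_nonneg norm_ge_zero real_sqrt_abs real_sqrt_mult zero_le_power2)
    then show ?thesis using r by (simp add: power2_eq_square)
  qed
  also have "norm ((l - 1) *\<^sub>R (mat 1 :: real^'n^'n)) \<le> real CARD('n) * \<bar>l - 1\<bar>"
  proof -
    have "(norm (mat 1 :: real^'n^'n))\<^sup>2 = real CARD('n)"
      using trace_mult_transpose[of "mat 1 :: real^'n^'n"] by (simp add: transpose_mat trace_I)
    also have "\<dots> \<le> (real CARD('n))\<^sup>2" by (simp add: power2_eq_square Suc_leI)
    finally have "norm (mat 1 :: real^'n^'n) \<le> real CARD('n)" by (rule power2_le_imp_le) simp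
    then show ?thesis by (simp add: mult.commute[of "\<bar>l - 1\<bar>"] mult_right_mono)
  qed
  finally show ?thesis by (simp add: l_def)
qed

lemma norm2_vec_grad_t: "x \<in> U \<Longrightarrow> norm2_vec (G x) (grad t x) = norm2_vec (h x) (grad \<rho> x)"
  using \<rho>_pos[of x] unfolding norm2_vec_G grad_t
  by (simp add: norm2_vec_def matrix_vector_mult_scaleR linear_neg[OF matrix_vector_mul_linear] power2_eq_square)

lemma continuous_on_energy:
  assumes "C2_on U N" shows "continuous_on U (energy N)"
proof -
  have "C1_on U (\<lambda>x. (N x)\<^sup>2 + grad N x \<bullet> rgrad G N x)"
    by (intro C1_on_add C1_on_power C2_on_C1[OF assms] C1_on_inner_rgrad[OF metric_G] assms)
  then show ?thesis by (auto dest!: C1_on_continuous simp: energy_def[abs_def] norm2_vec_def rgrad_def)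
qed

lemma continuous_on_Tmat:
  assumes "C2_on U N" shows "continuous_on U (\<lambda>x. norm2_mat (G x) (Tmat N x))"
proof (rule continuous_on_norm2_mat)
  show c: "continuous_on U (\<lambda>x. G x $ i $ j)" for i j by (rule C1_on_continuous[OF C1_on_metric[OF metric_G]])
  show "det (G x) \<noteq> 0" if "x \<in> U" for x using C1_metric_det[OF metric_G that] by simp
  show "continuous_on U (\<lambda>x. Tmat N x $ i $ j)" for i j
    unfolding Tmat_def using continuous_on_hess[OF metric_G assms, of i j] c C1_on_continuous[OF C2_on_C1[OF assms]]
    by (auto intro!: continuous_on_diff continuous_on_mult)
qed

text \<open>The field \<open>F\<close> has compact support, so its divergence integrates to zero,
  while \<open>f\<close> with the volume density lies below that divergence. Compactness has three
  sources, listed in \<open>supp\<close>: the bump function in the lateral directions, the cutoff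
  towards the inner boundary, and the support of \<open>N\<close> towards infinity.\<close>

lemma chart_inequality:
  fixes N b :: "real^'n \<Rightarrow> real" and z z' :: "real \<Rightarrow> real" and s K \<kappa> c C \<eta> :: real
  assumes N: "C2_on U N" and b: "C1_on U b" "\<And>x. x \<in> U \<Longrightarrow> b x \<ge> 0"
    and z: "\<And>r. DERIV z r :> z' r" "continuous_on UNIV z'" "\<And>r. z r \<ge> 0" "\<And>r. z' r \<ge> 0"
    and flux: "\<And>(a::real^'n) v d T E N b z z'. \<lbrakk>b \<ge> 0; z \<ge> 0; z' \<ge> 0; \<bar>a \<bullet> a - 1\<bar> \<le> \<eta>; norm E \<le> \<eta>\<rbrakk> \<Longrightarrow>
       z * (b * (c * (N\<^sup>2 + v \<bullet> v) - C * (norm T)\<^sup>2) - C * norm d * (N\<^sup>2 + v \<bullet> v))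
       \<le> mult_flux s K \<kappa> a v d T E N b z z'"
    and near: "\<And>x. x \<in> U \<Longrightarrow> \<bar>norm2_vec (h x) (grad \<rho> x) - 1\<bar> \<le> \<eta>"
      "\<And>x. x \<in> U \<Longrightarrow> \<rho> x * sqrt (norm2_mat (h x) (hess h \<rho> x))
         + real CARD('n) * \<bar>norm2_vec (h x) (grad \<rho> x) - 1\<bar> \<le> \<eta>"
    and Cs: "compact Cs" "Cs \<subseteq> U"
    and supp: "\<And>x. x \<in> U - Cs \<Longrightarrow> (b x = 0 \<and> grad b x = 0) \<or> z (t x) = 0
         \<or> (N x = 0 \<and> grad N x = 0 \<and> Tmat N x = 0)"
  defines "f \<equiv> \<lambda>x. exp (- 2 * s * t x) * (z (t x) * (b x * (c * energy N x - C * norm2_mat (G x) (Tmat N x))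
            - C * (\<rho> x * sqrt (norm2_vec (h x) (grad b x))) * energy N x))"
  shows "integrable lborel (\<lambda>x. indicator U x * (sqrt (det (G x)) * f x))"
    and "(\<integral>x. indicator U x * (sqrt (det (G x)) * f x) \<partial>lborel) \<le> 0"
    and "continuous_on U f"
proof -
  define \<Phi> where "\<Phi> = (\<lambda>y. b y * (z (t y) * exp (- 2 * s * t y)))"
  define u where "u = (\<lambda>y. multiplier K \<kappa> (N y) (grad N y \<bullet> rgrad G t y))"
  define F where "F i y = sqrt (det (G y)) * (\<Phi> y * u y * rgrad G t y $ i)
        + sqrt (det (G y)) * (\<Phi> y * N y * rgrad G N y $ i)" for i y
  have frame: "\<exists>B::real^'n^'n. transpose B ** G x ** B = mat 1" if "x \<in> U" for x
    using posdef_frame[of "G x"] metric_G that by (metis C1_metric_def)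
  have C1F: "C1_on U (F i)" for i
  \<comment> \<open>The regularity statement of \<open>multiplier_divergence\<close> is made at a
    point with a frame, so some point is needed to invoke it.\<close>
  proof (cases "U = {}")
    case True then show ?thesis by (simp add: C1_on_def)
  next
    case False
    then obtain x where x: "x \<in> U" by blast
    then obtain B :: "real^'n^'n" where B: "transpose B ** G x ** B = mat 1" using frame by blast
    show ?thesis unfolding F_def \<Phi>_def u_def
      by (rule multiplier_divergence(2)[OF x N b(1) z(1,2) B])
  qed
  have F0: "F i x = 0" if "x \<in> U - Cs" for i x
    using supp[OF that] by (auto simp: F_def \<Phi>_def u_def multiplier_def)
  have fF: "sqrt (det (G x)) * f x \<le> (\<Sum>i\<in>UNIV. pd i (F i) x)" if x: "x \<in> U" for x
  proof -
    obtain B :: "real^'n^'n" where B: "transpose B ** G x ** B = mat 1" using frame x by blast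
    define a v d where "a = transpose B *v grad t x" and "v = transpose B *v grad N x" and "d = transpose B *v grad b x"
    define T E where "T = transpose B ** Tmat N x ** B" and "E = transpose B ** Emat x ** B"
    have e: "(\<Sum>i\<in>UNIV. pd i (F i) x) = sqrt (det (G x)) * (exp (- 2 * s * t x) *
        mult_flux s K \<kappa> a v d T E (N x) (b x) (z (t x)) (z' (t x)))"
      using multiplier_divergence(1)[OF x N b(1) z(1,2) B, of s K \<kappa>]
      by (simp only: F_def[abs_def] \<Phi>_def u_def a_def v_def d_def T_def E_def)
    have l: "a \<bullet> a = norm2_vec (h x) (grad \<rho> x)"
      using norm2_vec_grad_t[OF x] by (simp only: a_def frame_inner[OF B, symmetric] norm2_vec_def)
    have v: "v \<bullet> v = norm2_vec (G x) (grad N x)"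
      unfolding v_def frame_inner[OF B, symmetric] norm2_vec_def ..
    have "norm2_vec (G x) (grad b x) = (norm d)\<^sup>2" unfolding d_def by (rule frame_norm2_vec[OF B])
    then have "(norm d)\<^sup>2 = (\<rho> x)\<^sup>2 * norm2_vec (h x) (grad b x)" using norm2_vec_G[OF x] by simp
    then have d: "norm d = \<rho> x * sqrt (norm2_vec (h x) (grad b x))"
      using \<rho>_pos[OF x] by (metis abs_of_nonneg less_imp_le norm_ge_zero real_sqrt_abs real_sqrt_mult)
    have T: "norm2_mat (G x) (Tmat N x) = (norm T)\<^sup>2" unfolding T_def by (rule frame_norm2_mat[OF B])
    have E: "norm E \<le> \<eta>" using norm_Emat[OF x B] near(2)[OF x] by (simp add: E_def)
    have "f x = exp (- 2 * s * t x) * (z (t x) * (b x * (c * ((N x)\<^sup>2 + v \<bullet> v) - C * (norm T)\<^sup>2)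
         - C * norm d * ((N x)\<^sup>2 + v \<bullet> v)))"
      by (simp add: f_def energy_def v T d)
    also have "\<dots> \<le> exp (- 2 * s * t x) * mult_flux s K \<kappa> a v d T E (N x) (b x) (z (t x)) (z' (t x))"
      by (intro mult_left_mono flux b(2) x z near(1) E) (auto simp: l near(1)[OF x])
    finally show ?thesis unfolding e using C1_metric_det[OF metric_G x] by (intro mult_left_mono) auto
  qed
  show cf0: "continuous_on U f"
  proof -
    have ct: "continuous_on U t" by (rule C1_on_continuous[OF C2_on_C1[OF C2_t]])
    have "continuous_on UNIV z" using z(1) by (meson DERIV_continuous continuous_at_imp_continuous_on)
    then have cz: "continuous_on U (\<lambda>x. z (t x))" by (rule continuous_on_compose2[OF _ ct]) auto
    have "continuous_on U (\<lambda>x. norm2_vec (h x) (grad b x))"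
      using C1_on_continuous[OF C1_on_metric[OF h]] C1_metric_det[OF h] C1_on_continuous_pd[OF b(1)]
      by (intro continuous_on_norm2_vec) (auto simp: less_le)
    then show ?thesis unfolding f_def
      using ct cz continuous_on_energy[OF N] continuous_on_Tmat[OF N]
        C1_on_continuous[OF b(1)] C1_on_continuous[OF C2_on_C1[OF \<rho>]]
      by (auto intro!: continuous_intros simp del: real_sqrt_mult)
  qed
  have cf: "continuous_on U (\<lambda>x. sqrt (det (G x)) * f x)"
    by (intro continuous_on_mult cf0 C1_on_continuous[OF C1_on_sqrt_det[OF metric_G]])
  have "f x = 0" if "x \<in> U - Cs" for x
    using supp[OF that] by (auto simp: f_def energy_def norm2_vec_def norm2_mat_def trace_def)
  then show int: "integrable lborel (\<lambda>x. indicator U x * (sqrt (det (G x)) * f x))"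
    by (intro integrable_compact_support[OF open_U Cs cf]) auto
  have intF: "integrable lborel (\<lambda>x. indicator U x * pd i (F i) x)" "(\<integral>x. indicator U x * pd i (F i) x \<partial>lborel) = 0" for i
    using integral_pd_eq_0[OF open_U Cs C1F F0] by auto
  have "(\<integral>x. indicator U x * (sqrt (det (G x)) * f x) \<partial>lborel)
      \<le> (\<integral>x. (\<Sum>i\<in>UNIV. indicator U x * pd i (F i) x) \<partial>lborel)"
  proof (rule integral_mono[OF int])
    show "integrable lborel (\<lambda>x. \<Sum>i\<in>UNIV. indicator U x * pd i (F i) x)"
      by (intro Bochner_Integration.integrable_sum intF)
    show "indicator U x * (sqrt (det (G x)) * f x) \<le> (\<Sum>i\<in>UNIV. indicator U x * pd i (F i) x)" for x
      using fF[of x] by (auto simp: indicator_def)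
  qed
  also have "\<dots> = 0" using intF by (subst Bochner_Integration.integral_sum) auto
  finally show "(\<integral>x. indicator U x * (sqrt (det (G x)) * f x) \<partial>lborel) \<le> 0" .
qed

end

section \<open>Smooth functions and one-sided derivatives\<close>

lemma C1_on_local:
  assumes "open U" "\<And>x. x \<in> U \<Longrightarrow> \<exists>V. open V \<and> x \<in> V \<and> V \<subseteq> U \<and> C1_on V f"
  shows "C1_on U f"
  unfolding C1_on_def
proof (intro conjI ballI)
  fix x assume "x \<in> U"
  then show "f differentiable (at x)" using assms(2) C1_on_differentiable by blast
next
  have "isCont (grad f) x" if "x \<in> U" for x
    using assms(2)[OF that] C1_on_continuous_grad continuous_on_eq_continuous_at by blast
  then show "continuous_on U (grad f)" by (simp add: continuous_at_imp_continuous_on)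
qed

lemma C2_on_local:
  assumes "open U" "\<And>x. x \<in> U \<Longrightarrow> \<exists>V. open V \<and> x \<in> V \<and> V \<subseteq> U \<and> C2_on V f"
  shows "C2_on U f"
  unfolding C2_on_def
proof (intro conjI allI)
  show "C1_on U f" by (rule C1_on_local[OF assms(1)]) (meson assms(2) C2_on_C1)
  show "C1_on U (pd i f)" for i by (rule C1_on_local[OF assms(1)]) (meson assms(2) C2_on_pd)
qed

text \<open>Differentiability of the iterated partial for \<open>i # I\<close> gives continuity of
  the gradient of the one for \<open>I\<close>.\<close>

lemma smooth_imp_C2_on:
  assumes "open U" "\<forall>I. iter_partial I e differentiable_on U"
  shows "C2_on U e"
proof -
  have d: "iter_partial I e differentiable (at x)" if "x \<in> U" for I x
    using assms that by (metis at_within_open differentiable_on_def)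
  have c: "C1_on U (iter_partial I e)" for I
  proof (rule C1_onI)
    show "GDERIV (iter_partial I e) x :> grad (iter_partial I e) x" if "x \<in> U" for x
      by (rule GDERIV_grad[OF d[OF that]])
    have "continuous_on U (pd i (iter_partial I e))" for i
      using differentiable_imp_continuous_on[OF assms(2)[rule_format, of "i # I"]]
      by (simp add: pd_def[abs_def])
    then show "continuous_on U (grad (iter_partial I e))"
      unfolding grad_def by (intro continuous_on_vec_lambda)
  qed
  have "C1_on U (pd i e)" for i using c[of "[i]"] by (simp add: pd_def[abs_def])
  with c[of "[]"] show ?thesis by (simp add: C2_on_def)
qed

lemma smooth_on_extension:
  assumes "smooth_on S f" "x \<in> S"
  obtains U e where "open U" "x \<in> U" "C2_on U e" "\<And>y. y \<in> S \<inter> U \<Longrightarrow> e y = f y"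
  using assms smooth_imp_C2_on unfolding smooth_on_def by metis

lemma smooth_on_C2_on:
  assumes "smooth_on S f" "open U" "U \<subseteq> S"
  shows "C2_on U f"
proof (rule C2_on_local[OF assms(2)])
  fix x assume x: "x \<in> U"
  obtain V e where V: "open V" "x \<in> V" "C2_on V e" "\<And>y. y \<in> S \<inter> V \<Longrightarrow> e y = f y"
    using smooth_on_extension[OF assms(1), of x] x assms(3) by blast
  have "C2_on (U \<inter> V) f"
    by (rule C2_on_cong[of _ e]) (use assms V C2_on_subset[OF V(3), of "U \<inter> V"] in auto)
  then show "\<exists>V. open V \<and> x \<in> V \<and> V \<subseteq> U \<and> C2_on V f"
    using assms(2) V x by (intro exI[of _ "U \<inter> V"]) auto
qed

lemma continuous_on_local_extension:
  fixes f :: "'x::topological_space \<Rightarrow> 'y::topological_space"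
  assumes "\<And>x. x \<in> S \<Longrightarrow> \<exists>U e. open U \<and> x \<in> U \<and> continuous_on U e \<and> (\<forall>y\<in>S \<inter> U. e y = f y)"
  shows "continuous_on S f"
  unfolding continuous_on_def
proof
  fix x assume x: "x \<in> S"
  obtain U e where U: "open U" "x \<in> U" "continuous_on U e" "\<forall>y\<in>S \<inter> U. e y = f y" using assms[OF x] by blast
  have "(e \<longlongrightarrow> e x) (at x within S)"
    using U by (metis continuous_on_def at_within_open tendsto_within_subset subset_UNIV)
  moreover have "\<forall>\<^sub>F y in at x within S. e y = f y"
    using U by (auto simp: eventually_at_topological)
  ultimately have "(f \<longlongrightarrow> e x) (at x within S)" by (rule Lim_transform_eventually)
  then show "(f \<longlongrightarrow> f x) (at x within S)" using U x by simp
qed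

lemma smooth_on_continuous: "smooth_on S f \<Longrightarrow> continuous_on S f"
  by (rule continuous_on_local_extension) (metis C1_on_continuous C2_on_C1 smooth_on_extension IntE IntI)

text \<open>Derivatives within \<open>S\<close> are unique at \<open>x\<close>.\<close>

definition thick :: "(real^'n::finite) set \<Rightarrow> real^'n \<Rightarrow> bool" where
  "thick S x \<longleftrightarrow> (\<forall>L. ((\<lambda>_. 0::real) has_derivative L) (at x within S) \<longrightarrow> (\<forall>v. L v = 0))"

text \<open>The set contains a short segment from \<open>x\<close> in every direction in which
  \<sigma> decreases. A derivative of the zero function must vanish in these directions, and they
  fill an open half-space, which spans.\<close>

lemma thick_sublevel:
  fixes x :: "real^'n::finite"
  assumes \<sigma>: "\<sigma> differentiable (at x)" "grad \<sigma> x \<noteq> 0" and S: "open B" "x \<in> B" "{y \<in> B. \<sigma> y < \<sigma> x} \<subseteq> S"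
  shows "thick S x"
  unfolding thick_def
proof (intro allI impI)
  fix L v assume L: "((\<lambda>_. 0::real) has_derivative L) (at x within S)"
  then have lin: "linear L" by (rule has_derivative_linear)
  have neg: "L w = 0" if w: "w \<bullet> grad \<sigma> x < 0" for w
  proof (rule ccontr)
    assume ne: "L w \<noteq> 0"
    have w0: "w \<noteq> 0" using w by auto
    \<comment> \<open>Half of \<open>\<bar>L w\<bar> / norm w\<close>, so that the derivative
      estimate along the segment contradicts \<open>L w \<noteq> 0\<close>.\<close>
    define \<epsilon> where "\<epsilon> = \<bar>L w\<bar> / (2 * norm w)"
    have \<epsilon>: "\<epsilon> > 0" using ne w0 by (simp add: \<epsilon>_def)
    obtain \<delta> where \<delta>: "\<delta> > 0" "\<And>y. y \<in> S \<Longrightarrow> norm (y - x) < \<delta> \<Longrightarrow> norm (L (y - x)) \<le> \<epsilon> * norm (y - x)"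
      using L \<epsilon> unfolding has_derivative_within_alt by (metis diff_self diff_0 norm_minus_cancel)
    have "((\<lambda>s. x + s *\<^sub>R w) has_derivative (\<lambda>s. s *\<^sub>R w)) (at 0)"
      by (auto intro!: derivative_eq_intros)
    moreover have "(\<sigma> has_derivative (\<lambda>h. h \<bullet> grad \<sigma> x)) (at (x + 0 *\<^sub>R w))"
      using GDERIV_grad[OF \<sigma>(1)] by (simp add: gderiv_def)
    ultimately have "((\<lambda>s. \<sigma> (x + s *\<^sub>R w)) has_derivative (\<lambda>s. (s *\<^sub>R w) \<bullet> grad \<sigma> x)) (at 0)"
      by (rule has_derivative_compose)
    then have "DERIV (\<lambda>s. \<sigma> (x + s *\<^sub>R w)) 0 :> w \<bullet> grad \<sigma> x"
      by (simp add: has_field_derivative_def mult_commute_abs)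
    then obtain d where d: "d > 0" "\<And>s. 0 < s \<Longrightarrow> s < d \<Longrightarrow> \<sigma> (x + s *\<^sub>R w) < \<sigma> x"
      using DERIV_neg_dec_right[of "\<lambda>s. \<sigma> (x + s *\<^sub>R w)" "w \<bullet> grad \<sigma> x" 0] w by (auto simp del: inner_commute)
    obtain r where r: "r > 0" "ball x r \<subseteq> B" using S(1,2) by (meson open_contains_ball)
    define s where "s = min d (min \<delta> r / norm w) / 2"
    have s: "0 < s" "s < d" "s * norm w < \<delta>" "s * norm w < r"
    proof -
      have *: "0 < min \<delta> r / norm w" using \<delta> r w0 by simp
      then show "0 < s" "s < d" using d by (auto simp: s_def)
      have "min d q / 2 < q" if "0 < q" for q :: real using that by (simp add: min_def)
      then have "s < min \<delta> r / norm w" unfolding s_def using * by blast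
      then have "s * norm w < min \<delta> r" using w0 by (simp add: field_simps)
      then show "s * norm w < \<delta>" "s * norm w < r" by auto
    qed
    have "x + s *\<^sub>R w \<in> ball x r" using s by (simp add: dist_norm)
    then have "x + s *\<^sub>R w \<in> S" using S(3) r(2) d(2)[OF s(1,2)] by blast
    then have "norm (L (s *\<^sub>R w)) \<le> \<epsilon> * norm (s *\<^sub>R w)" using \<delta>(2)[of "x + s *\<^sub>R w"] s by simp
    then have "s * \<bar>L w\<bar> \<le> s * (\<epsilon> * norm w)" using s by (simp add: linear_cmul[OF lin] abs_mult ac_simps)
    then have "\<bar>L w\<bar> \<le> \<epsilon> * norm w" using s by simp
    then show False using w0 ne by (simp add: \<epsilon>_def)
  qed
  define n where "n = grad \<sigma> x"
  have n: "n \<bullet> n > 0" using \<sigma>(2) by (simp add: n_def)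
  \<comment> \<open>Large enough to move \<open>v\<close> into the half-space; \<open>v\<close> is
    then a combination of two directions on which \<open>L\<close> vanishes.\<close>
  define k where "k = (\<bar>v \<bullet> n\<bar> + 1) / (n \<bullet> n)"
  have "(v - k *\<^sub>R n) \<bullet> n = v \<bullet> n - (\<bar>v \<bullet> n\<bar> + 1)" using n by (simp add: inner_diff_left k_def)
  then have "L (v - k *\<^sub>R n) = 0" by (intro neg) (simp add: n_def[symmetric])
  moreover have "L (- n) = 0" using n by (intro neg) (simp add: n_def[symmetric])
  ultimately show "L v = 0" by (simp add: linear_diff[OF lin] linear_cmul[OF lin] linear_neg[OF lin])
qed

text \<open>A derivative within a set is defined by choice and could be arbitrary where it is not
  unique. Thickness removes the ambiguity and lets any differentiable extension compute it.\<close>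

lemma thick_frechet_derivative:
  assumes "thick S x" "open U" "x \<in> U" "x \<in> S" "e differentiable (at x)" "\<And>y. y \<in> S \<inter> U \<Longrightarrow> f y = e y"
  shows "frechet_derivative f (at x within S) (axis i 1) = pd i e x"
proof -
  have "(e has_derivative frechet_derivative e (at x)) (at x within S)"
    using assms(5) frechet_derivative_works has_derivative_at_withinI by blast
  moreover obtain d where "d > 0" "ball x d \<subseteq> U" using assms(2,3) by (meson open_contains_ball)
  ultimately have f: "(f has_derivative frechet_derivative e (at x)) (at x within S)"
    using assms(4,6) by (intro has_derivative_transform_within[of e _ x S d f]) (auto simp: dist_commute subset_iff)
  then have "(f has_derivative frechet_derivative f (at x within S)) (at x within S)"
    using differentiableI frechet_derivative_works by blast
  from has_derivative_diff[OF this f]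
  have "frechet_derivative f (at x within S) v - frechet_derivative e (at x) v = 0" for v
    using assms(1)[unfolded thick_def, rule_format, of "\<lambda>v. frechet_derivative f (at x within S) v - frechet_derivative e (at x) v"]
    by simp
  then show ?thesis by (simp add: pd_def)
qed

text \<open>Two extensions of the same function have the same gradient at points of the thick set,
  although they may differ nearby.\<close>

lemma thick_grad_unique:
  assumes "thick S x" "open U" "x \<in> U" "x \<in> S" "e differentiable (at x)" "f differentiable (at x)"
    "\<And>y. y \<in> S \<inter> U \<Longrightarrow> f y = e y"
  shows "pd i f x = pd i e x"
  using thick_frechet_derivative[of S x U e f i] thick_frechet_derivative[of S x U f f i] assms by simp

section \<open>Charts\<close>

abbreviation cinv :: "('a, 'n::finite) chart \<Rightarrow> real^'n \<Rightarrow> 'a" where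
  "cinv c \<equiv> inv_into (fst c) (snd c)"

locale chart_atlas =
  fixes X :: "'a topology" and A :: "('a, 'n::finite) chart set"
  assumes manifold: "compact_manifold_with_boundary X A"
begin

lemma chart: "c \<in> A \<Longrightarrow> is_chart X c"
  using manifold by (simp add: compact_manifold_with_boundary_def)

lemma compact_X: "compact_space X" and Hausdorff_X: "Hausdorff_space X"
  using manifold by (simp_all add: compact_manifold_with_boundary_def)

lemma charts_cover: "p \<in> topspace X \<Longrightarrow> \<exists>c\<in>A. p \<in> fst c"
  using manifold unfolding compact_manifold_with_boundary_def by blast

lemma chart_at_mem: "p \<in> topspace X \<Longrightarrow> chart_at A p \<in> A \<and> p \<in> fst (chart_at A p)"
  unfolding chart_at_def using charts_cover[of p] by (metis (mono_tags, lifting) someI_ex)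

lemma open_domain: "c \<in> A \<Longrightarrow> openin X (fst c)"
  using chart by (simp add: is_chart_def)

lemma domain_subset: "c \<in> A \<Longrightarrow> fst c \<subseteq> topspace X"
  using open_domain openin_subset by blast

lemma homeo: "c \<in> A \<Longrightarrow> homeomorphic_map (subtopology X (fst c)) (top_of_set (snd c ` fst c)) (snd c)"
  using chart by (simp add: is_chart_def)

lemma inj_chart: "c \<in> A \<Longrightarrow> inj_on (snd c) (fst c)"
  using homeomorphic_imp_injective_map[OF homeo] domain_subset by (metis inf.absorb2 topspace_subtopology)

lemma cinv_chart [simp]: "c \<in> A \<Longrightarrow> p \<in> fst c \<Longrightarrow> cinv c (snd c p) = p"
  using inj_chart by (simp add: inv_into_f_f)

lemma continuous_chart: "c \<in> A \<Longrightarrow> continuous_map (subtopology X (fst c)) euclidean (snd c)"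
  using homeomorphic_imp_continuous_map[OF homeo] continuous_map_into_fulltopology by blast

lemma continuous_cinv:
  assumes c: "c \<in> A" shows "continuous_map (top_of_set (snd c ` fst c)) (subtopology X (fst c)) (cinv c)"
proof -
  obtain g where g: "homeomorphic_maps (subtopology X (fst c)) (top_of_set (snd c ` fst c)) (snd c) g"
    using homeo[OF c] homeomorphic_map_maps by blast
  then have cg: "continuous_map (top_of_set (snd c ` fst c)) (subtopology X (fst c)) g"
    and gi: "\<And>p. p \<in> topspace X \<Longrightarrow> p \<in> fst c \<Longrightarrow> g (snd c p) = p"
    by (auto simp: homeomorphic_maps_def)
  have "g x = cinv c x" if "x \<in> snd c ` fst c" for x
    using that gi domain_subset[OF c] c by auto
  then show ?thesis using cg by (intro continuous_map_eq[OF cg]) auto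
qed

lemma image_openin:
  assumes c: "c \<in> A" and V: "openin X V"
  shows "openin (top_of_set half_space) (snd c ` (fst c \<inter> V))"
proof -
  have "openin (subtopology X (fst c)) (fst c \<inter> V)"
    using V by (simp add: openin_subtopology_Int2)
  then have "openin (top_of_set (snd c ` fst c)) (snd c ` (fst c \<inter> V))"
    using homeomorphic_imp_open_map[OF homeo[OF c]] by (simp add: open_map_def)
  moreover have "openin (top_of_set half_space) (snd c ` fst c)" using chart[OF c] by (simp add: is_chart_def)
  ultimately show ?thesis using openin_trans by blast
qed

lemma chart_in_half_space: "c \<in> A \<Longrightarrow> p \<in> fst c \<Longrightarrow> 0 \<le> snd c p $ bdry_index"
  using chart[of c] openin_imp_subset[of euclidean half_space "snd c ` fst c"] unfolding is_chart_def half_space_def by auto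

lemma preimage_openin:
  assumes c: "c \<in> A" and B: "open B"
  shows "openin X {p \<in> fst c. snd c p \<in> B}"
proof -
  have "openin (subtopology X (fst c)) {p \<in> topspace (subtopology X (fst c)). snd c p \<in> B}"
    using continuous_chart[OF c] B unfolding continuous_map_def by simp
  moreover have "topspace (subtopology X (fst c)) = fst c" using domain_subset[OF c] by auto
  ultimately show ?thesis using open_domain[OF c] openin_trans_full by metis
qed

lemma continuous_map_chart:
  assumes c: "c \<in> A" and D: "D \<subseteq> fst c" and f: "continuous_on (snd c ` D) (f \<circ> cinv c)"
  shows "continuous_map (subtopology X D) euclidean f"
proof -
  have "continuous_map (subtopology X D) (top_of_set (snd c ` D)) (snd c)"
    using continuous_map_from_subtopology_mono[OF continuous_chart[OF c] D]
    by (auto simp: continuous_map_in_subtopology)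
  moreover have "continuous_map (top_of_set (snd c ` D)) euclidean (f \<circ> cinv c)" using f by simp
  ultimately have "continuous_map (subtopology X D) euclidean ((f \<circ> cinv c) \<circ> snd c)"
    by (rule continuous_map_compose)
  then show ?thesis by (rule continuous_map_eq) (use c D in auto)
qed

lemma continuous_map_charts:
  assumes D: "D \<subseteq> topspace X" and F: "\<And>c. c \<in> A \<Longrightarrow> continuous_on (snd c ` (fst c \<inter> D)) (f \<circ> cinv c)"
  shows "continuous_map (subtopology X D) euclidean f"
proof (rule pasting_lemma[where I = A and T = "\<lambda>c. fst c \<inter> D" and f = "\<lambda>c. f"])
  fix c assume c: "c \<in> A"
  show "openin (subtopology X D) (fst c \<inter> D)" using open_domain[OF c] by (simp add: openin_subtopology_Int)
  have sub: "subtopology (subtopology X D) (fst c \<inter> D) = subtopology X (fst c \<inter> D)"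
    by (simp add: subtopology_subtopology Int_absorb1 Int_commute Int_left_commute)
  show "continuous_map (subtopology (subtopology X D) (fst c \<inter> D)) euclidean f"
    unfolding sub by (rule continuous_map_chart[OF c _ F[OF c]]) simp
next
  show "\<exists>j. j \<in> A \<and> p \<in> fst j \<inter> D \<and> f p = f p" if "p \<in> topspace (subtopology X D)" for p
    using that charts_cover[of p] by (metis IntI IntE topspace_subtopology)
qed auto

end

section \<open>Asymptotically hyperbolic manifolds in charts\<close>

locale ah_manifold =
  fixes X :: "'a topology" and A :: "('a, 'n::finite) chart set" and \<rho> :: "'a \<Rightarrow> real" and h :: "('a, 'n) metric"
  assumes AH: "asymptotically_hyperbolic X A \<rho> h"

sublocale ah_manifold \<subseteq> chart_atlas X A
  by unfold_locales (use AH in \<open>simp add: asymptotically_hyperbolic_def\<close>)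

context ah_manifold
begin

abbreviation g :: "('a, 'n) metric" where "g \<equiv> ah_metric \<rho> h"
abbreviation M :: "'a set" where "M \<equiv> interior_part X A"

definition Om :: "('a, 'n) chart \<Rightarrow> (real^'n) set" where "Om c = snd c ` (fst c \<inter> M)"

lemma defining: "smooth_fun_on A UNIV \<rho>" "\<And>p. p \<in> topspace X \<Longrightarrow> 0 \<le> \<rho> p"
    "bdry A = {p \<in> topspace X. \<rho> p = 0}"
    "\<And>p c. p \<in> bdry A \<Longrightarrow> c \<in> A \<Longrightarrow> p \<in> fst c \<Longrightarrow> \<exists>i. coord_deriv UNIV c i \<rho> p \<noteq> 0"
  using AH unfolding asymptotically_hyperbolic_def defining_function_def by auto

lemma metric_h: "riemannian_metric A h"
  using AH by (simp add: asymptotically_hyperbolic_def)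

lemma smooth_rho: "c \<in> A \<Longrightarrow> smooth_on (snd c ` fst c) (\<rho> \<circ> cinv c)"
  using defining(1) by (simp add: smooth_fun_on_def smooth_in_chart_def)

lemma smooth_h: "c \<in> A \<Longrightarrow> smooth_on (snd c ` fst c) (\<lambda>x. h c (cinv c x) $ i $ j)"
  using metric_h by (simp add: riemannian_metric_def smooth_in_chart_def o_def)

lemma posdef_h_chart: "c \<in> A \<Longrightarrow> p \<in> fst c \<Longrightarrow> posdef (h c p)"
  using metric_h by (auto simp: riemannian_metric_def posdef_def)

lemma continuous_rho: "continuous_map X euclidean \<rho>"
  using continuous_map_charts[of "topspace X" \<rho>] smooth_on_continuous[OF smooth_rho] domain_subset
  by (simp add: Int_absorb2)

lemma M_eq: "M = {p \<in> topspace X. \<rho> p > 0}"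
  using defining(2,3) by (auto simp: interior_part_def less_le)

lemma M_subset: "M \<subseteq> topspace X" by (auto simp: interior_part_def)

lemma open_M: "openin X M"
proof -
  have "openin X {p \<in> topspace X. \<rho> p \<in> {0<..}}"
    using continuous_rho unfolding continuous_map_def by (metis open_openin open_greaterThan)
  then show ?thesis by (simp add: M_eq)
qed

text \<open>Points off the boundary have positive boundary coordinate, so relative openness in the
  half-space is openness in the whole space, and two-sided calculus applies.\<close>

lemma open_Om_inter:
  assumes c: "c \<in> A" and V: "openin X V" "V \<subseteq> M"
  shows "open (snd c ` (fst c \<inter> V))"
proof -
  obtain W where W: "open W" "snd c ` (fst c \<inter> V) = half_space \<inter> W"
    using image_openin[OF c V(1)] by (metis openin_open)
  have pos: "0 < x $ bdry_index" if "x \<in> snd c ` (fst c \<inter> V)" for x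
  proof -
    obtain p where p: "p \<in> fst c" "p \<in> V" "x = snd c p" using \<open>x \<in> _\<close> by blast
    then have "p \<notin> bdry A" using V(2) by (auto simp: interior_part_def)
    then show ?thesis using p c chart_in_half_space[OF c p(1)] by (force simp: bdry_def less_le)
  qed
  have "snd c ` (fst c \<inter> V) = W \<inter> {x. 0 < x $ bdry_index}"
    unfolding W(2) using pos[unfolded W(2)] by (auto simp: half_space_def)
  moreover have "open {x::real^'n. 0 < x $ bdry_index}" by (rule open_Collect_less) (auto intro!: continuous_intros)
  ultimately show ?thesis using W(1) by auto
qed

lemma open_Om: "c \<in> A \<Longrightarrow> open (Om c)"
  unfolding Om_def by (rule open_Om_inter) (auto simp: open_M)

lemma Om_subset: "Om c \<subseteq> snd c ` fst c" by (auto simp: Om_def)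

lemma cinv_Om: "c \<in> A \<Longrightarrow> x \<in> Om c \<Longrightarrow> cinv c x \<in> fst c \<and> cinv c x \<in> M \<and> snd c (cinv c x) = x"
  by (auto simp: Om_def)

lemma snd_Om: "c \<in> A \<Longrightarrow> p \<in> fst c \<Longrightarrow> p \<in> M \<Longrightarrow> snd c p \<in> Om c"
  by (auto simp: Om_def)

lemma conformal: "c \<in> A \<Longrightarrow> conformal_chart (Om c) (\<lambda>x. h c (cinv c x)) (\<lambda>x. \<rho> (cinv c x))"
proof
  assume c: "c \<in> A"
  show "C1_metric (Om c) (\<lambda>x. h c (cinv c x))"
    unfolding C1_metric_def
    using open_Om[OF c] posdef_h_chart[OF c] cinv_Om[OF c] C2_on_C1[OF smooth_on_C2_on[OF smooth_h[OF c] open_Om[OF c] Om_subset]]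
    by blast
  show "C2_on (Om c) (\<lambda>x. \<rho> (cinv c x))"
    using smooth_on_C2_on[OF smooth_rho[OF c] open_Om[OF c] Om_subset] by (simp add: o_def)
  show "\<rho> (cinv c x) > 0" if "x \<in> Om c" for x
    using cinv_Om[OF c that] by (auto simp: M_eq)
qed

abbreviation Gc :: "('a, 'n) chart \<Rightarrow> real^'n \<Rightarrow> real^'n^'n" where
  "Gc c \<equiv> (\<lambda>x. g c (cinv c x))"

lemma Gc_eq: "conformal_chart.G (\<lambda>x. h c (cinv c x)) (\<lambda>x. \<rho> (cinv c x)) = Gc c" if "c \<in> A"
  by (simp add: conformal_chart.G_def[OF conformal[OF that]] fun_eq_iff ah_metric_def)

lemma metric_Gc: "c \<in> A \<Longrightarrow> C1_metric (Om c) (Gc c)"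
  using conformal_chart.metric_G[OF conformal, of c] Gc_eq[of c] by simp

lemma posdef_g: "c \<in> A \<Longrightarrow> p \<in> fst c \<Longrightarrow> p \<in> M \<Longrightarrow> posdef (g c p)"
  using posdef_scaleR[OF posdef_h_chart, of c p "1 / (\<rho> p)\<^sup>2"] by (auto simp: ah_metric_def M_eq)

end

section \<open>Tensor norms of rank at most two as traces\<close>

lemma sum_lists_length_1:
  fixes f :: "'n::finite list \<Rightarrow> real"
  shows "(\<Sum>I | length I = 1. f I) = (\<Sum>i\<in>UNIV. f [i])"
proof -
  have "{I::'n list. length I = 1} = (\<lambda>i. [i]) ` UNIV" by (auto simp: length_Suc_conv)
  then show ?thesis by (simp add: sum.reindex inj_on_def)
qed

lemma sum_lists_length_2:
  fixes f :: "'n::finite list \<Rightarrow> real"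
  shows "(\<Sum>I | length I = 2. f I) = (\<Sum>i\<in>UNIV. \<Sum>j\<in>UNIV. f [i, j])"
proof -
  have "{I::'n list. length I = 2} = (\<lambda>(i, j). [i, j]) ` (UNIV \<times> UNIV)"
    by (auto simp: length_Suc_conv numeral_2_eq_2)
  then have "(\<Sum>I | length I = 2. f I) = (\<Sum>(i, j)\<in>UNIV \<times> UNIV. f [i, j])"
    by (simp add: sum.reindex inj_on_def split_def)
  then show ?thesis by (simp add: sum.cartesian_product)
qed

lemma tensor_norm_0: "(tensor_norm A g 0 T p)\<^sup>2 = (T (chart_at A p) p [])\<^sup>2"
  by (simp add: tensor_norm_def Let_def power2_eq_square)

lemma tensor_norm_1:
  fixes g :: "('a, 'n::finite) metric"
  assumes "posdef (g (chart_at A p) p)"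
  shows "(tensor_norm A g 1 T p)\<^sup>2 = norm2_vec (g (chart_at A p) p) (\<chi> i. T (chart_at A p) p [i])"
proof -
  let ?c = "chart_at A p"
  have "(\<Sum>I | length I = 1. \<Sum>J | length J = 1.
        (\<Prod>m<1. matrix_inv (g ?c p) $ (I ! m) $ (J ! m)) * T ?c p I * T ?c p J)
      = norm2_vec (g ?c p) (\<chi> i. T ?c p [i])"
    by (simp only: sum_lists_length_1)
       (simp add: norm2_vec_def inner_vec_def matrix_vector_mult_def sum_distrib_left ac_simps)
  then show ?thesis using norm2_vec_nonneg[OF assms] by (simp add: tensor_norm_def Let_def)
qed

lemma tensor_norm_2:
  fixes g :: "('a, 'n::finite) metric"
  assumes "posdef (g (chart_at A p) p)"
  shows "(tensor_norm A g 2 T p)\<^sup>2 = norm2_mat (g (chart_at A p) p) (\<chi> i j. T (chart_at A p) p [i, j])"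
proof -
  let ?c = "chart_at A p"
  let ?K = "matrix_inv (g ?c p)"
  have p2: "(\<Prod>m<2. ?K $ (I ! m) $ (J ! m)) = ?K $ (I ! 0) $ (J ! 0) * ?K $ (I ! 1) $ (J ! 1)" for I J
    by (simp add: numeral_2_eq_2)
  have "(\<Sum>I | length I = 2. \<Sum>J | length J = 2. (\<Prod>m<2. ?K $ (I ! m) $ (J ! m)) * T ?c p I * T ?c p J)
      = (\<Sum>i\<in>UNIV. \<Sum>j\<in>UNIV. \<Sum>k\<in>UNIV. \<Sum>l\<in>UNIV. ?K $ k $ i * ?K $ j $ l * T ?c p [i, j] * T ?c p [k, l])"
    by (simp add: p2 sum_lists_length_2 matrix_inv_symmetric[OF assms, of _ "_::'n"] cong: sum.cong)
  also have "\<dots> = (\<Sum>i\<in>UNIV. \<Sum>k\<in>UNIV. \<Sum>j\<in>UNIV. \<Sum>l\<in>UNIV. ?K $ k $ i * ?K $ j $ l * T ?c p [i, j] * T ?c p [k, l])"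
    by (rule sum.cong[OF refl], rule sum.swap)
  also have "\<dots> = (\<Sum>k\<in>UNIV. \<Sum>i\<in>UNIV. \<Sum>j\<in>UNIV. \<Sum>l\<in>UNIV. ?K $ k $ i * ?K $ j $ l * T ?c p [i, j] * T ?c p [k, l])"
    by (rule sum.swap)
  also have "\<dots> = norm2_mat (g ?c p) (\<chi> i j. T ?c p [i, j])"
  proof -
    have "norm2_mat (g ?c p) (\<chi> i j. T ?c p [i, j])
      = (\<Sum>k\<in>UNIV. \<Sum>l\<in>UNIV. \<Sum>j\<in>UNIV. \<Sum>i\<in>UNIV. ?K $ k $ i * ?K $ j $ l * T ?c p [i, j] * T ?c p [k, l])"
      by (simp add: norm2_mat_def trace_def matrix_matrix_mult_def transpose_def sum_distrib_right sum_distrib_left ac_simps)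
    also have "\<dots> = (\<Sum>k\<in>UNIV. \<Sum>l\<in>UNIV. \<Sum>i\<in>UNIV. \<Sum>j\<in>UNIV. ?K $ k $ i * ?K $ j $ l * T ?c p [i, j] * T ?c p [k, l])"
      by (rule sum.cong[OF refl], rule sum.cong[OF refl], rule sum.swap)
    also have "\<dots> = (\<Sum>k\<in>UNIV. \<Sum>i\<in>UNIV. \<Sum>l\<in>UNIV. \<Sum>j\<in>UNIV. ?K $ k $ i * ?K $ j $ l * T ?c p [i, j] * T ?c p [k, l])"
      by (rule sum.cong[OF refl], rule sum.swap)
    also have "\<dots> = (\<Sum>k\<in>UNIV. \<Sum>i\<in>UNIV. \<Sum>j\<in>UNIV. \<Sum>l\<in>UNIV. ?K $ k $ i * ?K $ j $ l * T ?c p [i, j] * T ?c p [k, l])"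
      by (rule sum.cong[OF refl], rule sum.cong[OF refl], rule sum.swap)
    finally show ?thesis by simp
  qed
  finally show ?thesis using norm2_mat_nonneg[OF assms] by (simp add: tensor_norm_def Let_def)
qed

section \<open>Derivatives of a function on the end\<close>

context ah_manifold
begin

text \<open>The coordinate image of \<open>D'\<close> contains a neighbourhood of the point, where a
  derivative within the set is the ordinary one.\<close>

lemma coord_deriv_interior:
  assumes c: "c \<in> A" and p: "p \<in> fst c" "p \<in> M" and D: "openin X D" "p \<in> D" "D \<subseteq> D'"
  shows "coord_deriv D' c i f p = pd i (f \<circ> cinv c) (snd c p)"
proof -
  have "open (snd c ` (fst c \<inter> (D \<inter> M)))"
    by (rule open_Om_inter[OF c]) (auto intro: openin_Int D open_M)
  moreover have "snd c p \<in> snd c ` (fst c \<inter> (D \<inter> M))" using p D(2) by blast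
  moreover have "snd c ` (fst c \<inter> (D \<inter> M)) \<subseteq> snd c ` (fst c \<inter> D')" using D(3) by blast
  ultimately have "snd c p \<in> interior (snd c ` (fst c \<inter> D'))" by (rule interiorI)
  from at_within_interior[OF this] show ?thesis by (simp add: coord_deriv_def pd_def)
qed

lemma christoffel_eq:
  assumes c: "c \<in> A" and p: "p \<in> fst c" "p \<in> M"
  shows "christoffel g c p l i j = (\<Sum>m\<in>UNIV. matrix_inv (g c p) $ l $ m * chr_low (Gc c) (snd c p) m i j)"
  by (simp add: christoffel_def coord_deriv_interior[OF c p, of "topspace X"] p(2) M_subset[THEN subsetD]
      chr_low_def o_def sum_divide_distrib)

section \<open>Coordinate changes between interior charts\<close>

definition transition :: "('a, 'n) chart \<Rightarrow> ('a, 'n) chart \<Rightarrow> real^'n \<Rightarrow> real^'n" where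
  "transition c d y = snd d (cinv c y)"

definition overlap :: "('a, 'n) chart \<Rightarrow> ('a, 'n) chart \<Rightarrow> (real^'n) set" where
  "overlap c d = snd c ` (fst c \<inter> (fst d \<inter> M))"

lemma open_overlap: "c \<in> A \<Longrightarrow> d \<in> A \<Longrightarrow> open (overlap c d)"
  unfolding overlap_def by (rule open_Om_inter) (auto intro: openin_Int open_domain open_M)

lemma cinv_overlap:
  "c \<in> A \<Longrightarrow> y \<in> overlap c d \<Longrightarrow> cinv c y \<in> fst c \<and> cinv c y \<in> fst d \<and> cinv c y \<in> M \<and> snd c (cinv c y) = y"
  by (auto simp: overlap_def)

lemma transition_Om: "c \<in> A \<Longrightarrow> d \<in> A \<Longrightarrow> y \<in> overlap c d \<Longrightarrow> transition c d y \<in> Om d \<and> cinv d (transition c d y) = cinv c y"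
  using cinv_overlap[of c y d] by (auto simp: transition_def Om_def)

lemma C2_transition:
  assumes "c \<in> A" "d \<in> A" shows "C2_on (overlap c d) (\<lambda>y. transition c d y $ k)"
proof -
  have "smooth_on (snd c ` (fst c \<inter> fst d)) ((\<lambda>p. snd d p $ k) \<circ> cinv c)"
    using manifold assms unfolding compact_manifold_with_boundary_def smooth_in_chart_def by blast
  then have "C2_on (overlap c d) ((\<lambda>p. snd d p $ k) \<circ> cinv c)"
    by (rule smooth_on_C2_on) (use open_overlap[OF assms] in \<open>auto simp: overlap_def\<close>)
  then show ?thesis by (simp add: o_def transition_def)
qed

lemma differentiable_transition:
  assumes "c \<in> A" "d \<in> A" "y \<in> overlap c d" shows "(\<lambda>y. transition c d y $ k) differentiable (at y)"
  using C1_on_differentiable[OF C2_on_C1[OF C2_transition]] assms by blast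

lemma metric_transform:
  assumes c: "c \<in> A" "d \<in> A" and y: "y \<in> overlap c d"
  defines "J \<equiv> (\<chi> k i. pd i (\<lambda>y. transition c d y $ k) y) :: real^'n^'n"
  shows "Gc c y = transpose J ** Gc d (transition c d y) ** J"
proof -
  define q where "q = cinv c y"
  have q: "q \<in> fst c" "q \<in> fst d" "q \<in> M" "snd c q = y" using cinv_overlap[OF c(1) y] by (auto simp: q_def)
  have cd: "coord_deriv (fst d) c i (\<lambda>q. snd d q $ k) q = J $ k $ i" for i k
    using coord_deriv_interior[OF c(1) q(1,3) open_domain[OF c(2)] q(2) subset_refl, of i "\<lambda>q. snd d q $ k"] q(4)
    by (simp add: o_def transition_def[abs_def] J_def)
  have "h c q $ i $ j = (\<Sum>k\<in>UNIV. \<Sum>l\<in>UNIV. J $ k $ i * J $ l $ j * h d q $ k $ l)" for i j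
    using metric_h c q unfolding riemannian_metric_def cd[symmetric] by blast
  also have "(\<Sum>k\<in>UNIV. \<Sum>l\<in>UNIV. J $ k $ i * J $ l $ j * h d q $ k $ l) = (transpose J ** h d q ** J) $ i $ j" for i j
    by (subst sum.swap) (simp add: matrix_matrix_mult_def transpose_def sum_distrib_right sum_distrib_left ac_simps)
  finally have "h c q = transpose J ** h d q ** J" by (simp add: vec_eq_iff)
  moreover have "cinv d (transition c d y) = q" using transition_Om[OF c y] by (simp add: q_def)
  ultimately show ?thesis
    by (simp add: ah_metric_def q_def[symmetric] matrix_mult_scaleR_left matrix_mult_scaleR_right)
qed

text \<open>By the chain rule d\<rho> cannot vanish in one chart and not in another. It is known to
  be nonzero in the chart of a patch, whereas one-sided derivatives are taken in all charts.\<close>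

lemma grad_rho_nonzero_transfer:
  assumes c: "c \<in> A" "d \<in> A" and p: "p \<in> fst c" "p \<in> fst d" "p \<in> M"
    and ne: "grad (\<lambda>x. \<rho> (cinv c x)) (snd c p) \<noteq> 0"
  shows "grad (\<lambda>x. \<rho> (cinv d x)) (snd d p) \<noteq> 0"
proof
  assume z: "grad (\<lambda>x. \<rho> (cinv d x)) (snd d p) = 0"
  have y: "snd c p \<in> overlap c d" using p by (auto simp: overlap_def)
  have tp: "transition c d (snd c p) = snd d p" using p c by (simp add: transition_def)
  have "pd i (\<lambda>x. \<rho> (cinv c x)) (snd c p) = pd i (\<lambda>x. \<rho> (cinv d (transition c d x))) (snd c p)" for i
    by (rule pd_transform[OF open_overlap[OF c] y]) (use transition_Om[OF c] in auto)
  also have "\<dots> i = (\<Sum>k\<in>UNIV. pd i (\<lambda>y. transition c d y $ k) (snd c p) * pd k (\<lambda>x. \<rho> (cinv d x)) (transition c d (snd c p)))" for i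
  proof (rule pd_chain)
    show "(\<lambda>x. \<rho> (cinv d x)) differentiable (at (transition c d (snd c p)))"
      using C1_on_differentiable[OF C2_on_C1[OF conformal_chart.\<rho>[OF conformal[OF c(2)]]]] snd_Om[OF c(2) p(2,3)]
      unfolding tp by blast
  qed (rule differentiable_transition[OF c y])
  also have "\<dots> i = 0" for i
    using arg_cong[OF z, of "\<lambda>v. v $ k" for k] unfolding tp by simp
  finally show False using ne by (simp add: vec_eq_iff)
qed

end

text \<open>\<open>regular\<close> makes \<open>\<rho> = exp (- 2 * R)\<close> a regular level, so
  that derivatives within the end are determined there. In the final proof it follows from the
  choice of \<open>R\<close>, because \<open>|d\<rho>|\<close> is close to 1 on the patches covering
  the end.\<close>

locale ah_function = ah_manifold X A \<rho> h
  for X :: "'a topology" and A :: "('a, 'n::finite) chart set" and \<rho> h +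
  fixes R :: real and N :: "'a \<Rightarrow> real"
  assumes regular: "\<And>c p. c \<in> A \<Longrightarrow> p \<in> fst c \<Longrightarrow> p \<in> end_set X A \<rho> R \<Longrightarrow> grad (\<lambda>x. \<rho> (cinv c x)) (snd c p) \<noteq> 0"
    and N_test: "N \<in> smooth_compact_support X A (end_set X A \<rho> R)"
begin

abbreviation E :: "'a set" where "E \<equiv> end_set X A \<rho> R"

definition Dc :: "('a, 'n) chart \<Rightarrow> (real^'n) set" where "Dc c = snd c ` (fst c \<inter> E)"

lemma E_eq: "p \<in> E \<longleftrightarrow> p \<in> M \<and> \<rho> p \<le> exp (- 2 * R)"
  by (auto simp: end_set_def)

lemma E_M: "E \<subseteq> M" by (auto simp: E_eq)

lemma Dc_eq: "c \<in> A \<Longrightarrow> Dc c = {x \<in> Om c. \<rho> (cinv c x) \<le> exp (- 2 * R)}"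
  by (auto simp: Dc_def Om_def E_eq)

lemma cinv_Dc: "c \<in> A \<Longrightarrow> x \<in> Dc c \<Longrightarrow> cinv c x \<in> fst c \<and> cinv c x \<in> E \<and> snd c (cinv c x) = x"
  by (auto simp: Dc_def)

text \<open>\<rho> itself serves as the defining function at every point: lower values of \<rho>
  stay in the end, and its gradient is nonzero throughout.\<close>

lemma thick_Dc:
  assumes c: "c \<in> A" and x: "x \<in> Dc c" shows "thick (Dc c) x"
proof (rule thick_sublevel[where \<sigma> = "\<lambda>x. \<rho> (cinv c x)" and B = "Om c"])
  have xO: "x \<in> Om c" using x Dc_eq[OF c] by auto
  show "(\<lambda>x. \<rho> (cinv c x)) differentiable (at x)"
    using C1_on_differentiable[OF C2_on_C1[OF conformal_chart.\<rho>[OF conformal[OF c]]] xO] .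
  show "grad (\<lambda>x. \<rho> (cinv c x)) x \<noteq> 0" using regular[OF c, of "cinv c x"] cinv_Dc[OF c x] by simp
  show "open (Om c)" "x \<in> Om c" using open_Om[OF c] xO by auto
  show "{y \<in> Om c. \<rho> (cinv c y) < \<rho> (cinv c x)} \<subseteq> Dc c"
    using x unfolding Dc_eq[OF c] by (auto intro: less_imp_le order.trans)
qed

text \<open>At the inner boundary \<open>N\<close> has no two-sided derivatives, so calculations are
  made with an extension \<open>e\<close> that agrees with \<open>N\<close> only on the end.
  Thickness makes the results at points of the end independent of \<open>e\<close>.\<close>

definition ext :: "('a, 'n) chart \<Rightarrow> (real^'n) set \<Rightarrow> (real^'n \<Rightarrow> real) \<Rightarrow> bool" where
  "ext c U e \<longleftrightarrow> open U \<and> U \<subseteq> Om c \<and> C2_on U e \<and> (\<forall>y\<in>Dc c \<inter> U. e y = N (cinv c y))"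

lemma ext_exists:
  assumes c: "c \<in> A" and x: "x \<in> Dc c" obtains U e where "x \<in> U" "ext c U e"
proof -
  have "smooth_on (Dc c) (N \<circ> cinv c)"
    using N_test c by (auto simp: smooth_compact_support_def smooth_fun_on_def smooth_in_chart_def Dc_def)
  then obtain U e where U: "open U" "x \<in> U" "C2_on U e" "\<And>y. y \<in> Dc c \<inter> U \<Longrightarrow> e y = (N \<circ> cinv c) y"
    using smooth_on_extension x by blast
  have "ext c (U \<inter> Om c) e"
    unfolding ext_def using U open_Om[OF c] C2_on_subset[OF U(3), of "U \<inter> Om c"] by auto
  then show ?thesis using that[of "U \<inter> Om c" e] U(2) x Dc_eq[OF c] by auto
qed

lemma ext_differentiable:
  "ext c U e \<Longrightarrow> y \<in> U \<Longrightarrow> e differentiable (at y)" "ext c U e \<Longrightarrow> y \<in> U \<Longrightarrow> pd i e differentiable (at y)"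
  unfolding ext_def by (auto intro: C1_on_differentiable[OF C2_on_C1] C1_on_differentiable[OF C2_on_pd])

lemma coord_deriv_ext:
  assumes c: "c \<in> A" and e: "ext c U e" and p: "p \<in> fst c" "p \<in> E" "snd c p \<in> U"
  shows "coord_deriv E c i N p = pd i e (snd c p)"
proof -
  have pD: "snd c p \<in> Dc c" using p by (auto simp: Dc_def)
  show ?thesis
    unfolding coord_deriv_def Dc_def[symmetric]
    using e by (intro thick_frechet_derivative[OF thick_Dc[OF c pD] _ p(3) pD ext_differentiable(1)[OF e p(3)]])
      (auto simp: ext_def)
qed

lemma cov_deriv_scalar: "cov_deriv g E (scalar N) c p [i] = coord_deriv E c i N p"
  by (simp add: cov_deriv_def scalar_def)

text \<open>The one-sided derivative of \<open>N\<close> is again a function on the end with a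
  differentiable extension, namely \<open>pd j e\<close>, so thickness can be used a second
  time.\<close>

lemma cov_deriv2_ext:
  assumes c: "c \<in> A" and e: "ext c U e" and p: "p \<in> fst c" "p \<in> E" "snd c p \<in> U"
  shows "cov_deriv g E (cov_deriv g E (scalar N)) c p [i, j] = hess (Gc c) e (snd c p) $ i $ j"
proof -
  define x where "x = snd c p"
  have pD: "x \<in> Dc c" using p by (auto simp: Dc_def x_def)
  have pM: "p \<in> M" using p E_M by auto
  have "coord_deriv E c i (\<lambda>q. cov_deriv g E (scalar N) c q [j]) p = pd i (pd j e) x"
    unfolding cov_deriv_scalar coord_deriv_def[of E c i] Dc_def[symmetric] x_def[symmetric]
  proof (rule thick_frechet_derivative[OF thick_Dc[OF c pD], where U = U and e = "pd j e" and f = "coord_deriv E c j N \<circ> cinv c"])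
    show "open U" "x \<in> U" "x \<in> Dc c" "pd j e differentiable (at x)"
      using e p pD ext_differentiable(2)[OF e p(3)] by (auto simp: ext_def x_def)
    show "(coord_deriv E c j N \<circ> cinv c) y = pd j e y" if y: "y \<in> Dc c \<inter> U" for y
      using y coord_deriv_ext[OF c e, of "cinv c y" j] cinv_Dc[OF c, of y] by simp
  qed
  moreover have "(\<Sum>l\<in>UNIV. christoffel g c p l i j * pd l e x)
      = (\<Sum>m\<in>UNIV. chr_low (Gc c) x m i j * rgrad (Gc c) e x $ m)"
  proof -
    have "(\<Sum>l\<in>UNIV. christoffel g c p l i j * pd l e x)
        = (\<Sum>l\<in>UNIV. \<Sum>m\<in>UNIV. chr_low (Gc c) x m i j * (matrix_inv (g c p) $ m $ l * pd l e x))"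
      unfolding christoffel_eq[OF c p(1) pM] x_def[symmetric] sum_distrib_right
      by (intro sum.cong refl) (simp add: matrix_inv_symmetric[OF posdef_g[OF c p(1) pM], of _ m for m] ac_simps)
    also have "\<dots> = (\<Sum>m\<in>UNIV. chr_low (Gc c) x m i j * (\<Sum>l\<in>UNIV. matrix_inv (g c p) $ m $ l * pd l e x))"
      by (subst sum.swap) (simp add: sum_distrib_left)
    finally show ?thesis using c p by (simp add: rgrad_def matrix_vector_mult_def x_def)
  qed
  ultimately show ?thesis
    by (simp add: cov_deriv_def[of g E "cov_deriv g E (scalar N)"] cov_deriv_scalar coord_deriv_ext[OF c e p] hess_def x_def)
qed

text \<open>The extensions in two charts match on the end only. Thickness promotes this to equality
  of first derivatives at all points of the end near \<open>x\<close>, and one more use of it gives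
  the second derivatives at \<open>x\<close>, as \<open>hess_transform\<close> requires.\<close>

lemma ext_transform:
  assumes c: "c \<in> A" "d \<in> A" and e: "ext c U e" "ext d U' e'"
    and p: "p \<in> fst c" "p \<in> fst d" "p \<in> E" "snd c p \<in> U" "snd d p \<in> U'"
  defines "J \<equiv> (\<chi> k i. pd i (\<lambda>y. transition c d y $ k) (snd c p)) :: real^'n^'n"
  shows "grad e (snd c p) = transpose J *v grad e' (snd d p)"
    and "hess (Gc c) e (snd c p) = transpose J ** hess (Gc d) e' (snd d p) ** J"
proof -
  define x where "x = snd c p"
  have pM: "p \<in> M" using p E_M by auto
  have x: "x \<in> overlap c d" "x \<in> Dc c" using p pM by (auto simp: overlap_def x_def Dc_def)
  have tx: "transition c d x = snd d p" using p c by (simp add: transition_def x_def)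
  have ct: "continuous_on (overlap c d) (transition c d)"
    using continuous_on_vec_lambda[of "overlap c d" "\<lambda>k y. transition c d y $ k"]
      C1_on_continuous[OF C2_on_C1[OF C2_transition[OF c]]] by simp
  define W where "W = (overlap c d \<inter> transition c d -` U') \<inter> U"
  have oW: "open W" unfolding W_def
    using ct open_overlap[OF c] e by (auto simp: ext_def intro: continuous_open_preimage)
  have xW: "x \<in> W" using x p tx by (auto simp: W_def x_def)
  have WU: "y \<in> overlap c d" "transition c d y \<in> U'" "y \<in> U" if "y \<in> W" for y using that by (auto simp: W_def)
  have td: "(\<lambda>y. transition c d y $ k) differentiable (at y)" if "y \<in> W" for y k
    using differentiable_transition[OF c WU(1)[OF that]] .
  have e'd: "e' differentiable (at (transition c d y))" "pd k e' differentiable (at (transition c d y))" if "y \<in> W" for y k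
    using ext_differentiable[OF e(2) WU(2)[OF that]] by auto
  \<comment> \<open>On the end both extensions are the values of \<open>N\<close> at the same point;
    outside it nothing is claimed.\<close>
  have agree: "e y = e' (transition c d y)" if y: "y \<in> Dc c \<inter> W" for y
  proof -
    have q: "cinv d (transition c d y) = cinv c y" using transition_Om[OF c WU(1)] y by auto
    have "transition c d y \<in> Dc d"
      using cinv_Dc[OF c(1), of y] y cinv_overlap[OF c(1) WU(1), of y] by (auto simp: Dc_def transition_def)
    then show ?thesis using e y WU q by (auto simp: ext_def)
  qed
  have first: "pd i e y = (\<Sum>k\<in>UNIV. pd i (\<lambda>y. transition c d y $ k) y * pd k e' (transition c d y))" if y: "y \<in> Dc c \<inter> W" for i y
  proof -
    have "pd i e y = pd i (\<lambda>y. e' (transition c d y)) y"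
      using y agree ext_differentiable(1)[OF e(1) WU(3)] GDERIV_imp_differentiable[OF GDERIV_chain[of e' "transition c d" y, OF e'd(1) td]]
      by (intro thick_grad_unique[OF thick_Dc[OF c(1)] oW]) auto
    also have "\<dots> = (\<Sum>k\<in>UNIV. pd i (\<lambda>y. transition c d y $ k) y * pd k e' (transition c d y))"
      using y e'd td by (intro pd_chain) auto
    finally show ?thesis .
  qed
  have ce: "(\<lambda>y. pd k e' (transition c d y)) differentiable (at x)" for k
    using GDERIV_imp_differentiable[OF GDERIV_chain[of "pd k e'" "transition c d" x, OF e'd(2)[OF xW] td[OF xW]]] .
  have tdd: "pd j (\<lambda>y. transition c d y $ k) differentiable (at x)" for j k
    using C1_on_differentiable[OF C2_on_pd[OF C2_transition[OF c]] x(1)] .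
  have second: "pd i (pd j e) x = (\<Sum>k\<in>UNIV. pd i (pd j (\<lambda>y. transition c d y $ k)) x * pd k e' (transition c d x))
        + (\<Sum>k\<in>UNIV. \<Sum>l\<in>UNIV. J $ k $ i * J $ l $ j * pd k (pd l e') (transition c d x))" for i j
  proof -
    have "pd i (pd j e) x = pd i (\<lambda>y. \<Sum>k\<in>UNIV. pd j (\<lambda>y. transition c d y $ k) y * pd k e' (transition c d y)) x"
      using xW x first ext_differentiable(2)[OF e(1) WU(3)[OF xW]] ce tdd
      \<comment> \<open>The identity \<open>first\<close>, valid on the end, is now the agreement of
        two differentiable functions on a thick set.\<close>
      by (intro thick_grad_unique[OF thick_Dc[OF c(1)] oW]) (auto intro!: derivative_intros)
    also have "\<dots> = (\<Sum>k\<in>UNIV. pd i (pd j (\<lambda>y. transition c d y $ k)) x * pd k e' (transition c d x)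
       + pd j (\<lambda>y. transition c d y $ k) x * pd i (\<lambda>y. pd k e' (transition c d y)) x)"
      using ce tdd by (subst pd_sum) (auto intro!: derivative_intros simp: pd_mult)
    also have "\<dots> = (\<Sum>k\<in>UNIV. pd i (pd j (\<lambda>y. transition c d y $ k)) x * pd k e' (transition c d x))
       + (\<Sum>l\<in>UNIV. \<Sum>k\<in>UNIV. J $ k $ i * J $ l $ j * pd k (pd l e') (transition c d x))"
      by (simp add: sum.distrib pd_chain[of "pd _ e'" "transition c d" x, OF e'd(2)[OF xW] td[OF xW]]
          sum_distrib_left J_def x_def[symmetric] ac_simps)
    also have "(\<Sum>l\<in>UNIV. \<Sum>k\<in>UNIV. J $ k $ i * J $ l $ j * pd k (pd l e') (transition c d x))
       = (\<Sum>k\<in>UNIV. \<Sum>l\<in>UNIV. J $ k $ i * J $ l $ j * pd k (pd l e') (transition c d x))" by (rule sum.swap)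
    finally show ?thesis .
  qed
  show "grad e (snd c p) = transpose J *v grad e' (snd d p)"
    unfolding x_def[symmetric] tx[symmetric]
    using first[of x] x xW by (simp add: vec_eq_iff matrix_vector_mult_def transpose_def J_def x_def)
  have "hess (Gc c) e x = transpose J ** hess (Gc d) e' (transition c d x) ** J"
    unfolding J_def x_def[symmetric]
  proof (rule hess_transform[where \<psi> = "transition c d" and U = "overlap c d"])
    show "open (overlap c d)" "x \<in> overlap c d" using open_overlap[OF c] x by auto
    show "C2_on (overlap c d) (\<lambda>y. transition c d y $ k)" for k by (rule C2_transition[OF c])
    have tO: "transition c d x \<in> Om d" using transition_Om[OF c x(1)] by auto
    show "(\<lambda>z. Gc d z $ k $ l) differentiable (at (transition c d x))" for k l
      using C1_on_differentiable[OF C1_on_metric[OF metric_Gc[OF c(2)]] tO] .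
    show "posdef (Gc c x)" "posdef (Gc d (transition c d x))"
      using posdef_g[OF c(1) p(1) pM] posdef_g[OF c(2) p(2) pM] p c unfolding tx by (auto simp: x_def)
    show "pd s (\<lambda>z. Gc d z $ k $ l) (transition c d x) = pd s (\<lambda>z. Gc d z $ l $ k) (transition c d x)" for k l s
      by (rule pd_metric_symmetric[OF metric_Gc[OF c(2)] tO])
    show "Gc c y = transpose (\<chi> k i. pd i (\<lambda>y. transition c d y $ k) y) ** Gc d (transition c d y) ** (\<chi> k i. pd i (\<lambda>y. transition c d y $ k) y)"
      if "y \<in> overlap c d" for y by (rule metric_transform[OF c that])
    show "pd i e x = (\<Sum>k\<in>UNIV. pd i (\<lambda>y. transition c d y $ k) x * pd k e' (transition c d x))" for i
      using first[of x] x xW by auto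
    show "pd i (pd j e) x = (\<Sum>k\<in>UNIV. pd i (pd j (\<lambda>y. transition c d y $ k)) x * pd k e' (transition c d x))
        + (\<Sum>k\<in>UNIV. \<Sum>l\<in>UNIV. (\<chi> k i. pd i (\<lambda>y. transition c d y $ k) x) $ k $ i *
           (\<chi> k i. pd i (\<lambda>y. transition c d y $ k) x) $ l $ j * pd k (pd l e') (transition c d x))" for i j
      using second[of i j] by (simp add: J_def x_def)
  qed
  then show "hess (Gc c) e (snd c p) = transpose J ** hess (Gc d) e' (snd d p) ** J" by (simp add: tx x_def[symmetric])
qed

definition V2 :: "'a \<Rightarrow> real" where "V2 p = (tensor_norm A g 1 (cov_deriv g E (scalar N)) p)\<^sup>2"
definition T2 :: "'a \<Rightarrow> real" where "T2 p = (tensor_norm A g 2 (T_op g E N) p)\<^sup>2"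

text \<open>\<open>tensor_norm\<close> evaluates at \<open>p\<close> in the chart chosen by
  \<open>chart_at\<close>, which can jump from point to point. The tensor transformation laws
  replace it by one fixed chart, as is needed for continuity and for integration.\<close>

lemma V2_ext:
  assumes d: "d \<in> A" and e': "ext d U' e'" and p: "p \<in> fst d" "p \<in> E" "snd d p \<in> U'"
  shows "V2 p = norm2_vec (g d p) (grad e' (snd d p))"
    and "T2 p = norm2_mat (g d p) (hess (Gc d) e' (snd d p) - N p *\<^sub>R g d p)"
proof -
  define c where "c = chart_at A p"
  have pM: "p \<in> M" using p E_M by auto
  have c: "c \<in> A" "p \<in> fst c" using chart_at_mem[of p] pM M_subset by (auto simp: c_def)
  have pD: "snd c p \<in> Dc c" using p c by (auto simp: Dc_def)
  obtain U e where e: "snd c p \<in> U" "ext c U e" using ext_exists[OF c(1) pD] by blast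
  define J :: "real^'n^'n" where "J = (\<chi> k i. pd i (\<lambda>y. transition c d y $ k) (snd c p))"
  note tr = ext_transform[OF c(1) d e(2) e' c(2) p(1,2) e(1) p(3), folded J_def]
  have pos: "posdef (g c p)" "posdef (g d p)" using posdef_g c d p pM by auto
  have "snd c p \<in> overlap c d" using c p pM by (auto simp: overlap_def)
  from metric_transform[OF c(1) d this, folded J_def]
  have gJ: "g c p = transpose J ** g d p ** J" using c d p by (simp add: transition_def)
  have "V2 p = norm2_vec (g c p) (grad e (snd c p))"
    unfolding V2_def using tensor_norm_1[of g A p] pos(1)
    by (simp add: c_def[symmetric] cov_deriv_scalar coord_deriv_ext[OF c(1) e(2) c(2) p(2) e(1)] grad_def)
  then show "V2 p = norm2_vec (g d p) (grad e' (snd d p))"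
    unfolding tr(1) norm2_vec_transform[OF pos gJ] .
  have "T2 p = norm2_mat (g c p) (hess (Gc c) e (snd c p) - N p *\<^sub>R g c p)"
  proof -
    have "(\<chi> i j. T_op g E N c p [i, j]) = hess (Gc c) e (snd c p) - N p *\<^sub>R g c p"
      by (simp add: T_op_def cov_deriv2_ext[OF c(1) e(2) c(2) p(2) e(1)] vec_eq_iff)
    then show ?thesis
      unfolding T2_def using tensor_norm_2[of g A p] pos(1) by (simp add: c_def[symmetric])
  qed
  also have "hess (Gc c) e (snd c p) - N p *\<^sub>R g c p = transpose J ** (hess (Gc d) e' (snd d p) - N p *\<^sub>R g d p) ** J"
  proof -
    have "transpose J ** (hess (Gc d) e' (snd d p) - N p *\<^sub>R g d p)
       = transpose J ** hess (Gc d) e' (snd d p) - N p *\<^sub>R (transpose J ** g d p)"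
      by (simp add: matrix_mult_diff_right matrix_mult_scaleR_right)
    moreover have "(P - N p *\<^sub>R Q) ** J = P ** J - N p *\<^sub>R (Q ** J)" for P Q :: "real^'n^'n"
      by (simp add: matrix_matrix_mult_def vec_eq_iff left_diff_distrib sum_subtractf sum_distrib_left mult.assoc)
    ultimately show ?thesis by (simp add: tr(2) gJ)
  qed
  finally show "T2 p = norm2_mat (g d p) (hess (Gc d) e' (snd d p) - N p *\<^sub>R g d p)"
    unfolding norm2_mat_transform[OF pos gJ] .
qed

lemma V2_nonneg: "0 \<le> V2 p" and T2_nonneg: "0 \<le> T2 p"
  by (simp_all add: V2_def T2_def)

text \<open>The Hessian is \<open>T + N g\<close>, and \<open>g\<close> has squared norm
  \<open>CARD('n)\<close>. Thus the second-order part of the Sobolev norm needs no separate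
  estimate.\<close>

lemma hess_norm_le:
  assumes "p \<in> E"
  shows "(tensor_norm A g 2 (cov_deriv g E (cov_deriv g E (scalar N))) p)\<^sup>2 \<le> 2 * T2 p + 2 * real CARD('n) * (N p)\<^sup>2"
proof -
  define c where "c = chart_at A p"
  have pM: "p \<in> M" using assms E_M by auto
  have c: "c \<in> A" "p \<in> fst c" using chart_at_mem[of p] pM M_subset by (auto simp: c_def)
  have pos: "posdef (g c p)" using posdef_g c pM by auto
  define H T :: "real^'n^'n" where "H = (\<chi> i j. cov_deriv g E (cov_deriv g E (scalar N)) c p [i, j])"
    and "T = (\<chi> i j. T_op g E N c p [i, j])"
  have HT: "H = T + N p *\<^sub>R g c p" by (simp add: vec_eq_iff H_def T_def T_op_def)
  obtain B :: "real^'n^'n" where B: "transpose B ** g c p ** B = mat 1" using posdef_frame[OF pos] by blast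
  have "transpose B ** H ** B = transpose B ** T ** B + N p *\<^sub>R mat 1"
    unfolding HT by (simp add: matrix_add_ldistrib matrix_mult_add_left matrix_mult_scaleR_right matrix_mult_scaleR_left B)
  then have "(norm (transpose B ** H ** B))\<^sup>2 \<le> (norm (transpose B ** T ** B) + norm (N p *\<^sub>R (mat 1 :: real^'n^'n)))\<^sup>2"
    by (simp add: norm_triangle_ineq power_mono del: norm_scaleR)
  also have "\<dots> \<le> 2 * (norm (transpose B ** T ** B))\<^sup>2 + 2 * (norm (N p *\<^sub>R (mat 1 :: real^'n^'n)))\<^sup>2"
    using sum_squares_bound[of "norm (transpose B ** T ** B)" "norm (N p *\<^sub>R (mat 1 :: real^'n^'n))"]
    by (simp add: power2_sum del: norm_scaleR)
  also have "(norm (N p *\<^sub>R (mat 1 :: real^'n^'n)))\<^sup>2 = real CARD('n) * (N p)\<^sup>2"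
    using trace_mult_transpose[of "mat 1 :: real^'n^'n"] by (simp add: transpose_mat trace_I power_mult_distrib)
  finally have "norm2_mat (g c p) H \<le> 2 * norm2_mat (g c p) T + 2 * real CARD('n) * (N p)\<^sup>2"
    by (simp add: frame_norm2_mat[OF B])
  then show ?thesis
    unfolding T2_def using tensor_norm_2[of g A p] pos by (simp add: c_def[symmetric] H_def T_def)
qed

lemma continuous_N: "continuous_map (subtopology X E) euclidean N"
proof (rule continuous_map_charts)
  show "E \<subseteq> topspace X" using E_M M_subset by auto
  show "continuous_on (snd c ` (fst c \<inter> E)) (N \<circ> cinv c)" if "c \<in> A" for c
    using N_test that by (intro smooth_on_continuous)
      (auto simp: smooth_compact_support_def smooth_fun_on_def smooth_in_chart_def)
qed

text \<open>Continuity is local and relative to the end, so it suffices that near each point the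
  formula in terms of an extension is continuous.\<close>

lemma continuous_V2_T2:
  "continuous_map (subtopology X E) euclidean V2" "continuous_map (subtopology X E) euclidean T2"
proof -
  have "continuous_on (Dc c) (V2 \<circ> cinv c) \<and> continuous_on (Dc c) (T2 \<circ> cinv c)" if c: "c \<in> A" for c
  proof -
    have "\<exists>U v t. open U \<and> x \<in> U \<and> continuous_on U v \<and> continuous_on U t \<and>
        (\<forall>y\<in>Dc c \<inter> U. v y = (V2 \<circ> cinv c) y) \<and> (\<forall>y\<in>Dc c \<inter> U. t y = (T2 \<circ> cinv c) y)" if x: "x \<in> Dc c" for x
    proof -
      obtain U e where e: "x \<in> U" "ext c U e" using ext_exists[OF c x] by blast
      have U: "open U" "U \<subseteq> Om c" "C2_on U e" using e by (auto simp: ext_def)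
      have met: "C1_metric U (Gc c)"
        using metric_Gc[OF c] U C1_on_subset unfolding C1_metric_def by blast
      have cG: "continuous_on U (\<lambda>y. Gc c y $ i $ j)" for i j by (rule C1_on_continuous[OF C1_on_metric[OF met]])
      have dG: "det (Gc c y) \<noteq> 0" if "y \<in> U" for y using C1_metric_det[OF met that] by simp
      have ch: "continuous_on U (\<lambda>y. (hess (Gc c) e y - e y *\<^sub>R Gc c y) $ i $ j)" for i j
        using continuous_on_hess[OF met U(3), of i j] cG[of i j] C1_on_continuous[OF C2_on_C1[OF U(3)]]
        by (auto intro!: continuous_intros)
      show ?thesis
      proof (intro exI conjI ballI)
        show "open U" "x \<in> U" using U e by auto
        show "continuous_on U (\<lambda>y. norm2_vec (Gc c y) (grad e y))"
          by (rule continuous_on_norm2_vec[OF cG dG])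
             (use C1_on_continuous_pd[OF C2_on_C1[OF U(3)]] in auto)
        show "continuous_on U (\<lambda>y. norm2_mat (Gc c y) (hess (Gc c) e y - e y *\<^sub>R Gc c y))"
          by (rule continuous_on_norm2_mat[OF cG dG ch])
        fix y assume y: "y \<in> Dc c \<inter> U"
        then have q: "cinv c y \<in> fst c" "cinv c y \<in> E" "snd c (cinv c y) = y" using cinv_Dc[OF c] by auto
        have ey: "e y = N (cinv c y)" using e y by (auto simp: ext_def)
        show "norm2_vec (Gc c y) (grad e y) = (V2 \<circ> cinv c) y"
          "norm2_mat (Gc c y) (hess (Gc c) e y - e y *\<^sub>R Gc c y) = (T2 \<circ> cinv c) y"
          using V2_ext[OF c e(2) q(1,2)] q(3) y ey by auto
      qed
    qed
    then show ?thesis by (intro conjI continuous_on_local_extension) meson+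
  qed
  then show "continuous_map (subtopology X E) euclidean V2" "continuous_map (subtopology X E) euclidean T2"
    using continuous_map_charts[of E] E_M M_subset unfolding Dc_def by blast+
qed

section \<open>The support of the test function\<close>

definition K :: "'a set" where "K = subtopology X E closure_of {p \<in> E. N p \<noteq> 0}"

lemma compact_K: "compactin X K" "K \<subseteq> E"
proof -
  have "compactin (subtopology X E) K" using N_test by (auto simp: smooth_compact_support_def K_def)
  then show "compactin X K" "K \<subseteq> E" by (auto simp: compactin_subtopology)
qed

lemma closed_K: "closedin X K"
  using compact_K(1) Hausdorff_X compactin_imp_closedin by blast

lemma N_outside_K: "p \<in> E \<Longrightarrow> p \<notin> K \<Longrightarrow> N p = 0"
  unfolding K_def using closure_of_subset[of "{p \<in> E. N p \<noteq> 0}" "subtopology X E"] E_M M_subset by auto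

text \<open>\<open>K\<close> is compact and hence closed, so off \<open>K\<close> the zero function
  is a legitimate local extension of \<open>N\<close>.\<close>

lemma outside_K:
  assumes "p \<in> E" "p \<notin> K" shows "V2 p = 0" "T2 p = 0"
proof -
  have pM: "p \<in> M" using assms E_M by auto
  obtain c where c: "c \<in> A" "p \<in> fst c" using charts_cover pM M_subset by blast
  define U where "U = snd c ` (fst c \<inter> (M - K))"
  have "openin X (M - K)" by (rule openin_diff[OF open_M closed_K])
  then have oU: "open U" unfolding U_def using c by (intro open_Om_inter) auto
  have ex: "ext c U (\<lambda>_. 0)"
    unfolding ext_def
  proof (intro conjI ballI)
    have "pd i (\<lambda>_. 0) = (\<lambda>_. 0)" for i :: 'n by (auto simp: pd_unique[OF GDERIV_const])
    then show "C2_on U (\<lambda>_. 0)" by (simp add: C2_on_def)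
    fix y assume "y \<in> Dc c \<inter> U"
    then show "0 = N (cinv c y)" using cinv_Dc[OF c(1), of y] N_outside_K[of "cinv c y"] c by (auto simp: U_def)
  qed (use oU in \<open>auto simp: U_def Om_def\<close>)
  have pU: "snd c p \<in> U" using assms pM c by (auto simp: U_def)
  have z: "grad (\<lambda>_. 0) x = 0" "pd i (pd j (\<lambda>_. 0)) x = 0" for x :: "real^'n" and i j
  proof -
    have "pd i (\<lambda>_. 0) = (\<lambda>_. 0)" for i :: 'n by (auto simp: pd_unique[OF GDERIV_const])
    then show "grad (\<lambda>_. 0) x = 0" "pd i (pd j (\<lambda>_. 0)) x = 0" by (auto simp: vec_eq_iff)
  qed
  show "V2 p = 0" using V2_ext(1)[OF c(1) ex c(2) assms(1) pU] by (simp add: z norm2_vec_def)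
  have "hess (Gc c) (\<lambda>_. 0) (snd c p) = 0" by (simp add: hess_def vec_eq_iff z rgrad_def)
  then show "T2 p = 0"
    using V2_ext(2)[OF c(1) ex c(2) assms(1) pU] N_outside_K[OF assms] by (simp add: norm2_mat_def trace_def)
qed

end

section \<open>Integration on the manifold\<close>

locale ah_measured = ah_manifold X A \<rho> h
  for X :: "'a topology" and A :: "('a, 'n::finite) chart set" and \<rho> h +
  fixes \<mu> :: "'a measure"
  assumes riem: "riemannian_measure X A M g \<mu>"
begin

lemma space_mu [simp]: "space \<mu> = M" and sets_mu: "sets \<mu> = sigma_sets M {V. openin (subtopology X M) V}"
  using riem by (simp_all add: riemannian_measure_def)

lemma emeasure_chart:
  "c \<in> A \<Longrightarrow> B \<in> sets \<mu> \<Longrightarrow> B \<subseteq> fst c \<Longrightarrow>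
    emeasure \<mu> B = (\<integral>\<^sup>+x. ennreal (sqrt (det (Gc c x))) * indicator (snd c ` B) x \<partial>lborel)"
  using riem by (simp add: riemannian_measure_def)

lemma open_in_sets:
  assumes "openin X V" shows "V \<inter> M \<in> sets \<mu>"
proof -
  have "openin (subtopology X M) (V \<inter> M)" using assms by (auto simp: openin_subtopology)
  then show ?thesis by (auto simp: sets_mu)
qed

lemma M_in_sets [simp]: "M \<in> sets \<mu>"
  using sets.top[of \<mu>] by simp

lemma continuous_measurable:
  assumes D: "D \<in> sets \<mu>" and f: "continuous_map (subtopology X D) euclidean f"
  shows "(\<lambda>p. indicator D p * f p :: real) \<in> borel_measurable \<mu>"
proof -
  have DM: "D \<subseteq> M" using sets.sets_into_space[OF D] by simp
  have "f \<in> borel_measurable (restrict_space \<mu> D)"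
  proof (rule borel_measurableI)
    fix S :: "real set" assume "open S"
    then have "openin (subtopology X D) {p \<in> topspace (subtopology X D). f p \<in> S}"
      using f unfolding continuous_map_def by simp
    then obtain V where V: "openin X V" "{p \<in> topspace (subtopology X D). f p \<in> S} = V \<inter> D"
      unfolding openin_subtopology by auto
    have "topspace (subtopology X D) = D" using DM M_subset by auto
    then have "f -` S \<inter> space (restrict_space \<mu> D) = D \<inter> (V \<inter> M)"
      using V(2) DM by (auto simp: space_restrict_space)
    then show "f -` S \<inter> space (restrict_space \<mu> D) \<in> sets (restrict_space \<mu> D)"
      using open_in_sets[OF V(1)] D by (auto simp: sets_restrict_space)
  qed
  then show ?thesis
    using D by (subst (asm) borel_measurable_restrict_space_iff) (auto simp: mult.commute)
qed

lemma sublevel_sets: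
  "{p \<in> M. \<rho> p \<le> a} \<in> sets \<mu>" "{p \<in> M. \<rho> p < a} \<in> sets \<mu>" "{p \<in> M. \<rho> p = a} \<in> sets \<mu>"
proof -
  have "continuous_map (subtopology X M) euclidean \<rho>"
    using continuous_rho continuous_map_from_subtopology by blast
  from continuous_measurable[OF M_in_sets this]
  have m: "(\<lambda>p. indicator M p * \<rho> p) \<in> borel_measurable \<mu>" .
  have *: "{p \<in> M. \<rho> p \<in> S} = (\<lambda>p. indicator M p * \<rho> p) -` S \<inter> space \<mu>" for S by auto
  have "{p \<in> M. \<rho> p \<in> S} \<in> sets \<mu>" if "S \<in> sets borel" for S
    unfolding * by (rule measurable_sets[OF m that])
  from this[of "{..a}"] this[of "{..<a}"] this[of "{a}"]
  show "{p \<in> M. \<rho> p \<le> a} \<in> sets \<mu>" "{p \<in> M. \<rho> p < a} \<in> sets \<mu>" "{p \<in> M. \<rho> p = a} \<in> sets \<mu>" by auto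
qed

text \<open>On a chart domain \<mu> and the image of Lebesgue measure with density
  \<open>sqrt (det g)\<close> agree on every measurable set, by the definition of a Riemannian
  measure; integrals then transfer by general theory.\<close>

lemma transfer:
  assumes c: "c \<in> A" and F: "F \<in> borel_measurable \<mu>"
  shows "(\<integral>p. indicator (fst c \<inter> M) p * F p \<partial>\<mu>)
      = (\<integral>x. indicator (Om c) x * (sqrt (det (Gc c x)) * F (cinv c x)) \<partial>lborel :: real)"
    and "integrable \<mu> (\<lambda>p. indicator (fst c \<inter> M) p * F p) \<longleftrightarrow>
      integrable lborel (\<lambda>x. indicator (Om c) x * (sqrt (det (Gc c x)) * F (cinv c x)))"
proof -
  define L where "L = restrict_space lborel (Om c)"
  define Q where "Q = restrict_space \<mu> (fst c \<inter> M)"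
  define D where "D x = sqrt (det (Gc c x))" for x
  have O: "fst c \<inter> M \<in> sets \<mu>" by (rule open_in_sets[OF open_domain[OF c]])
  have oO: "Om c \<in> sets lborel" using open_Om[OF c] by simp
  have spL: "space L = Om c" by (simp add: L_def space_restrict_space)
  have pre: "cinv c -` B \<inter> Om c = snd c ` (fst c \<inter> B)" if "B \<subseteq> M" for B
    using that c by (auto simp: Om_def image_iff)
  have "cinv c \<in> measurable L \<mu>"
  proof (rule measurable_sigma_sets[OF sets_mu])
    show "cinv c \<in> space L \<rightarrow> M" using cinv_Om[OF c] by (auto simp: spL)
    fix V assume "V \<in> {V. openin (subtopology X M) V}"
    then have V': "openin (subtopology X M) V" by simp
    have V: "openin X V" "V \<subseteq> M"
      using openin_trans_full[OF V' open_M] openin_imp_subset[OF V'] by auto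
    have "open (snd c ` (fst c \<inter> V))" by (rule open_Om_inter[OF c V])
    moreover have "snd c ` (fst c \<inter> V) \<subseteq> Om c" using V(2) by (auto simp: Om_def)
    ultimately have "snd c ` (fst c \<inter> V) \<in> sets L"
      using oO by (simp add: L_def sets_restrict_space_iff)
    moreover have "cinv c -` V \<inter> space L = snd c ` (fst c \<inter> V)" unfolding spL by (rule pre[OF V(2)])
    ultimately show "cinv c -` V \<inter> space L \<in> sets L" by simp
  qed (auto dest: openin_imp_subset)
  then have psi: "cinv c \<in> measurable L Q"
    unfolding Q_def using cinv_Om[OF c] by (intro measurable_restrict_space2) (auto simp: spL)
  have "continuous_on (Om c) D"
    unfolding D_def by (rule C1_on_continuous[OF C1_on_sqrt_det[OF metric_Gc[OF c]]])
  then have Dm: "D \<in> borel_measurable L"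
    unfolding L_def using borel_measurable_continuous_on_restrict[of "Om c" D]
    by (simp cong: measurable_cong_sets sets_restrict_space_cong)
  have D0: "D x \<ge> 0" if "x \<in> Om c" for x
    using C1_metric_det[OF metric_Gc[OF c] that] by (simp add: D_def)
  have eq: "Q = distr (density L D) Q (cinv c)"
  proof (rule measure_eqI)
    fix B assume B: "B \<in> sets Q"
    then have B': "B \<in> sets \<mu>" "B \<subseteq> fst c \<inter> M" using O by (auto simp: Q_def sets_restrict_space_iff)
    have m: "cinv c -` B \<inter> space L \<in> sets L" by (rule measurable_sets[OF psi B])
    have im: "cinv c -` B \<inter> Om c = snd c ` B" using pre[of B] B' by (simp add: Int_absorb1)
    have "emeasure (distr (density L D) Q (cinv c)) B = emeasure (density L D) (cinv c -` B \<inter> space L)"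
      using psi B by (subst emeasure_distr) auto
    also have "\<dots> = (\<integral>\<^sup>+x. ennreal (D x) * indicator (snd c ` B) x \<partial>L)"
      using m Dm by (subst emeasure_density) (auto simp: spL im)
    also have "\<dots> = (\<integral>\<^sup>+x. ennreal (D x) * indicator (snd c ` B) x * indicator (Om c) x \<partial>lborel)"
      unfolding L_def using oO by (subst nn_integral_restrict_space) auto
    also have "\<dots> = (\<integral>\<^sup>+x. ennreal (D x) * indicator (snd c ` B) x \<partial>lborel)"
      using B'(2) by (intro nn_integral_cong) (auto simp: indicator_def Om_def)
    also have "\<dots> = emeasure \<mu> B" unfolding D_def using emeasure_chart[OF c B'(1)] B'(2) by auto
    also have "\<dots> = emeasure Q B" unfolding Q_def using O B'(2) by (subst emeasure_restrict_space) auto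
    finally show "emeasure Q B = emeasure (distr (density L D) Q (cinv c)) B" by simp
  qed simp
  have FQ: "F \<in> borel_measurable Q" unfolding Q_def using F by (rule measurable_restrict_space1)
  have FL: "(\<lambda>x. F (cinv c x)) \<in> borel_measurable L" using measurable_compose[OF psi FQ] .
  have AED: "AE x in L. 0 \<le> D x" using D0 by (intro AE_I2) (simp add: spL)
  have "(\<integral>p. indicator (fst c \<inter> M) p * F p \<partial>\<mu>) = integral\<^sup>L Q F"
    unfolding Q_def using O by (subst integral_restrict_space) auto
  also have "\<dots> = (\<integral>p. F p \<partial>distr (density L D) Q (cinv c))" by (simp add: eq[symmetric])
  also have "\<dots> = (\<integral>x. F (cinv c x) \<partial>density L D)" using psi FQ by (subst integral_distr) auto
  also have "\<dots> = (\<integral>x. D x * F (cinv c x) \<partial>L)" using FL Dm AED by (subst integral_density) auto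
  also have "\<dots> = (\<integral>x. indicator (Om c) x * (D x * F (cinv c x)) \<partial>lborel)"
    unfolding L_def using oO by (subst integral_restrict_space) auto
  finally show "(\<integral>p. indicator (fst c \<inter> M) p * F p \<partial>\<mu>)
      = (\<integral>x. indicator (Om c) x * (sqrt (det (Gc c x)) * F (cinv c x)) \<partial>lborel :: real)" by (simp add: D_def)
  have "integrable \<mu> (\<lambda>p. indicator (fst c \<inter> M) p * F p) \<longleftrightarrow> integrable Q F"
    unfolding Q_def using O by (subst integrable_restrict_space) auto
  also have "\<dots> \<longleftrightarrow> integrable (distr (density L D) Q (cinv c)) F" by (simp add: eq[symmetric])
  also have "\<dots> \<longleftrightarrow> integrable (density L D) (\<lambda>x. F (cinv c x))"
    using psi FQ by (subst integrable_distr_eq) auto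
  also have "\<dots> \<longleftrightarrow> integrable L (\<lambda>x. D x * F (cinv c x))" using FL Dm AED by (subst integrable_density) auto
  also have "\<dots> \<longleftrightarrow> integrable lborel (\<lambda>x. indicator (Om c) x * (D x * F (cinv c x)))"
    unfolding L_def using oO by (subst integrable_restrict_space) auto
  finally show "integrable \<mu> (\<lambda>p. indicator (fst c \<inter> M) p * F p) \<longleftrightarrow>
      integrable lborel (\<lambda>x. indicator (Om c) x * (sqrt (det (Gc c x)) * F (cinv c x)))" by (simp add: D_def)
qed

text \<open>The density is bounded on a closed coordinate ball inside the open chart image.\<close>

lemma locally_finite:
  assumes p: "p \<in> M"
  obtains V where "openin X V" "p \<in> V" "V \<subseteq> M" "emeasure \<mu> V < \<infinity>"
proof -
  obtain c where c: "c \<in> A" "p \<in> fst c" using charts_cover p M_subset by blast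
  have x: "snd c p \<in> Om c" using snd_Om c p by auto
  obtain \<epsilon> where \<epsilon>: "\<epsilon> > 0" "cball (snd c p) \<epsilon> \<subseteq> Om c" using open_Om[OF c(1)] x by (meson open_contains_cball)
  define B where "B = cball (snd c p) \<epsilon>"
  define V where "V = {q \<in> fst c. snd c q \<in> ball (snd c p) \<epsilon>} \<inter> M"
  have V: "openin X V" "p \<in> V" "V \<subseteq> M"
    using preimage_openin[OF c(1), of "ball (snd c p) \<epsilon>"] open_M c p \<epsilon> by (auto simp: V_def)
  have "continuous_on B (\<lambda>x. sqrt (det (Gc c x)))"
    using C1_on_continuous[OF C1_on_sqrt_det[OF metric_Gc[OF c(1)]]] \<epsilon> by (auto simp: B_def intro: continuous_on_subset)
  then have "bounded ((\<lambda>x. sqrt (det (Gc c x))) ` B)"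
    by (intro compact_imp_bounded compact_continuous_image) (auto simp: B_def)
  then obtain k where k: "\<And>x. x \<in> B \<Longrightarrow> \<bar>sqrt (det (Gc c x))\<bar> \<le> k" unfolding bounded_iff by auto
  have "emeasure \<mu> V = (\<integral>\<^sup>+x. ennreal (sqrt (det (Gc c x))) * indicator (snd c ` V) x \<partial>lborel)"
    using open_in_sets[OF V(1)] V(3) by (intro emeasure_chart[OF c(1)]) (auto simp: V_def Int_absorb2)
  also have "\<dots> \<le> (\<integral>\<^sup>+x. ennreal k * indicator B x \<partial>lborel)"
  proof (intro nn_integral_mono)
    fix x
    have "snd c ` V \<subseteq> B" by (auto simp: V_def B_def)
    then show "ennreal (sqrt (det (Gc c x))) * indicator (snd c ` V) x \<le> ennreal k * indicator B x"
      using k[of x] by (auto simp: indicator_def intro!: ennreal_leI)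
  qed
  also have "\<dots> = ennreal k * emeasure lborel B" by (subst nn_integral_cmult_indicator) (auto simp: B_def)
  also have "\<dots> < \<infinity>" using emeasure_bounded_finite[of B] by (simp add: ennreal_mult_less_top B_def)
  finally show ?thesis using that V by blast
qed

text \<open>Finitely many neighbourhoods of finite measure cover \<open>K\<close>. This is what
  makes all weighted norms of a test function finite integrals.\<close>

lemma compact_finite_measure:
  assumes K: "compactin X K" "K \<subseteq> M"
  shows "K \<in> sets \<mu>" "emeasure \<mu> K < \<infinity>"
proof -
  have cl: "closedin X K" using K Hausdorff_X compactin_imp_closedin by blast
  have "M - ((topspace X - K) \<inter> M) = K" using K M_subset by auto
  moreover have "M - ((topspace X - K) \<inter> M) \<in> sets \<mu>"
    using cl by (intro sets.Diff open_in_sets M_in_sets) auto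
  ultimately show Ks: "K \<in> sets \<mu>" by simp
  have "\<exists>V. openin X V \<and> p \<in> V \<and> V \<subseteq> M \<and> emeasure \<mu> V < \<infinity>" if "p \<in> K" for p
  proof -
    have "p \<in> M" using that K(2) by blast
    then obtain V where "openin X V" "p \<in> V" "V \<subseteq> M" "emeasure \<mu> V < \<infinity>" by (rule locally_finite)
    then show ?thesis by blast
  qed
  then obtain V where V: "\<And>p. p \<in> K \<Longrightarrow> openin X (V p) \<and> p \<in> V p \<and> V p \<subseteq> M \<and> emeasure \<mu> (V p) < \<infinity>" by metis
  have "K \<subseteq> \<Union> (V ` K)" using V by blast
  moreover have "openin X W" if "W \<in> V ` K" for W using that V by blast
  ultimately obtain \<F> where \<F>: "finite \<F>" "\<F> \<subseteq> V ` K" "K \<subseteq> \<Union> \<F>"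
    using compactinD[OF K(1), of "V ` K"] by blast
  have Vs: "W \<in> sets \<mu>" "emeasure \<mu> W < \<infinity>" if W0: "W \<in> \<F>" for W
  proof -
    obtain p where "p \<in> K" "W = V p" using W0 \<F>(2) by blast
    then have W: "openin X W" "W \<subseteq> M" "emeasure \<mu> W < \<infinity>" using V by auto
    then show "W \<in> sets \<mu>" "emeasure \<mu> W < \<infinity>" using open_in_sets[OF W(1)] by (simp_all add: Int_absorb2)
  qed
  have "emeasure \<mu> K \<le> emeasure \<mu> (\<Union>W\<in>\<F>. W)" using \<F> Vs by (intro emeasure_mono) auto
  also have "\<dots> \<le> (\<Sum>W\<in>\<F>. emeasure \<mu> W)" using \<F> Vs by (intro emeasure_subadditive_finite) auto
  also have "\<dots> < \<infinity>" using Vs \<F>(1) by (simp add: ennreal_sum_less_top)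
  finally show "emeasure \<mu> K < \<infinity>" .
qed

lemma integrable_continuous_compact:
  assumes D: "D \<in> sets \<mu>" and f: "continuous_map (subtopology X D) euclidean f"
    and K: "compactin X K" "K \<subseteq> D" and supp: "\<And>p. p \<in> D \<Longrightarrow> p \<notin> K \<Longrightarrow> f p = 0"
  shows "integrable \<mu> (\<lambda>p. indicator D p * f p :: real)"
proof -
  have DM: "D \<subseteq> M" using sets.sets_into_space[OF D] by simp
  have Km: "K \<in> sets \<mu>" "emeasure \<mu> K < \<infinity>" using compact_finite_measure[OF K(1)] K(2) DM by auto
  have "compactin (subtopology X D) K" using K by (simp add: compactin_subtopology)
  then have "compactin euclidean (f ` K)" using f image_compactin by blast
  then have "bounded (f ` K)" by (simp add: compact_imp_bounded)
  then obtain k where k: "\<And>p. p \<in> K \<Longrightarrow> \<bar>f p\<bar> \<le> k" unfolding bounded_iff by auto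
  show ?thesis
  proof (rule Bochner_Integration.integrable_bound[of _ "\<lambda>p. k * indicator K p"])
    show "integrable \<mu> (\<lambda>p. k * indicator K p)" using Km by (intro integrable_mult_right integrable_real_indicator) auto
    show "(\<lambda>p. indicator D p * f p) \<in> borel_measurable \<mu>" by (rule continuous_measurable[OF D f])
    show "AE p in \<mu>. norm (indicator D p * f p) \<le> norm (k * indicator K p)"
    proof (rule AE_I2)
      fix p show "norm (indicator D p * f p) \<le> norm (k * indicator K p)"
        using k[of p] supp[of p] by (auto simp: indicator_def)
    qed
  qed
qed

end

section \<open>Patches covering the boundary at infinity\<close>

text \<open>Squaring removes the corner: at 0 the quotient is bounded by
  \<open>\<bar>h\<bar>\<close>. Bump functions and cutoffs need only one continuous derivative, so
  they can be built from this square.\<close>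

lemma DERIV_pos_part_sq: "((\<lambda>x. (max 0 x)\<^sup>2) has_real_derivative 2 * max 0 x) (at (x::real))"
proof -
  consider "x > 0" | "x < 0" | "x = 0" by linarith
  then show ?thesis
  proof cases
    case 1
    have "((\<lambda>x. x\<^sup>2) has_real_derivative 2 * max 0 x) (at x)"
      using 1 by (auto intro!: derivative_eq_intros)
    then show ?thesis by (rule has_field_derivative_transform_within_open[of _ _ _ "{0<..}"]) (use 1 in auto)
  next
    case 2
    have "((\<lambda>x. 0) has_real_derivative 2 * max 0 x) (at x)" using 2 by (auto intro!: derivative_eq_intros)
    then show ?thesis by (rule has_field_derivative_transform_within_open[of _ _ _ "{..<0}"]) (use 2 in auto)
  next
    case 3
    have "((\<lambda>h::real. (max 0 h)\<^sup>2 / h) \<longlongrightarrow> 0) (at 0)"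
    proof (rule Lim_null_comparison[where g = "\<lambda>h. \<bar>h\<bar>"])
      show "\<forall>\<^sub>F h in at 0. norm ((max 0 h)\<^sup>2 / h) \<le> \<bar>h\<bar>"
        by (rule always_eventually) (auto simp: max_def power2_eq_square)
      show "((\<lambda>h::real. \<bar>h\<bar>) \<longlongrightarrow> 0) (at 0)" by (rule tendsto_rabs_zero) (rule tendsto_ident_at)
    qed
    then show ?thesis using 3 by (simp add: DERIV_def)
  qed
qed

lemma GDERIV_nth: "GDERIV (\<lambda>x. x $ i) (x :: real^'n::finite) :> axis i 1"
  unfolding gderiv_def inner_axis by (auto intro!: bounded_linear_imp_has_derivative bounded_linear_vec_nth)

lemma C1_on_nth: "C1_on U (\<lambda>x::real^'n::finite. x $ i)"
  by (rule C1_onI[where F = "\<lambda>_. axis i 1"]) (simp_all add: GDERIV_nth)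

text \<open>Supported in the ball of radius \<open>d / 2\<close>. At distance \<open>d / 4\<close>
  the positive part equals \<open>3 * d\<^sup>2 / 16\<close>, whose inverse square is the
  normalising factor, so the bump is at least 1 on the smaller ball.\<close>

definition bump :: "real^'n::finite \<Rightarrow> real \<Rightarrow> real^'n \<Rightarrow> real" where
  "bump x0 d x = (16 / (3 * d\<^sup>2))\<^sup>2 * (max 0 (d\<^sup>2 / 4 - (x - x0) \<bullet> (x - x0)))\<^sup>2"

lemma C1_on_bump: "C1_on U (bump x0 d)"
proof -
  have "C1_on U (\<lambda>x. d\<^sup>2 / 4 - (x - x0) \<bullet> (x - x0))"
    unfolding inner_vec_def by (simp, intro C1_on_diff C1_on_sum C1_on_mult C1_on_nth C1_on_const)
  moreover have "continuous_on ((\<lambda>x. d\<^sup>2 / 4 - (x - x0) \<bullet> (x - x0)) ` U) (\<lambda>y. 2 * max 0 y)"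
    by (intro continuous_intros)
  ultimately have "C1_on U (\<lambda>x. (max 0 (d\<^sup>2 / 4 - (x - x0) \<bullet> (x - x0)))\<^sup>2)"
    by (rule C1_on_compose[of U _ "\<lambda>y. (max 0 y)\<^sup>2" "\<lambda>y. 2 * max 0 y", OF _ DERIV_pos_part_sq])
  then show ?thesis unfolding bump_def[abs_def] by (intro C1_on_mult C1_on_const)
qed

lemma bump_bounds:
  fixes x0 :: "real^'n::finite"
  shows "0 \<le> bump x0 d x" "bump x0 d x \<le> (16 / (3 * d\<^sup>2))\<^sup>2 * (d\<^sup>2 / 4)\<^sup>2"
proof -
  show "0 \<le> bump x0 d x" by (simp add: bump_def)
  have "max 0 (d\<^sup>2 / 4 - (x - x0) \<bullet> (x - x0)) \<le> d\<^sup>2 / 4" by (rule max.boundedI) auto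
  then show "bump x0 d x \<le> (16 / (3 * d\<^sup>2))\<^sup>2 * (d\<^sup>2 / 4)\<^sup>2"
    unfolding bump_def by (intro mult_left_mono power_mono) auto
qed

lemma bump_ge_1:
  assumes "d > 0" "x \<in> ball x0 (d / 4)" shows "bump x0 d x \<ge> 1"
proof -
  have "(x - x0) \<bullet> (x - x0) = (norm (x - x0))\<^sup>2" by (simp add: power2_norm_eq_inner)
  also have "\<dots> \<le> (d / 4)\<^sup>2" using assms by (intro power_mono) (auto simp: dist_norm norm_minus_commute)
  finally have "d\<^sup>2 / 4 - (x - x0) \<bullet> (x - x0) \<ge> 3 * d\<^sup>2 / 16" by (simp add: power2_eq_square)
  then have "(max 0 (d\<^sup>2 / 4 - (x - x0) \<bullet> (x - x0)))\<^sup>2 \<ge> (3 * d\<^sup>2 / 16)\<^sup>2"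
    by (intro power_mono max.coboundedI2) auto
  then have "bump x0 d x \<ge> (16 / (3 * d\<^sup>2))\<^sup>2 * (3 * d\<^sup>2 / 16)\<^sup>2"
    unfolding bump_def by (intro mult_left_mono) auto
  also have "(16 / (3 * d\<^sup>2))\<^sup>2 * (3 * d\<^sup>2 / 16)\<^sup>2 = 1" using assms by (simp add: power_mult_distrib[symmetric])
  finally show ?thesis by simp
qed

lemma bump_outside:
  assumes "x \<notin> cball x0 (d / 2)" "d > 0" shows "bump x0 d x = 0" "grad (bump x0 d) x = 0"
proof -
  have b0: "bump x0 d y = 0" if "y \<in> - cball x0 (d / 2)" for y
  proof -
    have "(norm (y - x0))\<^sup>2 \<ge> (d / 2)\<^sup>2" using that assms by (intro power_mono) (auto simp: dist_norm norm_minus_commute)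
    then have "max 0 (d\<^sup>2 / 4 - (y - x0) \<bullet> (y - x0)) = 0" by (simp add: power2_norm_eq_inner power_divide)
    then show ?thesis by (simp add: bump_def)
  qed
  then show "bump x0 d x = 0" using assms by auto
  have "grad (bump x0 d) x = grad (\<lambda>_. 0) x"
    by (rule grad_transform[of "- cball x0 (d / 2)"]) (use assms b0 in auto)
  then show "grad (bump x0 d) x = 0" by (simp add: grad_unique[OF GDERIV_const])
qed

lemma hess_cong:
  assumes V: "open V" "x \<in> V" and eq: "\<And>y. y \<in> V \<Longrightarrow> G y = G' y" "\<And>y. y \<in> V \<Longrightarrow> f y = f' y"
  shows "hess G f x = hess G' f' x"
proof -
  have g: "pd i f y = pd i f' y" if "y \<in> V" for i y by (rule pd_transform[OF V(1) that eq(2)])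
  have "pd i (pd j f) x = pd i (pd j f') x" for i j by (rule pd_transform[OF V g])
  moreover have "chr_low G x m i j = chr_low G' x m i j" for m i j
    unfolding chr_low_def using pd_transform[OF V, of "\<lambda>y. G y $ _ $ _" "\<lambda>y. G' y $ _ $ _"] eq(1) by simp
  moreover have "rgrad G f x = rgrad G' f' x"
    using g[OF V(2)] eq(1)[OF V(2)] by (simp add: rgrad_def grad_def)
  ultimately show ?thesis by (simp add: hess_def)
qed

lemma open_Collect_continuous:
  fixes f :: "'x::topological_space \<Rightarrow> real"
  assumes "open U" "continuous_on U f" "open S" shows "open {x \<in> U. f x \<in> S}"
  using continuous_open_preimage[OF assms(2,1,3)] by (simp add: vimage_def Int_def)

context ah_manifold
begin

text \<open>A coordinate ball at infinity with a bump \<open>b\<close> on it. \<open>b\<close> lives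
  on all of coordinate space and need not vanish at the boundary at infinity; the support of test
  functions takes care of that end. The single number \<open>D\<close> bounds \<open>b\<close>, its
  gradient and the Hessian of \<rho> in terms of \<open>h\<close>, hence without any reference to
  \<open>R\<close>. On \<open>W\<close> the bump is at least 1. Null level sets are recorded because
  the inner boundary is such a level.\<close>

definition patch :: "real \<Rightarrow> ('a, 'n) chart \<Rightarrow> (real^'n) set \<Rightarrow> (real^'n \<Rightarrow> real) \<Rightarrow> (real^'n) set \<Rightarrow> real \<Rightarrow> 'a set \<Rightarrow> bool"
  where
  "patch \<eta> c B b Kc D W \<longleftrightarrow> c \<in> A \<and> open B \<and> compact Kc \<and> Kc \<subseteq> B \<and> B \<inter> half_space \<subseteq> snd c ` fst c \<and>
     C1_on UNIV b \<and> (\<forall>x. 0 \<le> b x \<and> b x \<le> D) \<and> (\<forall>x. x \<notin> Kc \<longrightarrow> b x = 0 \<and> grad b x = 0) \<and>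
     (\<forall>x\<in>B \<inter> Om c. \<bar>norm2_vec (h c (cinv c x)) (grad (\<lambda>x. \<rho> (cinv c x)) x) - 1\<bar> \<le> \<eta> \<and>
        sqrt (norm2_mat (h c (cinv c x)) (hess (\<lambda>x. h c (cinv c x)) (\<lambda>x. \<rho> (cinv c x)) x)) \<le> D \<and>
        sqrt (norm2_vec (h c (cinv c x)) (grad b x)) \<le> D) \<and>
     (\<forall>r. emeasure lborel {x \<in> B \<inter> Om c. \<rho> (cinv c x) = r} = 0) \<and>
     openin X W \<and> (\<forall>q\<in>W. q \<in> fst c \<and> snd c q \<in> B \<and> 1 \<le> b (snd c q))"

text \<open>Makes derivatives at the boundary at infinity, taken within the half-space, computable
  from extensions across it.\<close>

lemma thick_half_space:
  assumes c: "c \<in> A" and p: "p \<in> fst c"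
  shows "thick (snd c ` fst c) (snd c p)"
proof -
  obtain W where W: "open W" "snd c ` fst c = half_space \<inter> W"
    using chart[OF c] by (auto simp: is_chart_def openin_open)
  have G: "GDERIV (\<lambda>x. - (x $ bdry_index)) (snd c p) :> - axis bdry_index 1"
    by (rule GDERIV_minus[OF GDERIV_nth])
  show ?thesis
  proof (rule thick_sublevel[where \<sigma> = "\<lambda>x. - (x $ bdry_index)" and B = W])
    show "(\<lambda>x. - (x $ bdry_index)) differentiable (at (snd c p))" by (rule GDERIV_imp_differentiable[OF G])
    show "grad (\<lambda>x. - (x $ bdry_index)) (snd c p) \<noteq> 0" by (simp add: grad_unique[OF G] axis_eq_0_iff)
    show "open W" "snd c p \<in> W" using W p by auto
    show "{y \<in> W. - (y $ bdry_index) < - (snd c p $ bdry_index)} \<subseteq> snd c ` fst c"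
      using chart_in_half_space[OF c p] unfolding W(2) by (auto simp: half_space_def)
  qed
qed

text \<open>\<rho> and \<open>h\<close> are extended across the boundary at infinity, where every
  quantity to be bounded is continuous in the extended data. At \<open>p\<close> one has
  \<open>|d\<rho>|\<^sup>2 = 1\<close>, so a small ball gives the bounds, including at interior
  points arbitrarily close to infinity.\<close>

lemma patch_exists:
  assumes p: "p \<in> bdry A" and \<eta>: "\<eta> > 0"
  shows "\<exists>c B b Kc D W. patch \<eta> c B b Kc D W \<and> p \<in> W"
proof -
  define c where "c = chart_at A p"
  have pX: "p \<in> topspace X" using p defining(3) by auto
  have c: "c \<in> A" "p \<in> fst c" using chart_at_mem[OF pX] by (auto simp: c_def)
  define S where "S = snd c ` fst c"
  define x0 where "x0 = snd c p"
  define rc where "rc = (\<lambda>x. \<rho> (cinv c x))"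
  define hc where "hc = (\<lambda>x. h c (cinv c x))"
  have x0: "x0 \<in> S" using c by (auto simp: S_def x0_def)
  obtain W0 where W0: "open W0" "S = half_space \<inter> W0"
    using chart[OF c(1)] by (auto simp: is_chart_def openin_open S_def)
  obtain U0 er where er: "open U0" "x0 \<in> U0" "C2_on U0 er" "\<And>y. y \<in> S \<inter> U0 \<Longrightarrow> er y = rc y"
    using smooth_on_extension[OF smooth_rho[OF c(1)], of x0] x0 by (auto simp: S_def rc_def)
  have "\<exists>U e. open U \<and> x0 \<in> U \<and> C2_on U e \<and> (\<forall>y\<in>S \<inter> U. e y = hc y $ i $ j)" for i j
    using smooth_on_extension[OF smooth_h[OF c(1), of i j], of x0] x0 unfolding S_def hc_def by (metis (no_types, lifting))
  then obtain Uh eh where eh: "\<And>i j. open (Uh i j)" "\<And>i j. x0 \<in> Uh i j" "\<And>i j. C2_on (Uh i j) (eh i j)"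
      "\<And>i j y. y \<in> S \<inter> Uh i j \<Longrightarrow> eh i j y = hc y $ i $ j" by metis
  define H where "H x = (\<chi> i j. eh i j x)" for x
  define U1 where "U1 = W0 \<inter> U0 \<inter> (\<Inter>i. \<Inter>j. Uh i j)"
  have U1: "open U1" "x0 \<in> U1" using W0 er eh x0 by (auto simp: U1_def intro!: open_INT)
  have HS: "H y = hc y" "er y = rc y" if "y \<in> S \<inter> U1" for y using that er(4) eh(4) by (auto simp: H_def U1_def vec_eq_iff)
  have C1H: "C1_on U1 (\<lambda>x. H x $ i $ j)" for i j
    using C1_on_subset[OF C2_on_C1[OF eh(3)[of i j]], of U1] by (auto simp: H_def U1_def)
  define U2 where "U2 = {x \<in> U1. det (H x) \<in> - {0}}"
  have cH: "continuous_on U1 (\<lambda>x. H x $ i $ j)" for i j by (rule C1_on_continuous[OF C1H])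
  have oU2: "open U2" unfolding U2_def by (rule open_Collect_continuous[OF U1(1) continuous_on_det[OF cH]]) auto
  have Hx0: "H x0 = h c p" "er x0 = rc x0" using HS[of x0] x0 U1 c by (auto simp: hc_def x0_def)
  have pos0: "posdef (h c p)" by (rule posdef_h_chart[OF c])
  have x0U2: "x0 \<in> U2" using U1(2) posdef_det[OF pos0] by (simp add: U2_def Hx0)
  have U2: "U2 \<subseteq> U1" "\<And>x. x \<in> U2 \<Longrightarrow> det (H x) \<noteq> 0" by (auto simp: U2_def)
  have C2er: "C2_on U2 er" using C2_on_subset[OF er(3)] U2(1) by (auto simp: U1_def)
  have C1H2: "C1_on U2 (\<lambda>x. H x $ i $ j)" for i j by (rule C1_on_subset[OF C1H U2(1)])
  have cH2: "continuous_on U2 (\<lambda>x. H x $ i $ j)" for i j by (rule C1_on_continuous[OF C1H2])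
  define l where "l x = norm2_vec (H x) (grad er x)" for x
  define m where "m x = norm2_mat (H x) (hess H er x)" for x
  have cl: "continuous_on U2 l" unfolding l_def
    by (rule continuous_on_norm2_vec[OF cH2 U2(2)]) (use C1_on_continuous_pd[OF C2_on_C1[OF C2er]] in auto)
  have cm: "continuous_on U2 m" unfolding m_def
    by (rule continuous_on_norm2_mat[OF cH2 U2(2) continuous_on_hess_entries[OF C1H2 U2(2) C2er]])
  have cd: "coord_deriv UNIV c i \<rho> p = pd i er x0" for i
    unfolding coord_deriv_def Int_UNIV_right x0_def
  proof (rule thick_frechet_derivative[OF thick_half_space[OF c], where U = U0])
    show "er differentiable (at (snd c p))" using C1_on_differentiable[OF C2_on_C1[OF er(3)] er(2)] by (simp add: x0_def)
    show "(\<rho> \<circ> cinv c) y = er y" if "y \<in> snd c ` fst c \<inter> U0" for y using er(4)[of y] that by (simp add: S_def rc_def)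
  qed (use er c in \<open>auto simp: x0_def\<close>)
  have l0: "l x0 = 1"
  proof -
    have "(tensor_norm A h 1 (differential UNIV \<rho>) p)\<^sup>2 = 1"
      using AH p by (simp add: asymptotically_hyperbolic_def)
    moreover have "(\<chi> i. differential UNIV \<rho> c p [i]) = grad er x0" by (simp add: differential_def cd vec_eq_iff)
    ultimately show ?thesis
      using tensor_norm_1[of h A p "differential UNIV \<rho>"] pos0 by (simp add: c_def[symmetric] l_def Hx0)
  qed
  \<comment> \<open>A direction transversal to the level sets of \<rho>; it remains transversal on
    the ball and makes these levels null sets.\<close>
  obtain i0 where i0: "pd i0 er x0 \<noteq> 0" using defining(4)[OF p c] by (auto simp: cd)
  define Q where "Q = {x \<in> U2. l x \<in> {1 - \<eta><..<1 + \<eta>}} \<inter> {x \<in> U2. m x \<in> {..<m x0 + 1}} \<inter> {x \<in> U2. pd i0 er x \<in> - {0}}"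
  have "open Q" unfolding Q_def
    by (intro open_Int open_Collect_continuous oU2 cl cm C1_on_continuous_pd[OF C2_on_C1[OF C2er]]) auto
  moreover have "x0 \<in> Q" using x0U2 l0 i0 \<eta> by (simp add: Q_def)
  ultimately obtain d where d: "d > 0" "ball x0 d \<subseteq> Q" by (meson open_contains_ball)
  define B where "B = ball x0 d"
  define Kc where "Kc = cball x0 (d / 2)"
  have BQ: "B \<subseteq> Q" "Q \<subseteq> U2" "Kc \<subseteq> B" using d by (auto simp: B_def Kc_def Q_def)
  have "bounded ((\<lambda>x. norm2_vec (H x) (grad (bump x0 d) x)) ` Kc)"
  proof (intro compact_imp_bounded compact_continuous_image)
    have "continuous_on U2 (\<lambda>x. norm2_vec (H x) (grad (bump x0 d) x))"
      by (rule continuous_on_norm2_vec[OF cH2 U2(2)]) (use C1_on_continuous_pd[OF C1_on_bump] in auto)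
    then show "continuous_on Kc (\<lambda>x. norm2_vec (H x) (grad (bump x0 d) x))"
      using BQ by (auto intro: continuous_on_subset)
  qed (simp add: Kc_def)
  then obtain k where k: "\<And>x. x \<in> Kc \<Longrightarrow> \<bar>norm2_vec (H x) (grad (bump x0 d) x)\<bar> \<le> k" unfolding bounded_iff by auto
  \<comment> \<open>The three entries bound the bump, the Hessian of \<rho>, and the gradient of the
    bump.\<close>
  define D where "D = max ((16 / (3 * d\<^sup>2))\<^sup>2 * (d\<^sup>2 / 4)\<^sup>2) (max (sqrt (m x0 + 1)) (sqrt (max k 0)))"
  define W where "W = {q \<in> fst c. snd c q \<in> ball x0 (d / 4)}"
  have loc: "hc x = H x" "grad rc x = grad er x" "hess hc rc x = hess H er x" if x: "x \<in> B \<inter> Om c" for x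
  proof -
    define V where "V = B \<inter> Om c"
    have V: "open V" "x \<in> V" using x open_Om[OF c(1)] by (auto simp: V_def B_def)
    have "V \<subseteq> S \<inter> U1" using BQ U2(1) Om_subset[of c] by (auto simp: V_def S_def)
    then have eq: "hc y = H y" "rc y = er y" if "y \<in> V" for y
      using HS(1)[of y, symmetric] HS(2)[of y, symmetric] that by blast+
    show "hc x = H x" by (rule eq(1)[OF V(2)])
    show "grad rc x = grad er x" by (rule grad_transform[OF V eq(2)])
    show "hess hc rc x = hess H er x" by (rule hess_cong[OF V eq])
  qed
  have nullr: "emeasure lborel {x \<in> B \<inter> Om c. rc x = r} = 0" for r
  proof (rule null_set_transversal[where i = i0])
    have oV: "open (B \<inter> Om c)" using open_Om[OF c(1)] by (simp add: B_def open_Int)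
    have "continuous_on (B \<inter> Om c) rc"
      using C1_on_continuous[OF C2_on_C1[OF conformal_chart.\<rho>[OF conformal[OF c(1)]]]]
      by (auto simp: rc_def intro: continuous_on_subset)
    from open_Collect_continuous[OF oV this, of "- {r}"]
    have "open {x \<in> B \<inter> Om c. rc x \<in> - {r}}" by auto
    moreover have "{x \<in> B \<inter> Om c. rc x = r} = (B \<inter> Om c) - {x \<in> B \<inter> Om c. rc x \<in> - {r}}" by auto
    ultimately show "{x \<in> B \<inter> Om c. rc x = r} \<in> sets borel" using oV by (simp only: sets.Diff borel_open)
    have key: "\<not> a > 0" if x: "x \<in> {x \<in> B \<inter> Om c. rc x = r}" "x + a *\<^sub>R axis i0 1 \<in> {x \<in> B \<inter> Om c. rc x = r}" for x a
    proof
      assume a: "a > 0"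
      \<comment> \<open>The segment between two points of the level may leave the interior, but by
        convexity it stays in the ball, where the extension \<open>er\<close> is differentiable and
        strictly monotone along axis \<open>i0\<close>.\<close>
      have seg: "x + z *\<^sub>R axis i0 1 \<in> B" if "0 \<le> z" "z \<le> a" for z
      proof -
        have "(1 - z / a) *\<^sub>R x + (z / a) *\<^sub>R (x + a *\<^sub>R axis i0 1) \<in> B"
          using x that a by (intro convexD[OF convex_ball[of x0 d, folded B_def]]) (auto simp: field_simps)
        moreover have "(1 - z / a) *\<^sub>R x + (z / a) *\<^sub>R (x + a *\<^sub>R axis i0 1) = x + z *\<^sub>R axis i0 1"
          using a by (simp add: algebra_simps)
        ultimately show ?thesis by simp
      qed
      have "\<exists>z>0. z < a \<and> er (x + a *\<^sub>R axis i0 1) - er (x + 0 *\<^sub>R axis i0 1) = (a - 0) * pd i0 er (x + z *\<^sub>R axis i0 1)"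
        using a seg BQ by (intro MVT2 DERIV_along_axis C1_on_differentiable[OF C2_on_C1[OF C2er]]) auto
      then obtain z where z: "0 < z" "z < a" "er (x + a *\<^sub>R axis i0 1) - er x = a * pd i0 er (x + z *\<^sub>R axis i0 1)" by auto
      have "y \<in> S \<inter> U1" if "y \<in> B \<inter> Om c" for y using that BQ U2(1) Om_subset[of c] by (auto simp: S_def)
      then have "er (x + a *\<^sub>R axis i0 1) = r" "er x = r" using HS(2) x by auto
      then have "pd i0 er (x + z *\<^sub>R axis i0 1) = 0" using z a by simp
      then show False using seg[of z] z BQ by (auto simp: Q_def)
    qed
    show "a = 0" if x: "x \<in> {x \<in> B \<inter> Om c. rc x = r}" "x + a *\<^sub>R axis i0 1 \<in> {x \<in> B \<inter> Om c. rc x = r}" for x a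
      using key[OF x] key[of "x + a *\<^sub>R axis i0 1" "- a"] x by force
  qed
  have fold: "h c (cinv c x) = hc x" "\<rho> (cinv c x) = rc x" for x by (simp_all add: hc_def rc_def)
  have "patch \<eta> c B (bump x0 d) Kc D W"
    unfolding patch_def fold
  proof (intro conjI ballI allI impI)
    show "c \<in> A" "open B" "compact Kc" "Kc \<subseteq> B" using c BQ by (auto simp: B_def Kc_def)
    show "B \<inter> half_space \<subseteq> snd c ` fst c" using BQ U2(1) W0(2) by (auto simp: S_def U1_def)
    show "C1_on UNIV (bump x0 d)" by (rule C1_on_bump)
    show "0 \<le> bump x0 d x" "bump x0 d x \<le> D" for x using bump_bounds[where ?x0.0 = x0 and d = d and x = x] by (auto simp: D_def)
    show "bump x0 d x = 0" "grad (bump x0 d) x = 0" if "x \<notin> Kc" for x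
      using bump_outside[of x x0 d] that d by (auto simp: Kc_def)
    show "\<bar>norm2_vec (hc x) (grad rc x) - 1\<bar> \<le> \<eta>" if x: "x \<in> B \<inter> Om c" for x
      using x BQ unfolding loc[OF x] l_def[symmetric] by (auto simp: Q_def)
    show "sqrt (norm2_mat (hc x) (hess hc rc x)) \<le> D" if x: "x \<in> B \<inter> Om c" for x
    proof -
      have "m x \<le> m x0 + 1" using x BQ by (auto simp: Q_def)
      then have "sqrt (m x) \<le> sqrt (m x0 + 1)" by (rule real_sqrt_le_mono)
      also have "\<dots> \<le> D" unfolding D_def by linarith
      finally show ?thesis unfolding loc[OF x] m_def[symmetric] .
    qed
    show "sqrt (norm2_vec (hc x) (grad (bump x0 d) x)) \<le> D" if x: "x \<in> B \<inter> Om c" for x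
    proof -
      have "norm2_vec (H x) (grad (bump x0 d) x) \<le> max k 0"
        using k[of x] bump_outside(2)[of x x0 d] d(1) by (cases "x \<in> Kc") (auto simp: Kc_def norm2_vec_def)
      then have "sqrt (norm2_vec (H x) (grad (bump x0 d) x)) \<le> sqrt (max k 0)" by (rule real_sqrt_le_mono)
      also have "\<dots> \<le> D" unfolding D_def by linarith
      finally show ?thesis unfolding loc(1)[OF x] .
    qed
    show "emeasure lborel {x \<in> B \<inter> Om c. rc x = r} = 0" for r by (rule nullr)
    show "openin X W" unfolding W_def by (rule preimage_openin[OF c(1)]) simp
    show "q \<in> fst c" "snd c q \<in> B" "1 \<le> bump x0 d (snd c q)" if "q \<in> W" for q
      using that d(1) bump_ge_1[OF d(1), of "snd c q" x0] by (auto simp: W_def B_def)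
  qed
  moreover have "p \<in> W" using c d by (auto simp: W_def x0_def)
  ultimately show ?thesis by blast
qed

text \<open>The boundary is compact, so finitely many patches suffice. What they leave uncovered is
  compact and disjoint from the boundary, so \<rho> has a positive lower bound there.\<close>

lemma boundary_cover:
  assumes "\<eta> > 0"
  obtains I :: "'a set" and c B b Kc D W and r0 :: real where "finite I" "\<And>i. i \<in> I \<Longrightarrow> patch \<eta> (c i) (B i) (b i) (Kc i) (D i) (W i)"
    "r0 > 0" "\<And>q. q \<in> topspace X \<Longrightarrow> \<rho> q \<le> r0 \<Longrightarrow> \<exists>i\<in>I. q \<in> W i"
proof -
  have "\<forall>p\<in>bdry A. \<exists>c B b Kc D W. patch \<eta> c B b Kc D W \<and> p \<in> W" using patch_exists assms by blast
  then obtain c B b Kc D W where P: "\<And>p. p \<in> bdry A \<Longrightarrow> patch \<eta> (c p) (B p) (b p) (Kc p) (D p) (W p) \<and> p \<in> W p"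
    by metis
  have Wo: "openin X (W p)" if "p \<in> bdry A" for p using P[OF that] by (auto simp: patch_def)
  have "closedin X (bdry A)"
  proof -
    have "topspace X - bdry A = M" by (simp add: interior_part_def)
    then show ?thesis using open_M defining(3) by (auto simp: closedin_def)
  qed
  then have "compactin X (bdry A)" using compact_X closedin_compact_space by blast
  moreover have "bdry A \<subseteq> \<Union> (W ` bdry A)" using P by blast
  moreover have "openin X V" if "V \<in> W ` bdry A" for V using that Wo by blast
  ultimately obtain \<F> where \<F>: "finite \<F>" "\<F> \<subseteq> W ` bdry A" "bdry A \<subseteq> \<Union> \<F>"
    using compactinD[of X "bdry A" "W ` bdry A"] by blast
  obtain I where I: "finite I" "I \<subseteq> bdry A" "\<F> = W ` I" using finite_subset_image[OF \<F>(1,2)] by blast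
  define Z where "Z = topspace X - \<Union> \<F>"
  have "openin X (\<Union> \<F>)" using \<F>(2) Wo by (intro openin_Union) blast
  then have "closedin X Z" unfolding Z_def by blast
  then have cZ: "compactin X Z" using compact_X closedin_compact_space by blast
  have posZ: "\<rho> q > 0" if "q \<in> Z" for q
  proof -
    have "q \<in> M" using that \<F>(3) unfolding Z_def interior_part_def by blast
    then show ?thesis unfolding M_eq by simp
  qed
  have "\<exists>r0>0. \<forall>q\<in>Z. \<rho> q > r0"
  proof (cases "Z = {}")
    case True then show ?thesis by (intro exI[of _ 1]) auto
  next
    case False
    have "compact (\<rho> ` Z)" using image_compactin[OF cZ continuous_rho] by simp
    then obtain q where q: "q \<in> Z" "\<And>y. y \<in> Z \<Longrightarrow> \<rho> q \<le> \<rho> y"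
      using compact_attains_inf[of "\<rho> ` Z"] False by auto
    show ?thesis
    proof (intro exI[of _ "\<rho> q / 2"] conjI ballI)
      show "0 < \<rho> q / 2" using posZ[OF q(1)] by simp
      show "\<rho> q / 2 < \<rho> y" if "y \<in> Z" for y using q(2)[OF that] posZ[OF q(1)] by linarith
    qed
  qed
  then obtain r0 where r0: "r0 > 0" "\<And>q. q \<in> Z \<Longrightarrow> \<rho> q > r0" by blast
  show ?thesis
  proof (rule that[of I c B b Kc D W r0])
    show "\<exists>i\<in>I. q \<in> W i" if "q \<in> topspace X" "\<rho> q \<le> r0" for q
      using r0(2)[of q] that I(3) by (force simp: Z_def)
  qed (use I P r0 in auto)
qed

end

section \<open>The weighted estimate\<close>

text \<open>A bounded nondecreasing C1 function, zero on the negative axis, that reaches 1 only in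
  the limit. Rescaling its argument is enough, since only pointwise convergence to 1 is
  used.\<close>

definition cutoff :: "real \<Rightarrow> real" where "cutoff y = (max 0 y)\<^sup>2 / (1 + (max 0 y)\<^sup>2)"

definition cutoff' :: "real \<Rightarrow> real" where "cutoff' y = 2 * max 0 y / (1 + (max 0 y)\<^sup>2)\<^sup>2"

lemma cutoff_denom: "1 + (max 0 y)\<^sup>2 > (0::real)" by (simp add: add_pos_nonneg)

lemma DERIV_cutoff: "DERIV cutoff y :> cutoff' y"
proof -
  have "DERIV (\<lambda>y. (max 0 y)\<^sup>2 / (1 + (max 0 y)\<^sup>2)) y :>
      ((2 * max 0 y) * (1 + (max 0 y)\<^sup>2) - (max 0 y)\<^sup>2 * (0 + 2 * max 0 y)) / ((1 + (max 0 y)\<^sup>2) * (1 + (max 0 y)\<^sup>2))"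
    using cutoff_denom[of y] by (intro DERIV_divide DERIV_add DERIV_const DERIV_pos_part_sq) auto
  moreover have "((2 * max 0 y) * (1 + (max 0 y)\<^sup>2) - (max 0 y)\<^sup>2 * (0 + 2 * max 0 y)) / ((1 + (max 0 y)\<^sup>2) * (1 + (max 0 y)\<^sup>2)) = cutoff' y"
    unfolding cutoff'_def by (simp add: power2_eq_square[of "1 + _"] algebra_simps)
  ultimately show ?thesis by (simp add: cutoff_def[abs_def])
qed

lemma continuous_cutoff': "continuous_on UNIV cutoff'"
  unfolding cutoff'_def[abs_def] using cutoff_denom by (intro continuous_intros) (metis less_irrefl power_eq_0_iff)

lemma cutoff_bounds: "0 \<le> cutoff y" "cutoff y \<le> 1" "0 \<le> cutoff' y" "y \<le> 0 \<Longrightarrow> cutoff y = 0"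
  using cutoff_denom[of y] by (auto simp: cutoff_def cutoff'_def)

lemma tendsto_cutoff:
  assumes "filterlim f at_top F" shows "((\<lambda>x. cutoff (f x)) \<longlongrightarrow> 1) F"
proof -
  have "((\<lambda>x. cutoff (f x) - 1) \<longlongrightarrow> 0) F"
  proof (rule Lim_null_comparison)
    have "norm (cutoff y - 1) \<le> inverse y" if "y \<ge> 1" for y
    proof -
      have ne: "1 + y\<^sup>2 \<noteq> 0" by (metis add_pos_nonneg less_irrefl zero_le_power2 zero_less_one)
      have "cutoff y = y\<^sup>2 / (1 + y\<^sup>2)" using that by (simp add: cutoff_def)
      also have "\<dots> = 1 - 1 / (1 + y\<^sup>2)" using ne by (simp add: divide_eq_eq diff_divide_distrib left_diff_distrib)
      finally have "cutoff y - 1 = - (1 / (1 + y\<^sup>2))" by simp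
      then have "norm (cutoff y - 1) = 1 / (1 + y\<^sup>2)" by (simp add: add_pos_nonneg)
      also have "\<dots> \<le> 1 / y"
        using that by (intro divide_left_mono) (auto simp: power2_eq_square add_pos_nonneg intro: order.trans[of _ "y * y"])
      finally show ?thesis by (simp add: inverse_eq_divide)
    qed
    then show "\<forall>\<^sub>F x in F. norm (cutoff (f x) - 1) \<le> inverse (f x)"
      using filterlim_at_top[THEN iffD1, OF assms, rule_format, of 1] by (auto elim!: eventually_mono)
    show "((\<lambda>x. inverse (f x)) \<longlongrightarrow> 0) F" by (rule tendsto_inverse_0_at_top[OF assms])
  qed
  then show ?thesis by (simp add: LIM_zero_iff)
qed

locale ah_measured_function = ah_function X A \<rho> h R N + ah_measured X A \<rho> h \<mu>
  for X :: "'a topology" and A :: "('a, 'n::finite) chart set" and \<rho> h R N \<mu>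
begin

definition energy :: "'a \<Rightarrow> real" where "energy p = (N p)\<^sup>2 + V2 p"

text \<open>The end without its inner boundary. It is open, so \<open>N\<close> has honest second
  derivatives there, and it differs from the end by a level set of \<rho>.\<close>

definition M' :: "'a set" where "M' = {p \<in> M. \<rho> p < exp (- 2 * R)}"

lemma M'_E: "M' \<subseteq> E" by (auto simp: M'_def E_eq)

lemma energy_nonneg: "0 \<le> energy p" using V2_nonneg by (simp add: energy_def)

lemma E_sets: "E \<in> sets \<mu>"
proof -
  have "E = {p \<in> M. \<rho> p \<le> exp (- 2 * R)}" by (auto simp: E_eq)
  then show ?thesis using sublevel_sets(1) by simp
qed

lemma M'_sets: "M' \<in> sets \<mu>" using sublevel_sets(2) by (simp add: M'_def)

lemma openin_M': "openin X M'"
proof -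
  have "openin X {p \<in> topspace X. \<rho> p \<in> {..<exp (- 2 * R)}}"
    using continuous_rho unfolding continuous_map_def by (metis open_openin open_lessThan)
  moreover have "M' = M \<inter> {p \<in> topspace X. \<rho> p \<in> {..<exp (- 2 * R)}}" using M_subset by (auto simp: M'_def)
  ultimately show ?thesis using open_M by (simp only: openin_Int)
qed

lemma continuous_weighted:
  assumes f: "continuous_map (subtopology X E) euclidean f"
  shows "continuous_map (subtopology X E) euclidean (\<lambda>p. f p * \<rho> p powr a)"
proof -
  have r: "continuous_map (subtopology X E) euclidean \<rho>"
    using continuous_rho continuous_map_from_subtopology by blast
  have "continuous_map (subtopology X E) euclidean (\<lambda>p. exp (a * ln (\<rho> p)))"
  proof -
    have "continuous_map (subtopology X E) (top_of_set {0<..}) \<rho>"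
      using r E_M by (auto simp: continuous_map_in_subtopology M_eq)
    moreover have "continuous_map (top_of_set {0<..}) euclidean (\<lambda>x. exp (a * ln x))"
      by (auto intro!: continuous_intros)
    ultimately have "continuous_map (subtopology X E) euclidean ((\<lambda>x. exp (a * ln x)) \<circ> \<rho>)"
      by (rule continuous_map_compose)
    then show ?thesis by (simp add: o_def)
  qed
  from continuous_map_real_mult[OF f this]
  show ?thesis
    by (rule continuous_map_eq) (use E_M in \<open>auto simp: powr_def M_eq\<close>)
qed

lemma integrable_weighted:
  assumes f: "continuous_map (subtopology X E) euclidean f" and "\<And>p. p \<in> E \<Longrightarrow> p \<notin> K \<Longrightarrow> f p = 0"
  shows "integrable \<mu> (\<lambda>p. indicator E p * (f p * \<rho> p powr a))"
  by (rule integrable_continuous_compact[OF E_sets continuous_weighted[OF f] compact_K]) (use assms in auto)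

lemma integrable_T2: "integrable \<mu> (\<lambda>p. indicator E p * (T2 p * \<rho> p powr a))"
  by (rule integrable_weighted[OF continuous_V2_T2(2)]) (use outside_K in auto)

lemma integrable_energy: "integrable \<mu> (\<lambda>p. indicator E p * (energy p * \<rho> p powr a))"
proof (rule integrable_weighted)
  have "continuous_map (subtopology X E) euclidean (\<lambda>p. N p * N p + V2 p)"
    by (intro continuous_map_add continuous_map_real_mult continuous_N continuous_V2_T2)
  then show "continuous_map (subtopology X E) euclidean energy" by (simp add: energy_def[abs_def] power2_eq_square)
qed (use outside_K N_outside_K in \<open>auto simp: energy_def\<close>)

text \<open>\<open>chart_inequality\<close> on one patch, carried back to the manifold by
  \<open>transfer\<close>. The two halves of \<eta>' bound the two summands in
  \<open>norm_Emat\<close>, the Hessian of \<rho> being multiplied by \<rho>, which is below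
  \<open>exp (- 2 * R)\<close>. The gap \<open>t1 > 2 * R\<close> keeps the cutoff away from the
  inner boundary.\<close>

lemma patch_inequality:
  fixes s Kc0 \<kappa> cc C \<eta>' t1 :: real
  assumes patch: "patch \<eta> c B b Kc D W"
    and small: "\<eta> \<le> \<eta>'" "real CARD('n) * \<eta> \<le> \<eta>' / 2" "exp (- 2 * R) * D \<le> \<eta>' / 2"
    and z: "\<And>r. DERIV z r :> z' r" "continuous_on UNIV z'" "\<And>r. z r \<ge> 0" "\<And>r. z' r \<ge> 0"
      "\<And>r. r \<le> t1 \<Longrightarrow> z r = 0" and t1: "t1 > 2 * R"
    and flux: "\<And>(a::real^'n) v d T E N b z z'. \<lbrakk>b \<ge> 0; z \<ge> 0; z' \<ge> 0; \<bar>a \<bullet> a - 1\<bar> \<le> \<eta>'; norm E \<le> \<eta>'\<rbrakk> \<Longrightarrow>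
       z * (b * (cc * (N\<^sup>2 + v \<bullet> v) - C * (norm T)\<^sup>2) - C * norm d * (N\<^sup>2 + v \<bullet> v))
       \<le> mult_flux s Kc0 \<kappa> a v d T E N b z z'"
  defines "F \<equiv> \<lambda>p. indicator {p \<in> fst c \<inter> M'. snd c p \<in> B} p * (\<rho> p powr (2 * s) * (z (- ln (\<rho> p)) *
      (b (snd c p) * (cc * energy p - C * T2 p)
       - C * (\<rho> p * sqrt (norm2_vec (h c p) (grad b (snd c p)))) * energy p)))"
  shows "integrable \<mu> F" "(\<integral>p. F p \<partial>\<mu>) \<le> 0"
proof -
  have c: "c \<in> A" and B: "open B" "B \<inter> half_space \<subseteq> snd c ` fst c" and Kc: "compact Kc" "Kc \<subseteq> B"
    and b: "C1_on UNIV b" "\<And>x. 0 \<le> b x" "\<And>x. x \<notin> Kc \<Longrightarrow> b x = 0 \<and> grad b x = 0"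
    and near: "\<And>x. x \<in> B \<inter> Om c \<Longrightarrow> \<bar>norm2_vec (h c (cinv c x)) (grad (\<lambda>x. \<rho> (cinv c x)) x) - 1\<bar> \<le> \<eta>"
      "\<And>x. x \<in> B \<inter> Om c \<Longrightarrow> sqrt (norm2_mat (h c (cinv c x)) (hess (\<lambda>x. h c (cinv c x)) (\<lambda>x. \<rho> (cinv c x)) x)) \<le> D"
    using patch by (auto simp: patch_def)
  define V where "V = {p \<in> fst c \<inter> M'. snd c p \<in> B}"
  define U where "U = snd c ` V"
  have "openin X ({p \<in> fst c. snd c p \<in> B} \<inter> M')" by (intro openin_Int preimage_openin[OF c B(1)] openin_M')
  then have oV: "openin X V" by (rule back_subst[of "openin X"]) (auto simp: V_def)
  have VM: "V \<subseteq> fst c" "V \<subseteq> M" "V \<subseteq> E" using M'_E E_M by (auto simp: V_def)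
  have "U = snd c ` (fst c \<inter> V)" using VM by (simp add: U_def Int_absorb1)
  then have oU: "open U" using open_Om_inter[OF c oV VM(2)] by simp
  have UO: "U \<subseteq> B \<inter> Om c" using VM by (auto simp: U_def V_def Om_def)
  have UD: "U \<subseteq> Dc c" using VM by (auto simp: U_def Dc_def)
  have UV: "cinv c x \<in> V" "snd c (cinv c x) = x" if "x \<in> U" for x using that VM c by (auto simp: U_def)
  define hc where "hc = (\<lambda>x. h c (cinv c x))"
  define rc where "rc = (\<lambda>x. \<rho> (cinv c x))"
  define Nc where "Nc = (\<lambda>x. N (cinv c x))"
  have cf: "conformal_chart U hc rc"
  proof
    have cc0: "conformal_chart (Om c) hc rc" unfolding hc_def rc_def by (rule conformal[OF c])
    show "C1_metric U hc" using conformal_chart.h[OF cc0] oU UO C1_on_subset[of "Om c" _ U] unfolding C1_metric_def by blast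
    show "C2_on U rc" using conformal_chart.\<rho>[OF cc0] UO C2_on_subset by blast
    show "rc x > 0" if "x \<in> U" for x using conformal_chart.\<rho>_pos[OF cc0, of x] UO that by blast
  qed
  interpret cc: conformal_chart U hc rc by (rule cf)
  have G: "cc.G = Gc c" unfolding fun_eq_iff cc.G_def by (simp add: hc_def rc_def ah_metric_def)
  have C2N: "C2_on U Nc"
  proof -
    have "smooth_on (Dc c) (N \<circ> cinv c)"
      using N_test c by (auto simp: smooth_compact_support_def smooth_fun_on_def smooth_in_chart_def Dc_def)
    from smooth_on_C2_on[OF this oU UD] show ?thesis by (simp add: Nc_def o_def)
  qed
  have ex: "ext c U Nc" unfolding ext_def using oU UO C2N by (auto simp: Nc_def)
  have id: "cc.energy Nc x = energy (cinv c x)" "norm2_mat (cc.G x) (cc.Tmat Nc x) = T2 (cinv c x)"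
    "exp (- 2 * s * cc.t x) = \<rho> (cinv c x) powr (2 * s)" "cc.t x = - ln (\<rho> (cinv c x))" if x: "x \<in> U" for x
  proof -
    have q: "cinv c x \<in> fst c" "cinv c x \<in> E" "snd c (cinv c x) \<in> U" using UV[OF x] VM x by auto
    show "cc.energy Nc x = energy (cinv c x)" "norm2_mat (cc.G x) (cc.Tmat Nc x) = T2 (cinv c x)"
      using V2_ext[OF c ex q] UV(2)[OF x] by (simp_all add: cc.energy_def cc.Tmat_def energy_def G Nc_def)
    show "exp (- 2 * s * cc.t x) = \<rho> (cinv c x) powr (2 * s)" "cc.t x = - ln (\<rho> (cinv c x))"
      using cc.\<rho>_pos[OF x] unfolding cc.t_def by (simp_all add: rc_def powr_def)
  qed
  define f where "f x = exp (- 2 * s * cc.t x) * (z (cc.t x) * (b x * (cc * cc.energy Nc x - C * norm2_mat (cc.G x) (cc.Tmat Nc x))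
            - C * (rc x * sqrt (norm2_vec (hc x) (grad b x))) * cc.energy Nc x))" for x
  define f' where "f' p = \<rho> p powr (2 * s) * (z (- ln (\<rho> p)) * (b (snd c p) * (cc * energy p - C * T2 p)
       - C * (\<rho> p * sqrt (norm2_vec (h c p) (grad b (snd c p)))) * energy p))" for p
  have ff': "f' (cinv c x) = f x" if x: "x \<in> U" for x
    unfolding f_def f'_def id(1-3)[OF x] UV(2)[OF x] unfolding id(4)[OF x] by (simp only: hc_def rc_def)
  \<comment> \<open>The part of the support of \<open>N\<close> on which the cutoff can be nonzero;
    it keeps a positive distance from the inner boundary.\<close>
  define K' where "K' = K \<inter> {q \<in> topspace X. \<rho> q \<in> {..exp (- t1)}}"
  have "closedin X {q \<in> topspace X. \<rho> q \<in> {..exp (- t1)}}"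
    using continuous_rho unfolding continuous_map_closedin by (metis closed_closedin closed_atMost)
  then have clK': "closedin X K'" unfolding K'_def by (intro closedin_Int closed_K)
  \<comment> \<open>\<open>Kc\<close> may reach beyond the half-space, so it is cut back to it
    first; \<open>Cs\<close> is then closed in a compact subset of the chart image.\<close>
  define Cs where "Cs = {x \<in> Kc \<inter> half_space. cinv c x \<in> K'}"
  have cCs: "compact Cs"
  proof -
    have hs: "closed (half_space :: (real^'n) set)"
      unfolding half_space_def by (rule closed_Collect_le) (auto intro!: continuous_intros)
    then have cK: "compact (Kc \<inter> half_space)" using Kc(1) by (rule compact_Int_closed[rotated])
    have sub: "Kc \<inter> half_space \<subseteq> snd c ` fst c" using Kc B by auto
    have "continuous_map (top_of_set (Kc \<inter> half_space)) X (cinv c)"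
      using continuous_map_from_subtopology_mono[OF continuous_map_into_fulltopology[OF continuous_cinv[OF c]] sub] .
    then have "closedin (top_of_set (Kc \<inter> half_space)) {x \<in> topspace (top_of_set (Kc \<inter> half_space)). cinv c x \<in> K'}"
      using clK' unfolding continuous_map_closedin by blast
    then have "closedin (top_of_set (Kc \<inter> half_space)) Cs" by (simp add: Cs_def)
    then show ?thesis using closedin_compact[OF cK] by blast
  qed
  have CsU: "Cs \<subseteq> U"
  proof
    fix x assume x: "x \<in> Cs"
    then have xx: "x \<in> Kc" "x \<in> half_space" "cinv c x \<in> K'" by (auto simp: Cs_def)
    then have "x \<in> snd c ` fst c" using Kc B by auto
    then obtain q where q: "q \<in> fst c" "x = snd c q" by auto
    then have "q \<in> K'" using xx c by simp
    then have qK: "q \<in> E" "\<rho> q \<le> exp (- t1)" using compact_K(2) by (auto simp: K'_def)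
    have "exp (- t1) < exp (- 2 * R)" using t1 by simp
    with qK(2) have "\<rho> q < exp (- 2 * R)" by (rule le_less_trans)
    then have "q \<in> M'" using qK(1) E_M unfolding M'_def by blast
    then show "x \<in> U" using q xx Kc(2) by (auto simp: U_def V_def)
  qed
  \<comment> \<open>Outside \<open>Cs\<close> a point is off \<open>Kc\<close>, at a height where
    \<open>z\<close> vanishes, or off \<open>K\<close>; in the last case \<open>N\<close> is zero in
    a whole neighbourhood, and so are its derivatives.\<close>
  have supp: "(b x = 0 \<and> grad b x = 0) \<or> z (cc.t x) = 0 \<or> (Nc x = 0 \<and> grad Nc x = 0 \<and> cc.Tmat Nc x = 0)"
    if x: "x \<in> U - Cs" for x
  proof (cases "x \<in> Kc")
    case False then show ?thesis using b(3) by blast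
  next
    case True
    define q where "q = cinv c x"
    have q: "q \<in> fst c" "q \<in> V" "snd c q = x" using UV[of x] x VM by (auto simp: q_def)
    have "x \<in> half_space" using chart_in_half_space[OF c q(1)] q(3) by (simp add: half_space_def)
    then have nK': "q \<notin> K'" using x True by (auto simp: Cs_def q_def)
    show ?thesis
    proof (cases "q \<in> K")
      case True
      then have "\<rho> q > exp (- t1)" using nK' q VM M_subset by (auto simp: K'_def)
      then have "ln (\<rho> q) > - t1" by (metis exp_gt_zero less_trans ln_exp ln_less_cancel_iff)
      then have "z (cc.t x) = 0" using id(4)[of x] x by (intro z(5)) (simp add: q_def)
      then show ?thesis by blast
    next
      case False
      define U' where "U' = U \<inter> snd c ` (fst c \<inter> (M - K))"
      have "openin X (M - K)" by (rule openin_diff[OF open_M closed_K])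
      then have oU': "open U'" unfolding U'_def using oU open_Om_inter[OF c, of "M - K"] by auto
      have xU': "x \<in> U'" using x q False VM by (auto simp: U'_def)
      have N0: "Nc y = 0" if "y \<in> U'" for y
      proof -
        have "cinv c y \<in> E" using UV[of y] that VM by (auto simp: U'_def)
        moreover have "cinv c y \<notin> K" using that c by (auto simp: U'_def)
        ultimately show ?thesis unfolding Nc_def by (rule N_outside_K)
      qed
      have z0: "pd i (\<lambda>_. 0) = (\<lambda>_. 0)" for i :: 'n by (auto simp: pd_unique[OF GDERIV_const])
      have g0: "grad Nc x = 0" using grad_transform[OF oU' xU', of Nc "\<lambda>_. 0"] N0 by (simp add: z0 vec_eq_iff)
      have "hess cc.G Nc x = hess cc.G (\<lambda>_. 0) x" by (rule hess_cong[OF oU' xU']) (use N0 in auto)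
      also have "\<dots> = 0" by (simp add: hess_def rgrad_def grad_def z0 vec_eq_iff matrix_vector_mult_def)
      finally have "cc.Tmat Nc x = 0" using N0[OF xU'] by (simp add: cc.Tmat_def)
      then show ?thesis using g0 N0[OF xU'] by blast
    qed
  qed
  have n1: "\<bar>norm2_vec (hc x) (grad rc x) - 1\<bar> \<le> \<eta>'" if "x \<in> U" for x
    using near(1)[of x] that UO small(1) by (force simp: hc_def rc_def)
  have n2: "rc x * sqrt (norm2_mat (hc x) (hess hc rc x)) + real CARD('n) * \<bar>norm2_vec (hc x) (grad rc x) - 1\<bar> \<le> \<eta>'"
    if x: "x \<in> U" for x
  proof -
    have xB: "x \<in> B \<inter> Om c" using x UO by blast
    have "\<rho> (cinv c x) < exp (- 2 * R)" using UV(1)[OF x] by (auto simp: V_def M'_def)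
    then have "rc x * sqrt (norm2_mat (hc x) (hess hc rc x)) \<le> exp (- 2 * R) * D"
      using near(2)[OF xB] cc.\<rho>_pos[OF x] norm2_mat_nonneg[OF cc.posdef_h[OF x]]
      by (intro mult_mono) (auto simp: hc_def rc_def)
    moreover have "real CARD('n) * \<bar>norm2_vec (hc x) (grad rc x) - 1\<bar> \<le> real CARD('n) * \<eta>"
      using near(1)[OF xB] by (intro mult_left_mono) (auto simp: hc_def rc_def)
    ultimately show ?thesis using small by linarith
  qed
  note ci = cc.chart_inequality[OF C2N C1_on_subset[OF b(1) subset_UNIV] b(2) z(1-4) flux n1 n2 cCs CsU supp]
  have ci': "integrable lborel (\<lambda>x. indicator U x * (sqrt (det (cc.G x)) * f x))"
    "(\<integral>x. indicator U x * (sqrt (det (cc.G x)) * f x) \<partial>lborel) \<le> 0" "continuous_on U f"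
    using ci unfolding f_def by auto
  have cf': "continuous_map (subtopology X V) euclidean f'"
  proof (rule continuous_map_chart[OF c VM(1)])
    have "continuous_on U (f' \<circ> cinv c)"
      using ci'(3) by (rule continuous_on_cong[THEN iffD1, rotated 2]) (auto simp: ff')
    then show "continuous_on (snd c ` V) (f' \<circ> cinv c)" by (simp add: U_def)
  qed
  have Vs: "V \<in> sets \<mu>" using open_in_sets[OF oV] VM by (simp add: Int_absorb2)
  have FV: "F = (\<lambda>p. indicator V p * f' p)" by (simp add: F_def V_def f'_def fun_eq_iff)
  have Fm: "F \<in> borel_measurable \<mu>" unfolding FV by (rule continuous_measurable[OF Vs cf'])
  have F1: "(\<lambda>p. indicator (fst c \<inter> M) p * F p) = F" using VM by (auto simp: FV indicator_def fun_eq_iff)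
  have "indicator (Om c) x * (sqrt (det (Gc c x)) * F (cinv c x)) = indicator U x * (sqrt (det (cc.G x)) * f x)" for x
  proof (cases "x \<in> U")
    case True then show ?thesis using UO UV[OF True] ff'[OF True] by (auto simp: FV G)
  next
    case False
    then have "x \<in> Om c \<Longrightarrow> cinv c x \<notin> V" using cinv_Om[OF c, of x] by (force simp: U_def)
    then show ?thesis using False by (auto simp: FV indicator_def)
  qed
  then show "integrable \<mu> F" "(\<integral>p. F p \<partial>\<mu>) \<le> 0"
    using transfer[OF c Fm] ci' unfolding F1 by simp_all
qed

text \<open>Each patch sees the level as a Lebesgue null set, and \<mu> has a density in charts.
  Finitely many patches cover the level.\<close>

lemma level_null:
  assumes "finite I" and patch: "\<And>i. i \<in> I \<Longrightarrow> patch \<eta> (c i) (B i) (b i) (Kc i) (D i) (W i)"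
    and cover: "\<And>q. q \<in> E \<Longrightarrow> \<exists>i\<in>I. q \<in> W i"
  shows "emeasure \<mu> {p \<in> M. \<rho> p = exp (- 2 * R)} = 0"
proof -
  define L where "L = {p \<in> M. \<rho> p = exp (- 2 * R)}"
  have L: "L \<in> sets \<mu>" unfolding L_def by (rule sublevel_sets)
  define P where "P i = L \<inter> (W i \<inter> M)" for i
  have Wi: "c i \<in> A" "openin X (W i)" "W i \<subseteq> fst (c i)" "\<And>q. q \<in> W i \<Longrightarrow> snd (c i) q \<in> B i"
    "emeasure lborel {x \<in> B i \<inter> Om (c i). \<rho> (cinv (c i) x) = exp (- 2 * R)} = 0" "open (B i)" if "i \<in> I" for i
    using patch[OF that] by (auto simp: patch_def)
  have P: "P i \<in> sets \<mu>" if "i \<in> I" for i unfolding P_def using L open_in_sets[OF Wi(2)[OF that]] by blast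
  have P0: "emeasure \<mu> (P i) = 0" if i: "i \<in> I" for i
  proof -
    let ?S = "{x \<in> B i \<inter> Om (c i). \<rho> (cinv (c i) x) = exp (- 2 * R)}"
    have sub: "snd (c i) ` P i \<subseteq> ?S"
      using Wi(1,3,4)[OF i] by (auto simp: P_def L_def Om_def)
    have "continuous_on (B i \<inter> Om (c i)) (\<lambda>x. \<rho> (cinv (c i) x))"
      using C1_on_continuous[OF C2_on_C1[OF conformal_chart.\<rho>[OF conformal[OF Wi(1)[OF i]]]]] continuous_on_subset by blast
    moreover have oV: "open (B i \<inter> Om (c i))" using open_Om[OF Wi(1)[OF i]] Wi(6)[OF i] by blast
    ultimately have "open {x \<in> B i \<inter> Om (c i). \<rho> (cinv (c i) x) \<in> - {exp (- 2 * R)}}"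
      by (intro open_Collect_continuous) auto
    moreover have "?S = (B i \<inter> Om (c i)) - {x \<in> B i \<inter> Om (c i). \<rho> (cinv (c i) x) \<in> - {exp (- 2 * R)}}" by auto
    ultimately have S: "?S \<in> sets borel" using oV by (simp only: sets.Diff borel_open)
    then have "?S \<in> null_sets lborel" using Wi(5)[OF i] by (simp add: null_sets_def)
    then have ae: "AE x in lborel. x \<notin> ?S" by (rule AE_not_in)
    have "emeasure \<mu> (P i) = (\<integral>\<^sup>+x. ennreal (sqrt (det (Gc (c i) x))) * indicator (snd (c i) ` P i) x \<partial>lborel)"
      using Wi(3)[OF i] by (intro emeasure_chart Wi(1) i P) (auto simp: P_def)
    also have "\<dots> = (\<integral>\<^sup>+x. 0 \<partial>(lborel :: (real^'n) measure))"
      using ae by (intro nn_integral_cong_AE) (use sub in \<open>auto simp: indicator_def elim!: eventually_mono\<close>)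
    finally show ?thesis by simp
  qed
  have "L \<subseteq> (\<Union>i\<in>I. P i)"
  proof
    fix q assume q: "q \<in> L"
    then have "q \<in> E" by (auto simp: L_def E_eq)
    then obtain i where "i \<in> I" "q \<in> W i" using cover by blast
    then show "q \<in> (\<Union>i\<in>I. P i)" using q by (auto simp: P_def L_def)
  qed
  then have "emeasure \<mu> L \<le> emeasure \<mu> (\<Union>i\<in>I. P i)" using P assms(1) by (intro emeasure_mono) auto
  also have "\<dots> \<le> (\<Sum>i\<in>I. emeasure \<mu> (P i))" using P assms(1) by (intro emeasure_subadditive_finite) auto
  also have "\<dots> = 0" using P0 by simp
  finally show ?thesis by (simp add: L_def)
qed

text \<open>The patch inequalities are added. The sum of the bumps is at least 1 on the end, which
  keeps the energy term, and at most the sum of the \<open>D i\<close>, which bounds the coefficient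
  of \<open>T2\<close>. Their gradients cost at most \<open>C * exp (- 2 * R)\<close> times that
  sum, which is half of \<open>cc\<close> by \<open>small(4)\<close>.\<close>

lemma weighted_estimate:
  fixes s Kc0 \<kappa> cc C \<eta>' \<eta> :: real
  assumes I: "finite I" and patch: "\<And>i. i \<in> I \<Longrightarrow> patch \<eta> (c i) (B i) (b i) (Kc i) (D i) (W i)"
    and cover: "\<And>q. q \<in> E \<Longrightarrow> \<exists>i\<in>I. q \<in> W i"
    and small: "\<eta> \<le> \<eta>'" "real CARD('n) * \<eta> \<le> \<eta>' / 2" "\<And>i. i \<in> I \<Longrightarrow> exp (- 2 * R) * D i \<le> \<eta>' / 2"
      "C * exp (- 2 * R) * (\<Sum>i\<in>I. D i) \<le> cc / 2"
    and pos: "cc > 0" "C > 0"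
    and flux: "\<And>(a::real^'n) v d T E N b z z'. \<lbrakk>b \<ge> 0; z \<ge> 0; z' \<ge> 0; \<bar>a \<bullet> a - 1\<bar> \<le> \<eta>'; norm E \<le> \<eta>'\<rbrakk> \<Longrightarrow>
       z * (b * (cc * (N\<^sup>2 + v \<bullet> v) - C * (norm T)\<^sup>2) - C * norm d * (N\<^sup>2 + v \<bullet> v))
       \<le> mult_flux s Kc0 \<kappa> a v d T E N b z z'"
  shows "(\<integral>p. indicator E p * (energy p * \<rho> p powr (2 * s)) \<partial>\<mu>)
     \<le> 2 * C * (\<Sum>i\<in>I. D i) / cc * (\<integral>p. indicator E p * (T2 p * \<rho> p powr (2 * s)) \<partial>\<mu>)"
proof -
  define r where "r = exp (- 2 * R)"
  define Ds where "Ds = (\<Sum>i\<in>I. D i)"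
  define eE where "eE p = indicator E p * (energy p * \<rho> p powr (2 * s))" for p
  define tE where "tE p = indicator E p * (T2 p * \<rho> p powr (2 * s))" for p
  \<comment> \<open>The shift by 1 makes \<open>z m\<close> vanish up to
    \<open>t = 2 * R + 1 / Suc m\<close>, leaving room to the inner boundary for each
    \<open>m\<close>, while \<open>z m\<close> tends to 1 at every \<open>t > 2 * R\<close>.\<close>
  define z where "z m t = cutoff (real (Suc m) * (t - 2 * R) - 1)" for m :: nat and t
  define z' where "z' m t = real (Suc m) * cutoff' (real (Suc m) * (t - 2 * R) - 1)" for m :: nat and t
  define Z where "Z m p = indicator M' p * z m (- ln (\<rho> p))" for m p
  have D0: "0 \<le> D i" if "i \<in> I" for i
  proof -
    have "0 \<le> b i 0 \<and> b i 0 \<le> D i" using patch[OF that] unfolding patch_def by blast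
    then show ?thesis by linarith
  qed
  have ie: "integrable \<mu> eE" "integrable \<mu> tE"
    using integrable_energy[of "2 * s"] integrable_T2[of "2 * s"] by (simp_all add: eE_def[abs_def] tE_def[abs_def])
  have z01: "0 \<le> z m t" "z m t \<le> 1" for m t using cutoff_bounds by (auto simp: z_def)
  have cz: "continuous_on UNIV (z m)" for m
  proof -
    have "isCont cutoff y" for y using DERIV_cutoff[of y] by (rule DERIV_isCont)
    then have "continuous_on UNIV cutoff" by (simp add: continuous_at_imp_continuous_on)
    then show ?thesis unfolding z_def by (rule continuous_on_compose2) (auto intro!: continuous_intros)
  qed
  have Zm: "Z m \<in> borel_measurable \<mu>" for m
  proof -
    have "continuous_map (subtopology X M) euclidean \<rho>" using continuous_rho continuous_map_from_subtopology by blast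
    from continuous_measurable[OF M_in_sets this]
    have [measurable]: "(\<lambda>p. indicator M p * \<rho> p) \<in> borel_measurable \<mu>" .
    have [measurable]: "z m \<in> borel_measurable borel" using cz by (rule borel_measurable_continuous_onI)
    have [measurable]: "M' \<in> sets \<mu>" by (rule M'_sets)
    have "(\<lambda>p. indicator M' p * z m (- ln (indicator M p * \<rho> p))) \<in> borel_measurable \<mu>" by measurable
    moreover have "(\<lambda>p. indicator M' p * z m (- ln (indicator M p * \<rho> p))) = Z m"
      by (auto simp: Z_def fun_eq_iff indicator_def M'_def)
    ultimately show ?thesis by simp
  qed
  have Zb: "0 \<le> Z m p" "Z m p \<le> 1" for m p using z01 by (auto simp: Z_def indicator_def)
  have iZ: "integrable \<mu> (\<lambda>p. Z m p * f p)" if "integrable \<mu> f" for m and f :: "'a \<Rightarrow> real"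
  proof (rule Bochner_Integration.integrable_bound[OF that])
    show "(\<lambda>p. Z m p * f p) \<in> borel_measurable \<mu>" using Zm that by (intro borel_measurable_times) auto
    show "AE p in \<mu>. norm (Z m p * f p) \<le> norm (f p)"
      using Zb by (intro AE_I2) (auto simp: abs_mult intro: mult_left_le_one_le)
  qed
  have key: "cc / 2 * (\<integral>p. Z m p * eE p \<partial>\<mu>) \<le> C * Ds * (\<integral>p. tE p \<partial>\<mu>)" for m
  proof -
    define F where "F i p = indicator {p \<in> fst (c i) \<inter> M'. snd (c i) p \<in> B i} p * (\<rho> p powr (2 * s) * (z m (- ln (\<rho> p)) *
      (b i (snd (c i) p) * (cc * energy p - C * T2 p)
       - C * (\<rho> p * sqrt (norm2_vec (h (c i) p) (grad (b i) (snd (c i) p)))) * energy p)))" for i p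
    have F: "integrable \<mu> (F i)" "(\<integral>p. F i p \<partial>\<mu>) \<le> 0" if i: "i \<in> I" for i
    proof -
      have d: "DERIV (z m) t :> z' m t" for t
      proof -
        have "DERIV (\<lambda>t. real (Suc m) * (t - 2 * R) - 1) t :> real (Suc m)" by (auto intro!: derivative_eq_intros)
        from DERIV_chain2[OF DERIV_cutoff this]
        show ?thesis unfolding z_def[abs_def] z'_def by (simp only: mult.commute[of "cutoff' _"])
      qed
      have c': "continuous_on UNIV (z' m)" unfolding z'_def[abs_def]
        by (intro continuous_intros continuous_on_compose2[OF continuous_cutoff']) auto
      have p': "z' m t \<ge> 0" for t using cutoff_bounds(3) by (simp add: z'_def)
      have v: "z m t = 0" if "t \<le> 2 * R + 1 / real (Suc m)" for t
      proof -
        have "real (Suc m) * (t - 2 * R) \<le> real (Suc m) * (1 / real (Suc m))" using that by (intro mult_left_mono) auto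
        then show ?thesis unfolding z_def by (intro cutoff_bounds(4)) simp
      qed
      note pi = patch_inequality[OF patch[OF i] small(1,2) small(3)[OF i] d c' z01(1) p' v _ flux, folded F_def[abs_def]]
      show "integrable \<mu> (F i)" "(\<integral>p. F i p \<partial>\<mu>) \<le> 0" using pi unfolding F_def[abs_def] by auto
    qed
    have low: "Z m p * (cc / 2 * eE p - C * Ds * tE p) \<le> (\<Sum>i\<in>I. F i p)" for p
    proof (cases "p \<in> M'")
      case False
      then show ?thesis by (auto simp: Z_def F_def)
    next
      case True
      then have pE: "p \<in> E" "p \<in> M" "\<rho> p < r" using M'_E E_M by (auto simp: M'_def r_def)
      have rp: "0 < \<rho> p" using pE M_eq by auto
      define w where "w = \<rho> p powr (2 * s) * z m (- ln (\<rho> p))"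
      have w: "w \<ge> 0" using z01 by (simp add: w_def)
      \<comment> \<open>The bump extended by zero off its patch, so that all patches can be summed
        at the same point.\<close>
      define \<beta> where "\<beta> i = (if p \<in> fst (c i) \<and> snd (c i) p \<in> B i then b i (snd (c i) p) else 0)" for i
      have \<beta>: "0 \<le> \<beta> i" "\<beta> i \<le> D i" if "i \<in> I" for i
        using patch[OF that] D0[OF that] unfolding patch_def \<beta>_def by auto
      have "\<exists>i\<in>I. 1 \<le> \<beta> i"
      proof -
        obtain i where i: "i \<in> I" "p \<in> W i" using cover[OF pE(1)] by blast
        have "\<forall>q\<in>W i. q \<in> fst (c i) \<and> snd (c i) q \<in> B i \<and> 1 \<le> b i (snd (c i) q)"
          using patch[OF i(1)] unfolding patch_def by blast
        then show ?thesis using i by (auto simp: \<beta>_def)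
      qed
      then obtain i0 where "i0 \<in> I" "1 \<le> \<beta> i0" by blast
      moreover have "\<beta> i0 \<le> (\<Sum>i\<in>I. \<beta> i)" using \<beta>(1) I \<open>i0 \<in> I\<close> by (intro member_le_sum) auto
      ultimately have s1: "1 \<le> (\<Sum>i\<in>I. \<beta> i)" by linarith
      have s2: "(\<Sum>i\<in>I. \<beta> i) \<le> Ds" unfolding Ds_def using \<beta>(2) by (rule sum_mono)
      have Fi: "F i p \<ge> w * (\<beta> i * (cc * energy p) - \<beta> i * (C * T2 p) - C * r * D i * energy p)" if i: "i \<in> I" for i
      proof (cases "p \<in> fst (c i) \<and> snd (c i) p \<in> B i")
        case False
        then have "F i p = 0" "\<beta> i = 0" by (auto simp: F_def \<beta>_def)
        moreover have "0 \<le> C * r * D i * energy p" using pos D0[OF i] energy_nonneg by (simp add: r_def)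
        ultimately show ?thesis using w by (simp add: mult_nonneg_nonneg mult_le_0_iff)
      next
        case True
        define q where "q = sqrt (norm2_vec (h (c i) p) (grad (b i) (snd (c i) p)))"
        have ci: "c i \<in> A" using patch[OF i] by (simp add: patch_def)
        have "snd (c i) p \<in> B i \<inter> Om (c i)" using True snd_Om[OF ci] pE by auto
        then have "sqrt (norm2_vec (h (c i) (cinv (c i) (snd (c i) p))) (grad (b i) (snd (c i) p))) \<le> D i"
          using patch[OF i] unfolding patch_def by blast
        then have q: "q \<le> D i" using ci True by (simp add: q_def)
        have "\<rho> p * q \<le> r * D i" using pE(3) rp q D0[OF i] by (intro mult_mono) (auto simp: q_def r_def norm2_vec_nonneg posdef_h_chart ci True)
        then have "C * (\<rho> p * q) * energy p \<le> C * (r * D i) * energy p"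
          using pos energy_nonneg by (intro mult_right_mono mult_left_mono) auto
        then have "\<beta> i * (cc * energy p) - \<beta> i * (C * T2 p) - C * r * D i * energy p
            \<le> \<beta> i * (cc * energy p - C * T2 p) - C * (\<rho> p * q) * energy p" by (simp add: algebra_simps)
        moreover have "F i p = w * (\<beta> i * (cc * energy p - C * T2 p) - C * (\<rho> p * q) * energy p)"
          using True \<open>p \<in> M'\<close> by (simp add: F_def w_def q_def \<beta>_def)
        ultimately show ?thesis using w by (simp add: mult_left_mono)
      qed
      have "(\<Sum>i\<in>I. F i p) \<ge> (\<Sum>i\<in>I. w * (\<beta> i * (cc * energy p) - \<beta> i * (C * T2 p) - C * r * D i * energy p))"
        using Fi by (rule sum_mono)
      also have "(\<Sum>i\<in>I. w * (\<beta> i * (cc * energy p) - \<beta> i * (C * T2 p) - C * r * D i * energy p))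
          = w * ((\<Sum>i\<in>I. \<beta> i) * (cc * energy p) - (\<Sum>i\<in>I. \<beta> i) * (C * T2 p) - C * r * Ds * energy p)"
        by (simp add: sum_distrib_left[symmetric] sum_subtractf sum_distrib_right[symmetric] Ds_def)
      finally have "(\<Sum>i\<in>I. F i p) \<ge> w * ((\<Sum>i\<in>I. \<beta> i) * (cc * energy p) - (\<Sum>i\<in>I. \<beta> i) * (C * T2 p) - C * r * Ds * energy p)" .
      moreover have "w * (cc / 2 * energy p - C * Ds * T2 p)
          \<le> w * ((\<Sum>i\<in>I. \<beta> i) * (cc * energy p) - (\<Sum>i\<in>I. \<beta> i) * (C * T2 p) - C * r * Ds * energy p)"
      proof (rule mult_left_mono[OF _ w])
        have "1 * (cc * energy p) \<le> (\<Sum>i\<in>I. \<beta> i) * (cc * energy p)"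
          using s1 pos energy_nonneg by (intro mult_right_mono) auto
        moreover have "(\<Sum>i\<in>I. \<beta> i) * (C * T2 p) \<le> Ds * (C * T2 p)"
          using s2 pos T2_nonneg by (intro mult_right_mono) auto
        moreover have "C * r * Ds * energy p \<le> cc / 2 * energy p"
          using small(4) energy_nonneg unfolding r_def Ds_def by (intro mult_right_mono) auto
        ultimately show "cc / 2 * energy p - C * Ds * T2 p
            \<le> (\<Sum>i\<in>I. \<beta> i) * (cc * energy p) - (\<Sum>i\<in>I. \<beta> i) * (C * T2 p) - C * r * Ds * energy p"
          by (simp add: algebra_simps)
      qed
      moreover have "Z m p * (cc / 2 * eE p - C * Ds * tE p) = w * (cc / 2 * energy p - C * Ds * T2 p)"
        using True pE by (simp add: Z_def eE_def tE_def w_def algebra_simps)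
      ultimately show ?thesis by linarith
    qed
    have "(\<integral>p. Z m p * (cc / 2 * eE p - C * Ds * tE p) \<partial>\<mu>) \<le> (\<integral>p. (\<Sum>i\<in>I. F i p) \<partial>\<mu>)"
      using ie F low by (intro integral_mono iZ Bochner_Integration.integrable_sum Bochner_Integration.integrable_diff integrable_mult_right) auto
    also have "\<dots> = (\<Sum>i\<in>I. \<integral>p. F i p \<partial>\<mu>)" using F by (intro Bochner_Integration.integral_sum) auto
    also have "\<dots> \<le> 0" using F by (intro sum_nonpos) auto
    finally have "(\<integral>p. cc / 2 * (Z m p * eE p) - C * Ds * (Z m p * tE p) \<partial>\<mu>) \<le> 0" by (simp add: algebra_simps)
    then have "cc / 2 * (\<integral>p. Z m p * eE p \<partial>\<mu>) - C * Ds * (\<integral>p. Z m p * tE p \<partial>\<mu>) \<le> 0"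
      using iZ[OF ie(1), of m] iZ[OF ie(2), of m] by simp
    moreover have "(\<integral>p. Z m p * tE p \<partial>\<mu>) \<le> (\<integral>p. tE p \<partial>\<mu>)"
    proof (rule integral_mono[OF iZ[OF ie(2)] ie(2)])
      have "0 \<le> tE p" for p using T2_nonneg[of p] by (simp add: tE_def)
      then show "Z m p * tE p \<le> tE p" for p using Zb[of m p] by (intro mult_left_le_one_le)
    qed
    then have "C * Ds * (\<integral>p. Z m p * tE p \<partial>\<mu>) \<le> C * Ds * (\<integral>p. tE p \<partial>\<mu>)"
      using pos D0 by (intro mult_left_mono) (auto simp: Ds_def intro!: sum_nonneg mult_nonneg_nonneg)
    ultimately show ?thesis by linarith
  qed
  \<comment> \<open>The bound \<open>key\<close> is uniform in \<open>m\<close>; dominated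
    convergence removes the cutoff on the open part of the end.\<close>
  have "(\<lambda>m. \<integral>p. Z m p * eE p \<partial>\<mu>) \<longlonglongrightarrow> (\<integral>p. indicator M' p * eE p \<partial>\<mu>)"
  proof (rule integral_dominated_convergence[where w = "\<lambda>p. norm (eE p)"])
    show "(\<lambda>p. indicator M' p * eE p) \<in> borel_measurable \<mu>" using ie(1) M'_sets by (intro borel_measurable_times) auto
    show "(\<lambda>p. Z m p * eE p) \<in> borel_measurable \<mu>" for m using iZ[OF ie(1)] by auto
    show "integrable \<mu> (\<lambda>p. norm (eE p))" using ie(1) by (rule integrable_norm)
    show "AE p in \<mu>. norm (Z m p * eE p) \<le> norm (eE p)" for m
      using Zb by (intro AE_I2) (auto simp: abs_mult intro: mult_left_le_one_le)
    have "(\<lambda>m. Z m p) \<longlonglongrightarrow> indicator M' p" for p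
    proof (cases "p \<in> M'")
      case False then show ?thesis by (simp add: Z_def)
    next
      case True
      define a where "a = - ln (\<rho> p) - 2 * R"
      have rp: "0 < \<rho> p" "\<rho> p < exp (- 2 * R)" using True M_eq by (auto simp: M'_def)
      then have "ln (\<rho> p) < - 2 * R" by (metis exp_less_cancel_iff exp_ln)
      then have a: "a > 0" by (simp add: a_def)
      have "filterlim (\<lambda>m. a * real (Suc m)) at_top sequentially"
        by (intro filterlim_tendsto_pos_mult_at_top[OF tendsto_const a]
            filterlim_compose[OF filterlim_real_sequentially filterlim_Suc])
      then have "filterlim (\<lambda>m. - 1 + a * real (Suc m)) at_top sequentially"
        by (intro filterlim_tendsto_add_at_top[OF tendsto_const])
      from tendsto_cutoff[OF this]
      have "(\<lambda>m. cutoff (- 1 + a * real (Suc m))) \<longlonglongrightarrow> 1" .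
      moreover have "Z m p = cutoff (- 1 + a * real (Suc m))" for m
        using True by (simp add: Z_def z_def a_def mult.commute del: of_nat_Suc)
      ultimately show ?thesis using True by simp
    qed
    then show "AE p in \<mu>. (\<lambda>m. Z m p * eE p) \<longlonglongrightarrow> indicator M' p * eE p"
      by (intro AE_I2 tendsto_mult tendsto_const)
  qed
  then have "(\<lambda>m. cc / 2 * (\<integral>p. Z m p * eE p \<partial>\<mu>)) \<longlonglongrightarrow> cc / 2 * (\<integral>p. indicator M' p * eE p \<partial>\<mu>)"
    by (rule tendsto_mult_left)
  then have fin: "cc / 2 * (\<integral>p. indicator M' p * eE p \<partial>\<mu>) \<le> C * Ds * (\<integral>p. tE p \<partial>\<mu>)"
    using key by (intro LIMSEQ_le_const2) auto
  \<comment> \<open>The inner boundary itself carries no mass.\<close>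
  have "(\<integral>p. indicator M' p * eE p \<partial>\<mu>) = (\<integral>p. eE p \<partial>\<mu>)"
  proof (rule integral_cong_AE)
    show "(\<lambda>p. indicator M' p * eE p) \<in> borel_measurable \<mu>" "eE \<in> borel_measurable \<mu>"
      using ie(1) M'_sets by (auto intro!: borel_measurable_times)
    have "{p \<in> M. \<rho> p = exp (- 2 * R)} \<in> null_sets \<mu>"
      using level_null[OF I patch cover] sublevel_sets(3) by (simp add: null_sets_def)
    from AE_not_in[OF this]
    show "AE p in \<mu>. indicator M' p * eE p = eE p"
      by (rule eventually_mono) (auto simp: eE_def M'_def E_eq indicator_def)
  qed
  with fin have "(\<integral>p. eE p \<partial>\<mu>) \<le> 2 * C * Ds / cc * (\<integral>p. tE p \<partial>\<mu>)"
    using pos by (simp add: field_simps)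
  then show ?thesis by (simp add: eE_def tE_def Ds_def)
qed

end

section \<open>Choice of the constants and conclusion\<close>

theorem proposition4:
  fixes X :: "'a topology" and A :: "('a, 'n::finite) chart set"
    and \<rho> :: "'a \<Rightarrow> real" and h g :: "('a, 'n) metric" and \<mu> :: "'a measure"
  assumes "asymptotically_hyperbolic X A \<rho> h"
    and "g = ah_metric \<rho> h"
    and "riemannian_measure X A (interior_part X A) g \<mu>"
  shows "\<forall>\<epsilon>::real. \<epsilon> > 0 \<longrightarrow> (\<forall>\<delta>::real. - (real CARD('n) + 1) / 2 < \<delta> \<and> \<delta> < -1 \<longrightarrow>
    (\<exists>R\<^sub>0>0. \<forall>R>R\<^sub>0. \<exists>c>0. \<forall>N \<in> smooth_compact_support X A (end_set X A \<rho> R).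
       weighted_sobolev_norm A g \<rho> \<mu> 2 (- \<delta>) (end_set X A \<rho> R) N
         \<le> c * weighted_norm A g \<rho> \<mu> (- \<delta>) (end_set X A \<rho> R) 2 (T_op g (end_set X A \<rho> R) N)))"
proof (intro allI impI)
  fix \<epsilon> \<delta> :: real
  assume \<delta>: "- (real CARD('n) + 1) / 2 < \<delta> \<and> \<delta> < -1"
  interpret ah_manifold X A \<rho> h by unfold_locales (rule assms(1))
  define s where "s = - \<delta>"
  define n where "n = real CARD('n)"
  have s: "s < (real CARD('n) + 1) / 2" using \<delta> by (simp add: s_def)
  \<comment> \<open>The two bounds on \<delta> are compatible only if
    \<open>(n + 1) / 2 > 1\<close>; this supplies the dimension bound for the multiplier.\<close>
  have "real CARD('n) > 1" using \<delta> by (auto simp: field_simps)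
  then have n2: "CARD('n) \<ge> 2" by linarith
  have n: "n \<ge> 1" using n2 by (simp add: n_def)
  show "\<exists>R\<^sub>0>0. \<forall>R>R\<^sub>0. \<exists>c>0. \<forall>N \<in> smooth_compact_support X A (end_set X A \<rho> R).
       weighted_sobolev_norm A g \<rho> \<mu> 2 (- \<delta>) (end_set X A \<rho> R) N
         \<le> c * weighted_norm A g \<rho> \<mu> (- \<delta>) (end_set X A \<rho> R) 2 (T_op g (end_set X A \<rho> R) N)"
  proof (rule multiplier_pointwise[OF n2 s])
    fix Kc0 \<kappa> cc C \<eta>' :: real
    assume pos: "Kc0 > 0" "\<kappa> > 0" "cc > 0" "C > 0" "\<eta>' > 0"
      and flux: "\<And>(a::real^'n) v d T E N b z z'. \<lbrakk>b \<ge> 0; z \<ge> 0; z' \<ge> 0; \<bar>a \<bullet> a - 1\<bar> \<le> \<eta>'; norm E \<le> \<eta>'\<rbrakk> \<Longrightarrow>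
       z * (b * (cc * (N\<^sup>2 + v \<bullet> v) - C * (norm T)\<^sup>2) - C * norm d * (N\<^sup>2 + v \<bullet> v))
       \<le> mult_flux s Kc0 \<kappa> a v d T E N b z z'"
    \<comment> \<open>The first entry leaves half of \<eta>' for the Hessian of \<rho>; the bound
      1/2 keeps \<open>|d\<rho>|\<^sup>2\<close> away from 0, which gives
      \<open>regular\<close>.\<close>
    define \<eta> where "\<eta> = min (\<eta>' / (2 * n)) (1 / 2)"
    have \<eta>: "\<eta> > 0" using pos n by (simp add: \<eta>_def)
    have "n * \<eta> \<le> n * (\<eta>' / (2 * n))" using n by (intro mult_left_mono) (auto simp: \<eta>_def)
    then have \<eta>2: "n * \<eta> \<le> \<eta>' / 2" using n by simp
    have \<eta>1: "\<eta> \<le> \<eta>'" using \<eta>2 mult_right_mono[OF n, of \<eta>] \<eta> pos by linarith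
    show ?thesis
    proof (rule boundary_cover[OF \<eta>])
      fix I :: "'a set" and c B b Kc D W and r0 :: real
      assume I: "finite I" and patch: "\<And>i. i \<in> I \<Longrightarrow> patch \<eta> (c i) (B i) (b i) (Kc i) (D i) (W i)"
        and r0: "r0 > 0" and cover: "\<And>q. q \<in> topspace X \<Longrightarrow> \<rho> q \<le> r0 \<Longrightarrow> \<exists>i\<in>I. q \<in> W i"
      define Ds where "Ds = (\<Sum>i\<in>I. D i)"
      have D0: "0 \<le> D i" if "i \<in> I" for i
      proof -
        have "0 \<le> b i 0 \<and> b i 0 \<le> D i" using patch[OF that] unfolding patch_def by blast
        then show ?thesis by linarith
      qed
      have Ds: "0 \<le> Ds" "D i \<le> Ds + 1" if "i \<in> I" for i
        using D0 member_le_sum[OF that, of D] I by (auto simp: Ds_def intro!: sum_nonneg)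
      have cancel: "x / (y * q) * q = x / y" if "q \<noteq> 0" for x y q :: real using that by simp
      have Ds0: "0 \<le> Ds" using D0 by (auto simp: Ds_def intro!: sum_nonneg)
      \<comment> \<open>Below \<open>r0\<close> the patches cover; the other two entries give the
        smallness conditions of \<open>weighted_estimate\<close>. \<open>Ds + 1\<close> avoids
        division by zero.\<close>
      define r1 where "r1 = min r0 (min (\<eta>' / (2 * (Ds + 1))) (cc / (2 * C * (Ds + 1))))"
      have r1: "r1 > 0" using r0 pos Ds0 by (simp add: r1_def)
      define Cq where "Cq = 2 * C * Ds / cc"
      have Cq: "Cq \<ge> 0" using pos Ds0 by (simp add: Cq_def)
      \<comment> \<open>Orders 0 and 1 of the Sobolev norm contribute \<open>sqrt Cq\<close> each,
        and the Hessian the last root, by \<open>hess_norm_le\<close>. The constant does not depend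
        on \<open>R\<close>.\<close>
      define k where "k = 2 * sqrt Cq + sqrt (2 + 2 * n * Cq)"
      have k: "k > 0" using Cq n by (simp add: k_def add_nonneg_pos add_pos_nonneg)
      show ?thesis
      proof (rule exI[of _ "max 1 (- ln r1 / 2)"], intro conjI allI impI)
        show "0 < max 1 (- ln r1 / 2)" by simp
        fix R assume R: "max 1 (- ln r1 / 2) < R"
        then have "- 2 * R < ln r1" by simp
        then have Rr: "exp (- 2 * R) < r1" using r1 by (metis exp_less_cancel_iff exp_ln)
        have sm3: "exp (- 2 * R) * D i \<le> \<eta>' / 2" if "i \<in> I" for i
        proof -
          have "exp (- 2 * R) * D i \<le> (\<eta>' / (2 * (Ds + 1))) * (Ds + 1)"
            using Rr D0[OF that] Ds[OF that] pos by (intro mult_mono) (auto simp: r1_def)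
          also have "\<dots> = \<eta>' / 2" using Ds0 by (intro cancel) auto
          finally show ?thesis .
        qed
        have sm4: "C * exp (- 2 * R) * (\<Sum>i\<in>I. D i) \<le> cc / 2"
        proof -
          have "exp (- 2 * R) * Ds \<le> (cc / (2 * C * (Ds + 1))) * (Ds + 1)"
            using Rr Ds0 pos by (intro mult_mono) (auto simp: r1_def)
          also have "\<dots> = cc / (2 * C)" using Ds0 by (intro cancel) auto
          finally have "C * (exp (- 2 * R) * Ds) \<le> C * (cc / (2 * C))" using pos by (intro mult_left_mono) auto
          then show ?thesis using pos by (simp add: Ds_def mult.assoc)
        qed
        have coverE: "\<exists>i\<in>I. q \<in> W i" if "q \<in> end_set X A \<rho> R" for q
          using that Rr M_subset by (intro cover) (auto simp: end_set_def r1_def)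
        have reg: "grad (\<lambda>x. \<rho> (cinv c' x)) (snd c' p) \<noteq> 0"
          if p: "c' \<in> A" "p \<in> fst c'" "p \<in> end_set X A \<rho> R" for c' p
        proof -
          obtain i where i: "i \<in> I" "p \<in> W i" using coverE[OF p(3)] by blast
          have pM: "p \<in> M" using p by (auto simp: end_set_def)
          have ci: "c i \<in> A" "p \<in> fst (c i)" "snd (c i) p \<in> B i" using patch[OF i(1)] i(2) by (auto simp: patch_def)
          have "snd (c i) p \<in> B i \<inter> Om (c i)" using ci snd_Om[OF ci(1,2) pM] by blast
          then have "\<bar>norm2_vec (h (c i) (cinv (c i) (snd (c i) p))) (grad (\<lambda>x. \<rho> (cinv (c i) x)) (snd (c i) p)) - 1\<bar> \<le> \<eta>"
            using patch[OF i(1)] unfolding patch_def by blast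
          moreover have "\<eta> \<le> 1 / 2" by (simp add: \<eta>_def)
          ultimately have "grad (\<lambda>x. \<rho> (cinv (c i) x)) (snd (c i) p) \<noteq> 0" by (auto simp: norm2_vec_def)
          then show ?thesis by (rule grad_rho_nonzero_transfer[OF ci(1) p(1) ci(2) p(2) pM])
        qed
        show "\<exists>c>0. \<forall>N \<in> smooth_compact_support X A (end_set X A \<rho> R).
           weighted_sobolev_norm A g \<rho> \<mu> 2 (- \<delta>) (end_set X A \<rho> R) N
             \<le> c * weighted_norm A g \<rho> \<mu> (- \<delta>) (end_set X A \<rho> R) 2 (T_op g (end_set X A \<rho> R) N)"
        proof (intro exI[of _ k] conjI ballI k)
          fix N assume N: "N \<in> smooth_compact_support X A (end_set X A \<rho> R)"
          interpret f: ah_measured_function X A \<rho> h R N \<mu>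
            by unfold_locales (use reg N assms(2,3) in auto)
          let ?E = "end_set X A \<rho> R"
          define \<tau> where "\<tau> = (\<integral>p. indicator ?E p * (f.T2 p * \<rho> p powr (2 * s)) \<partial>\<mu>)"
          have \<tau>0: "\<tau> \<ge> 0" unfolding \<tau>_def using f.T2_nonneg by (intro Bochner_Integration.integral_nonneg) auto
          have est: "(\<integral>p. indicator ?E p * (f.energy p * \<rho> p powr (2 * s)) \<partial>\<mu>) \<le> Cq * \<tau>"
            using f.weighted_estimate[OF I patch coverE \<eta>1 \<eta>2[unfolded n_def] sm3 sm4 pos(3,4) flux]
            by (simp add: Cq_def Ds_def \<tau>_def)
          have wT: "weighted_norm A g \<rho> \<mu> s ?E 2 (T_op g ?E N) = sqrt \<tau>"
            by (simp add: weighted_norm_def set_lebesgue_integral_def \<tau>_def f.T2_def assms(2))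
          have bound: "weighted_norm A g \<rho> \<mu> s ?E j T \<le> sqrt (a * Cq * \<tau> + a' * \<tau>)"
            if "\<And>p. p \<in> ?E \<Longrightarrow> (tensor_norm A g j T p)\<^sup>2 \<le> a * f.energy p + a' * f.T2 p" "0 \<le> a" "0 \<le> a'" for j T a a'
          proof -
            let ?e = "\<lambda>p. indicator ?E p * (f.energy p * \<rho> p powr (2 * s))"
            let ?t = "\<lambda>p. indicator ?E p * (f.T2 p * \<rho> p powr (2 * s))"
            have "(\<integral>p. indicator ?E p *\<^sub>R ((tensor_norm A g j T p)\<^sup>2 * \<rho> p powr (2 * s)) \<partial>\<mu>) \<le> (\<integral>p. a * ?e p + a' * ?t p \<partial>\<mu>)"
            proof (rule integral_mono')
              show "integrable \<mu> (\<lambda>p. a * ?e p + a' * ?t p)"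
                by (intro Bochner_Integration.integrable_add integrable_mult_right f.integrable_energy f.integrable_T2)
              show "0 \<le> a * ?e p + a' * ?t p" for p
                using that f.energy_nonneg[of p] f.T2_nonneg[of p] by (intro add_nonneg_nonneg mult_nonneg_nonneg) auto
              show "indicator ?E p *\<^sub>R ((tensor_norm A g j T p)\<^sup>2 * \<rho> p powr (2 * s)) \<le> a * ?e p + a' * ?t p" for p
              proof (cases "p \<in> ?E")
                case True
                from mult_right_mono[OF that(1)[OF True], of "\<rho> p powr (2 * s)"] True
                show ?thesis by (simp add: algebra_simps)
              qed simp
            qed
            also have "\<dots> = a * (\<integral>p. ?e p \<partial>\<mu>) + a' * \<tau>"
              using f.integrable_energy[of "2 * s"] f.integrable_T2[of "2 * s"] by (simp add: \<tau>_def)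
            also have "\<dots> \<le> a * (Cq * \<tau>) + a' * \<tau>" using est that by (intro add_mono mult_left_mono) auto
            finally show ?thesis by (simp add: weighted_norm_def set_lebesgue_integral_def mult.assoc)
          qed
          have b0: "weighted_norm A g \<rho> \<mu> s ?E 0 (scalar N) \<le> sqrt (Cq * \<tau>)"
            using bound[of 0 "scalar N" 1 0] f.V2_nonneg by (simp add: tensor_norm_0 scalar_def f.energy_def)
          have b1: "weighted_norm A g \<rho> \<mu> s ?E 1 (cov_deriv g ?E (scalar N)) \<le> sqrt (Cq * \<tau>)"
            using bound[of 1 "cov_deriv g ?E (scalar N)" 1 0]
            by (simp add: f.energy_def f.V2_def assms(2))
          have b2: "weighted_norm A g \<rho> \<mu> s ?E 2 (cov_deriv g ?E (cov_deriv g ?E (scalar N))) \<le> sqrt (2 * n * Cq * \<tau> + 2 * \<tau>)"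
          proof (rule bound)
            fix p assume "p \<in> ?E"
            from f.hess_norm_le[OF this]
            have "(tensor_norm A g 2 (cov_deriv g ?E (cov_deriv g ?E (scalar N))) p)\<^sup>2 \<le> 2 * f.T2 p + 2 * n * (N p)\<^sup>2"
              by (simp add: assms(2) n_def)
            also have "\<dots> \<le> 2 * f.T2 p + 2 * n * f.energy p"
              using f.V2_nonneg n by (intro add_mono mult_left_mono) (auto simp: f.energy_def)
            finally show "(tensor_norm A g 2 (cov_deriv g ?E (cov_deriv g ?E (scalar N))) p)\<^sup>2
                \<le> 2 * n * f.energy p + 2 * f.T2 p" by simp
          qed (use n in auto)
          have "weighted_sobolev_norm A g \<rho> \<mu> 2 s ?E N
             = weighted_norm A g \<rho> \<mu> s ?E 0 (scalar N) + weighted_norm A g \<rho> \<mu> s ?E 1 (cov_deriv g ?E (scalar N))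
               + weighted_norm A g \<rho> \<mu> s ?E 2 (cov_deriv g ?E (cov_deriv g ?E (scalar N)))"
            by (simp add: weighted_sobolev_norm_def numeral_2_eq_2)
          also have "\<dots> \<le> sqrt (Cq * \<tau>) + sqrt (Cq * \<tau>) + sqrt (2 * n * Cq * \<tau> + 2 * \<tau>)"
            using b0 b1 b2 by linarith
          also have "2 * n * Cq * \<tau> + 2 * \<tau> = (2 + 2 * n * Cq) * \<tau>" by (simp add: algebra_simps)
          also have "sqrt (Cq * \<tau>) + sqrt (Cq * \<tau>) + sqrt ((2 + 2 * n * Cq) * \<tau>) = k * sqrt \<tau>"
            unfolding k_def real_sqrt_mult by (simp add: distrib_right)
          finally show "weighted_sobolev_norm A g \<rho> \<mu> 2 (- \<delta>) ?E N
             \<le> k * weighted_norm A g \<rho> \<mu> (- \<delta>) ?E 2 (T_op g ?E N)"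
            by (simp only: wT s_def[symmetric])
        qed
      qed
    qed
  qed
qed

end
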